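(* Let $A$ be a unital $C^*$-algebra with the ideal property. Assume moreover that $A$ has strict comparison of projections and finitely many extremal quasitraces, and that the Cuntz semigroup $W(A)$ is almost unperforated. Then $A$ has weak strict comparison.
   Context: "Ideal" means closed two-sided ideal. A $C^*$-algebra $A$ has the ideal property if each of its ideals is generated (as an ideal) by the projections it contains. $M_\infty(A)$ is the algebraic inductive limit of the $M_n(A)$ under $x\mapsto x\oplus 0$, $M_\infty(A)^+$ is its set of positive elements and $\mathcal P(M_\infty(A))$ its set of projections. For $a,b\in M_\infty(A)^+$ write $a\precsim b$ if for some $n$ with $a,b\in M_n(A)$ there is a sequence $\{x_k\}$ in $M_n(A)$ with $a=\lim_k x_k b x_k^*$; write $a\sim b$ if $a\precsim b$ and $b\precsim a$. The Cuntz semigroup is $W(A)=M_\infty(A)^+/\!\sim$, with classes $\langle a\rangle$, addition $\langle a\rangle+\langle b\rangle=\langle a\oplus b\rangle$, and order $\langle a\rangle\le\langle b\rangle\iff a\precsim b$. $W(A)$ is almost unperforated if for all $x,y\in W(A)$ and all $m,n\in\mathbb N$ (positive integers) with $nx\le my$ and $n>m$, one has $x\le y$. A dimension function on $A$ is an additive order preserving function $d:W(A)\to[0,\infty]$; equivalently, a function $d:M_\infty(A)^+\to[0,\infty]$ with $d(a\oplus b)=d(a)+d(b)$ and $a\precsim b\Rightarrow d(a)\le d(b)$. $DF(A)$ is the set of all dimension functions on $A$. For $A$ unital, a (normalized) quasitrace on $A$ is a function $\tau:A\to\mathbb C$ such that: (i) $\tau(1)=1$; (ii) $0\le\tau(xx^*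 )=\tau(x^*x)$ for all $x\in A$; (iii) $\tau(a+ib)=\tau(a)+i\tau(b)$ for all self-adjoint $a,b\in A$; (iv) $\tau$ is linear on abelian sub-$C^*$-algebras of $A$; (v) for every $n$, $\tau$ extends (along $x\mapsto x\oplus 0$) to a function $M_n(A)\to\mathbb C$ satisfying (ii)-(iv). $QT(A)$ is the (convex) set of all normalized quasitraces on $A$; extremal quasitraces are its extreme points. For $\tau\in QT(A)$, $d_\tau(a)=\lim_{n\to\infty}\tau(a^{1/n})$ for $a\in M_\infty(A)^+$; this is a dimension function. A unital $C^*$-algebra $A$ with $QT(A)\ne\emptyset$ has strict comparison of projections if $p\precsim q$ whenever $p,q\in\mathcal P(M_\infty(A))$ satisfy $\tau(p)<\tau(q)$ for every $\tau\in QT(A)$. A unital $C^*$-algebra $A$ with $QT(A)\ne\emptyset$ has weak strict comparison if $a\precsim b$ whenever $a,b\in M_\infty(A)^+$ satisfy $d(a)<d(b)$ for every $d\in E\cup\{f\in DF(A)\setminus E: f(b)=1\}$, where $E=\{d_\tau:\tau\in QT(A)\}$. *)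

theory Defs
  imports "HOL-Analysis.Analysis" "HOL-Library.Nonpos_Ints"
begin

section \<open>Unital C*-algebras and the ideal property\<close>

text \<open>
  The zero algebra is not covered, because the superclass forces \<open>0 \<noteq> 1\<close>.  It has no normalized
  quasitrace, so strict comparison of projections excludes it anyway.
\<close>

class unital_cstar_algebra = real_normed_algebra_1 + banach +
  fixes scaleC :: "complex \<Rightarrow> 'a \<Rightarrow> 'a"  (infixr \<open>*\<^sub>C\<close> 75)
    and adj :: "'a \<Rightarrow> 'a"
  assumes scaleC_add_right: "c *\<^sub>C (x + y) = c *\<^sub>C x + c *\<^sub>C y"
    and scaleC_add_left: "(c + d) *\<^sub>C x = c *\<^sub>C x + d *\<^sub>C x"
    and scaleC_scaleC: "c *\<^sub>C (d *\<^sub>C x) = (c * d) *\<^sub>C x"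
    and scaleR_scaleC: "scaleR r x = complex_of_real r *\<^sub>C x"
    and mult_scaleC_left: "(c *\<^sub>C x) * y = c *\<^sub>C (x * y)"
    and mult_scaleC_right: "x * (c *\<^sub>C y) = c *\<^sub>C (x * y)"
    and norm_scaleC: "norm (c *\<^sub>C x) = cmod c * norm x"
    and adj_adj: "adj (adj x) = x"
    and adj_add: "adj (x + y) = adj x + adj y"
    and adj_scaleC: "adj (c *\<^sub>C x) = cnj c *\<^sub>C adj x"
    and adj_mult: "adj (x * y) = adj y * adj x"
    and cstar_identity: "norm (adj x * x) = (norm x)\<^sup>2"

definition cstar_ideal :: "'a::unital_cstar_algebra set \<Rightarrow> bool" where
  "cstar_ideal I \<longleftrightarrow>
     0 \<in> I \<and> (\<forall>x\<in>I. \<forall>y\<in>I. x + y \<in> I) \<and> (\<forall>c. \<forall>x\<in>I. c *\<^sub>C x \<in> I) \<and>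
     (\<forall>a. \<forall>x\<in>I. a * x \<in> I \<and> x * a \<in> I) \<and> closed I"

definition projection :: "'a::unital_cstar_algebra \<Rightarrow> bool" where
  "projection p \<longleftrightarrow> adj p = p \<and> p * p = p"

definition ideal_property :: "'a::unital_cstar_algebra itself \<Rightarrow> bool" where
  "ideal_property (_ :: 'a itself) \<longleftrightarrow>
     (\<forall>I :: 'a set. cstar_ideal I \<longrightarrow> cstar_ideal hull {p \<in> I. projection p} = I)"


section \<open>Matrices over a C*-algebra\<close>

text \<open>
  A matrix is an infinite array, and \<open>matrices n\<close> consists of those supported in the upper left
  \<open>n \<times> n\<close> corner.  The embedding \<open>x \<mapsto> x \<oplus> 0\<close> of \<open>M\<^sub>n(A)\<close> into \<open>M\<^sub>n\<^sub>+\<^sub>1(A)\<close> is then an inclusion,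
  and the algebraic inductive limit is the union.
\<close>

type_synonym 'a mat_array = "nat \<Rightarrow> nat \<Rightarrow> 'a"

definition matrices :: "nat \<Rightarrow> 'a::unital_cstar_algebra mat_array set" where
  "matrices n = {x. \<forall>i j. x i j \<noteq> 0 \<longrightarrow> i < n \<and> j < n}"

definition Minf :: "'a::unital_cstar_algebra mat_array set" where
  "Minf = (\<Union>n. matrices n)"

definition mplus :: "'a::unital_cstar_algebra mat_array \<Rightarrow> 'a mat_array \<Rightarrow> 'a mat_array" where
  "mplus x y = (\<lambda>i j. x i j + y i j)"

definition mminus :: "'a::unital_cstar_algebra mat_array \<Rightarrow> 'a mat_array \<Rightarrow> 'a mat_array" where
  "mminus x y = (\<lambda>i j. x i j - y i j)"

definition mscale :: "complex \<Rightarrow> 'a::unital_cstar_algebra mat_array \<Rightarrow> 'a mat_array" where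
  "mscale c x = (\<lambda>i j. c *\<^sub>C x i j)"

definition mmult :: "'a::unital_cstar_algebra mat_array \<Rightarrow> 'a mat_array \<Rightarrow> 'a mat_array" where
  "mmult x y = (\<lambda>i j. \<Sum>k | x i k \<noteq> 0. x i k * y k j)"

definition madj :: "'a::unital_cstar_algebra mat_array \<Rightarrow> 'a mat_array" where
  "madj x = (\<lambda>i j. adj (x j i))"

definition corner :: "'a::unital_cstar_algebra \<Rightarrow> 'a mat_array" where
  "corner a = (\<lambda>i j. if i = 0 \<and> j = 0 then a else 0)"

text \<open>The sum \<open>a \<oplus> b\<close> of \<open>a \<in> M\<^sub>n(A)\<close> and \<open>b \<in> M\<^sub>\<infinity>(A)\<close>, with \<open>b\<close> placed after the first \<open>n\<close> indices.\<close>

definition dsum :: "nat \<Rightarrow> 'a::unital_cstar_algebra mat_array \<Rightarrow> 'a mat_array \<Rightarrow> 'a mat_array" where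
  "dsum n a b = (\<lambda>i j. if i < n \<and> j < n then a i j
                       else if n \<le> i \<and> n \<le> j then b (i - n) (j - n) else 0)"

text \<open>
  The C*-norm of \<open>M\<^sub>n(A)\<close> is the operator norm of its action by left multiplication on the Hilbert
  module \<open>A\<^sup>n\<close>, whose norm is \<open>\<parallel>v\<parallel> = \<parallel>\<Sum>i<n. v\<^sub>i\<^sup>* v\<^sub>i\<parallel>\<^sup>1\<^sup>/\<^sup>2\<close>.
\<close>

definition vnorm :: "nat \<Rightarrow> (nat \<Rightarrow> 'a::unital_cstar_algebra) \<Rightarrow> real" where
  "vnorm n v = sqrt (norm (\<Sum>i<n. adj (v i) * v i))"

definition mnorm :: "nat \<Rightarrow> 'a::unital_cstar_algebra mat_array \<Rightarrow> real" where
  "mnorm n x = (SUP v\<in>{v. vnorm n v \<le> 1}. vnorm n (\<lambda>i. \<Sum>j<n. x i j * v j))"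

definition mtendsto :: "nat \<Rightarrow> (nat \<Rightarrow> 'a::unital_cstar_algebra mat_array) \<Rightarrow> 'a mat_array \<Rightarrow> bool" where
  "mtendsto n x a \<longleftrightarrow> (\<lambda>k. mnorm n (mminus (x k) a)) \<longlonglongrightarrow> 0"

definition Minf_pos :: "'a::unital_cstar_algebra mat_array set" where
  "Minf_pos = {mmult (madj y) y | y. y \<in> Minf}"

definition Minf_proj :: "'a::unital_cstar_algebra mat_array set" where
  "Minf_proj = {p \<in> Minf. madj p = p \<and> mmult p p = p}"

text \<open>The positive root \<open>a\<^sup>1\<^sup>/\<^sup>n\<close> for \<open>n \<ge> 1\<close>.\<close>

definition mroot :: "nat \<Rightarrow> 'a::unital_cstar_algebra mat_array \<Rightarrow> 'a mat_array" where
  "mroot n a = (THE b. b \<in> Minf_pos \<and> (mmult b ^^ (n - 1)) b = a)"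


section \<open>The Cuntz semigroup\<close>

definition cuntz_le :: "'a::unital_cstar_algebra mat_array \<Rightarrow> 'a mat_array \<Rightarrow> bool"  (infix \<open>\<lesssim>\<close> 50) where
  "a \<lesssim> b \<longleftrightarrow> (\<exists>n. a \<in> matrices n \<and> b \<in> matrices n \<and>
     (\<exists>x. (\<forall>k. x k \<in> matrices n) \<and> mtendsto n (\<lambda>k. mmult (mmult (x k) b) (madj (x k))) a))"

definition cuntz_rel :: "('a::unital_cstar_algebra mat_array \<times> 'a mat_array) set" where
  "cuntz_rel = {(a, b). a \<in> Minf_pos \<and> b \<in> Minf_pos \<and> a \<lesssim> b \<and> b \<lesssim> a}"

definition cuntz_semigroup :: "'a::unital_cstar_algebra mat_array set set" where
  "cuntz_semigroup = Minf_pos // cuntz_rel"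

definition cuntz_class :: "'a::unital_cstar_algebra mat_array \<Rightarrow> 'a mat_array set" where
  "cuntz_class a = cuntz_rel `` {a}"

text \<open>Any choice of representatives \<open>a\<close>, \<open>b\<close> and of the size \<open>n\<close> gives the same class \<open>\<langle>a \<oplus> b\<rangle>\<close>.\<close>

definition W_add :: "'a::unital_cstar_algebra mat_array set \<Rightarrow> 'a mat_array set \<Rightarrow> 'a mat_array set" where
  "W_add X Y = (\<Union>a\<in>X. \<Union>b\<in>Y. \<Union>n\<in>{n. a \<in> matrices n}. cuntz_class (dsum n a b))"

definition W_le :: "'a::unital_cstar_algebra mat_array set \<Rightarrow> 'a mat_array set \<Rightarrow> bool" where
  "W_le X Y \<longleftrightarrow> (\<exists>a\<in>X. \<exists>b\<in>Y. a \<lesssim> b)"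

definition W_times :: "nat \<Rightarrow> 'a::unital_cstar_algebra mat_array set \<Rightarrow> 'a mat_array set" where
  "W_times n X = (W_add X ^^ n) (cuntz_class (\<lambda>i j. 0))"

definition almost_unperforated :: "'a::unital_cstar_algebra itself \<Rightarrow> bool" where
  "almost_unperforated (_ :: 'a itself) \<longleftrightarrow>
     (\<forall>X \<in> cuntz_semigroup :: 'a mat_array set set. \<forall>Y \<in> cuntz_semigroup. \<forall>m n :: nat.
        0 < m \<longrightarrow> 0 < n \<longrightarrow> W_le (W_times n X) (W_times m Y) \<longrightarrow> m < n \<longrightarrow> W_le X Y)"

text \<open>
  Dimension functions are taken to be extensional, that is \<open>undefined\<close> off \<open>M\<^sub>\<infinity>(A)\<^sup>+\<close>, so that
  equality in HOL is equality as functions on \<open>M\<^sub>\<infinity>(A)\<^sup>+\<close>.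
\<close>

definition dimension_functions :: "('a::unital_cstar_algebra mat_array \<Rightarrow> ennreal) set" where
  "dimension_functions = {d \<in> extensional Minf_pos.
     (\<forall>n. \<forall>a \<in> Minf_pos \<inter> matrices n. \<forall>b \<in> Minf_pos. d (dsum n a b) = d a + d b) \<and>
     (\<forall>a \<in> Minf_pos. \<forall>b \<in> Minf_pos. a \<lesssim> b \<longrightarrow> d a \<le> d b)}"


section \<open>Quasitraces\<close>

definition abelian_subalgebra :: "nat \<Rightarrow> 'a::unital_cstar_algebra mat_array set \<Rightarrow> bool" where
  "abelian_subalgebra n B \<longleftrightarrow>
     B \<subseteq> matrices n \<and> (\<lambda>i j. 0) \<in> B \<and>
     (\<forall>x\<in>B. \<forall>y\<in>B. mplus x y \<in> B \<and> mmult x y \<in> B) \<and>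
     (\<forall>c. \<forall>x\<in>B. mscale c x \<in> B) \<and> (\<forall>x\<in>B. madj x \<in> B) \<and>
     (\<forall>x. \<forall>a \<in> matrices n. (\<forall>k. x k \<in> B) \<longrightarrow> mtendsto n x a \<longrightarrow> a \<in> B) \<and>
     (\<forall>x\<in>B. \<forall>y\<in>B. mmult x y = mmult y x)"

text \<open>The unnormalized quasitrace conditions on \<open>M\<^sub>n(A)\<close>; values of \<open>\<sigma>\<close> off \<open>M\<^sub>n(A)\<close> are irrelevant.\<close>

definition quasitrace_on :: "nat \<Rightarrow> ('a::unital_cstar_algebra mat_array \<Rightarrow> complex) \<Rightarrow> bool" where
  "quasitrace_on n \<sigma> \<longleftrightarrow>
     (\<forall>x \<in> matrices n. \<sigma> (mmult x (madj x)) \<in> \<real>\<^sub>\<ge>\<^sub>0 \<and>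
        \<sigma> (mmult x (madj x)) = \<sigma> (mmult (madj x) x)) \<and>
     (\<forall>a \<in> matrices n. \<forall>b \<in> matrices n. madj a = a \<longrightarrow> madj b = b \<longrightarrow>
        \<sigma> (mplus a (mscale \<i> b)) = \<sigma> a + \<i> * \<sigma> b) \<and>
     (\<forall>B. abelian_subalgebra n B \<longrightarrow>
        (\<forall>x\<in>B. \<forall>y\<in>B. \<sigma> (mplus x y) = \<sigma> x + \<sigma> y) \<and>
        (\<forall>c. \<forall>x\<in>B. \<sigma> (mscale c x) = c * \<sigma> x))"

definition quasitrace_extension ::
    "nat \<Rightarrow> ('a::unital_cstar_algebra \<Rightarrow> complex) \<Rightarrow> ('a mat_array \<Rightarrow> complex) \<Rightarrow> bool" where
  "quasitrace_extension n \<tau> \<sigma> \<longleftrightarrow> (\<forall>x. \<sigma> (corner x) = \<tau> x) \<and> quasitrace_on n \<sigma>"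

text \<open>
  The second conjunct states the conditions on \<open>A\<close> itself, identified with \<open>M\<^sub>1(A)\<close> by
  \<open>x \<leftrightarrow> x 0 0\<close>.
\<close>

definition QT :: "('a::unital_cstar_algebra \<Rightarrow> complex) set" where
  "QT = {\<tau>. \<tau> 1 = 1 \<and> quasitrace_on 1 (\<lambda>x. \<tau> (x 0 0)) \<and>
            (\<forall>n\<ge>1. \<exists>\<sigma>. quasitrace_extension n \<tau> \<sigma>)}"

definition extremal_quasitraces :: "('a::unital_cstar_algebra \<Rightarrow> complex) set" where
  "extremal_quasitraces = {\<tau> \<in> QT. \<forall>\<sigma>\<in>QT. \<forall>\<rho>\<in>QT. \<forall>t::real.
     0 < t \<longrightarrow> t < 1 \<longrightarrow> \<tau> = (\<lambda>x. of_real t * \<sigma> x + of_real (1 - t) * \<rho> x) \<longrightarrow> \<sigma> = \<rho>}"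

text \<open>
  The function on \<open>M\<^sub>\<infinity>(A)\<close> that is usually again written \<open>\<tau>\<close>.  A quasitrace has exactly one
  extension to each \<open>M\<^sub>n(A)\<close> (Blackadar and Handelman), so these extensions are compatible and the
  choice is unique on \<open>M\<^sub>\<infinity>(A)\<close>.
\<close>

definition qt_ext :: "('a::unital_cstar_algebra \<Rightarrow> complex) \<Rightarrow> 'a mat_array \<Rightarrow> complex" where
  "qt_ext \<tau> = (SOME \<sigma>. \<forall>n\<ge>1. quasitrace_extension n \<tau> \<sigma>)"

definition d_qt :: "('a::unital_cstar_algebra \<Rightarrow> complex) \<Rightarrow> 'a mat_array \<Rightarrow> ennreal" where
  "d_qt \<tau> = restrict (\<lambda>a. ennreal (Re (lim (\<lambda>n. qt_ext \<tau> (mroot n a))))) Minf_pos"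


section \<open>Comparison\<close>

definition strict_comparison_of_projections :: "'a::unital_cstar_algebra itself \<Rightarrow> bool" where
  "strict_comparison_of_projections (_ :: 'a itself) \<longleftrightarrow>
     (QT :: ('a \<Rightarrow> complex) set) \<noteq> {} \<and>
     (\<forall>p \<in> Minf_proj :: 'a mat_array set. \<forall>q \<in> Minf_proj.
        (\<forall>\<tau>\<in>QT. Re (qt_ext \<tau> p) < Re (qt_ext \<tau> q)) \<longrightarrow> p \<lesssim> q)"

definition weak_strict_comparison :: "'a::unital_cstar_algebra itself \<Rightarrow> bool" where
  "weak_strict_comparison (_ :: 'a itself) \<longleftrightarrow>
     (QT :: ('a \<Rightarrow> complex) set) \<noteq> {} \<and>
     (\<forall>a \<in> Minf_pos :: 'a mat_array set. \<forall>b \<in> Minf_pos.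
        (\<forall>d \<in> d_qt ` QT \<union> {f \<in> dimension_functions - d_qt ` QT. f b = 1}. d a < d b) \<longrightarrow> a \<lesssim> b)"

end

theory Submission
  imports Defs
begin

text \<open>
  Let \<open>x\<close>, \<open>y\<close> be the classes of \<open>a\<close>, \<open>b\<close> in \<open>W(A)\<close> and suppose \<open>x \<le> y\<close> fails.  If \<open>y\<close> admits a normalized state on
  the order ideal it generates, then almost unperforation and an extension argument of Goodearl--Handelman
  type give such a state \<open>f\<close> with \<open>f(x) \<ge> 1\<close>, or \<open>f\<close> is extended by \<open>\<infinity>\<close> off the order ideal and \<open>f(x) = \<infinity>\<close>.
  Either way \<open>f\<close> is a dimension function with \<open>f(b) = 1 \<le> f(a)\<close>, against the hypothesis on \<open>a\<close> and \<open>b\<close>.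
  Otherwise \<open>K y \<le> y\<close> for all \<open>K\<close>.  A quasitrace is bounded on \<open>M\<^sub>m(A)\<close>, so this forces it to vanish on all
  roots of \<open>b\<close>; hence \<open>d\<^sub>\<tau>(b) = 0\<close> for every \<open>\<tau>\<close>, and \<open>d\<^sub>\<tau>(a) < d\<^sub>\<tau>(b)\<close> is impossible.

  The norm of a polynomial in a self-adjoint contraction \<open>x\<close>, the basis of the functional calculus, is
  estimated by writing \<open>x\<close> as the real part of the unitary \<open>u = x + i(1 - x\<^sup>2)\<^sup>1\<^sup>/\<^sup>2\<close>: expansion in powers of \<open>u\<close> gives
  the bound up to a factor linear in the degree, which is removed by passing to high powers.
\<close>

section \<open>Self-adjoint elements and polynomials\<close>

text \<open>Cuntz comparison only exhibits an element as a limit of conjugates of b, while a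
  quasitrace is additive on commuting elements only, so passing it through such a limit is not
  direct. The bound therefore works with one element C, the direct sum of K copies of a root c of b.
  Every sum that is formed consists of commuting elements, and cutting C down by \<delta> turns the
  approximate comparison into an exact factorization, at a cost of at most \<delta> times the value
  at 1. The resulting bound is independent of K, which forces the value at c to be 0. In W(A) the
  obstacle is that cancellation may fail, so there is no passage to an ordered group: states are
  built on the monoid itself as minimal subadditive functionals, and a summand that cannot be
  cancelled is outweighed by iterating the inequality. Whether the dimension function f so obtained
  comes from a quasitrace is left undecided: being normalized at b, it belongs in either case to the
  functions for which d(a) < d(b) is assumed.\<close>

lemma scaleC_zero_left [simp]: "0 *\<^sub>C (x::'a::unital_cstar_algebra) = 0"
  using scaleR_scaleC[of 0 x] by simp

lemma scaleC_zero_right [simp]: "c *\<^sub>C (0::'a::unital_cstar_algebra) = 0"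
  using scaleC_add_right[of c 0 0] by simp

lemma scaleC_one [simp]: "1 *\<^sub>C (x::'a::unital_cstar_algebra) = x"
  using scaleR_scaleC[of 1 x] by simp

lemma scaleC_minus_right: "c *\<^sub>C (- x) = - (c *\<^sub>C (x::'a::unital_cstar_algebra))"
  using scaleC_add_right[of c x "- x"] by (simp add: eq_neg_iff_add_eq_0 add.commute)

lemma scaleC_minus_left: "(- c) *\<^sub>C x = - (c *\<^sub>C (x::'a::unital_cstar_algebra))"
  using scaleC_add_left[of c "- c" x] by (simp add: eq_neg_iff_add_eq_0 add.commute)

lemma scaleC_diff_right: "c *\<^sub>C (x - y) = c *\<^sub>C x - c *\<^sub>C (y::'a::unital_cstar_algebra)"
  using scaleC_add_right[of c x "- y"] by (simp add: scaleC_minus_right)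

lemma scaleC_sum_right: "c *\<^sub>C (\<Sum>i\<in>I. f i) = (\<Sum>i\<in>I. c *\<^sub>C (f i :: 'a::unital_cstar_algebra))"
  by (induction I rule: infinite_finite_induct) (auto simp: scaleC_add_right)

lemma scaleC_sum_left: "(\<Sum>i\<in>I. f i) *\<^sub>C x = (\<Sum>i\<in>I. f i *\<^sub>C (x :: 'a::unital_cstar_algebra))"
  by (induction I rule: infinite_finite_induct) (auto simp: scaleC_add_left)

lemma adj_zero [simp]: "adj (0::'a::unital_cstar_algebra) = 0"
  using adj_add[of 0 "0::'a"] by simp

lemma adj_one [simp]: "adj (1::'a::unital_cstar_algebra) = 1"
  by (metis adj_adj adj_mult mult_1 mult.right_neutral)

lemma adj_minus [simp]: "adj (- x) = - adj (x::'a::unital_cstar_algebra)"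
  using adj_add[of x "- x"] by (simp add: eq_neg_iff_add_eq_0 add.commute)

lemma adj_diff: "adj (x - y) = adj x - adj (y::'a::unital_cstar_algebra)"
  using adj_add[of x "- y"] by simp

lemma adj_scaleR [simp]: "adj (r *\<^sub>R x) = r *\<^sub>R adj (x::'a::unital_cstar_algebra)"
  by (simp add: scaleR_scaleC adj_scaleC)

lemma adj_of_real [simp]: "adj (of_real r) = (of_real r::'a::unital_cstar_algebra)"
  by (simp add: of_real_def)

lemma adj_sum: "adj (\<Sum>i\<in>I. f i) = (\<Sum>i\<in>I. adj (f i :: 'a::unital_cstar_algebra))"
  by (induction I rule: infinite_finite_induct) (auto simp: adj_add)

lemma adj_power: "adj (x ^ n) = adj (x::'a::unital_cstar_algebra) ^ n"
  by (induction n) (auto simp: adj_mult power_commutes)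

lemma norm_adj [simp]: "norm (adj x) = norm (x::'a::unital_cstar_algebra)"
proof -
  have "norm x \<le> norm (adj x)" for x :: 'a
  proof (cases "x = 0")
    case False
    have "norm x * norm x \<le> norm (adj x) * norm x"
      using cstar_identity[of x] norm_mult_ineq[of "adj x" x] by (simp add: power2_eq_square)
    then show ?thesis using False by simp
  qed simp
  from this[of x] this[of "adj x"] show ?thesis by (simp add: adj_adj)
qed

lemma bounded_linear_adj: "bounded_linear (adj :: 'a::unital_cstar_algebra \<Rightarrow> 'a)"
  by (rule bounded_linear_intro[of _ 1]) (auto simp: adj_add)

lemmas tendsto_adj = bounded_linear.tendsto[OF bounded_linear_adj]

lemma norm_power_self_adjoint:
  fixes x :: "'a::unital_cstar_algebra"
  assumes "adj x = x"
  shows "norm (x ^ (2 ^ k)) = norm x ^ (2 ^ k)"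
proof (induction k)
  case (Suc k)
  have "norm (x ^ (2 ^ Suc k)) = norm (adj (x ^ (2 ^ k)) * x ^ (2 ^ k))"
    using assms by (simp add: adj_power power_add[symmetric] mult_2)
  also have "\<dots> = norm x ^ (2 ^ Suc k)"
    by (simp add: cstar_identity Suc power_mult[symmetric] mult.commute)
  finally show ?case .
qed simp

lemma self_adjoint_power_eq_0:
  fixes x :: "'a::unital_cstar_algebra"
  assumes "adj x = x" "x ^ n = 0"
  shows "x = 0"
proof -
  have "n \<le> 2 ^ n" by (rule less_imp_le) simp
  then have "x ^ (2 ^ n) = x ^ n * x ^ (2 ^ n - n)"
    by (simp add: power_add[symmetric])
  then have "norm x ^ (2 ^ n) = 0"
    using assms(2) norm_power_self_adjoint[OF assms(1), of n] by simp
  then show ?thesis by simp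
qed

lemma adj_mult_self_eq_0: "adj x * x = 0 \<Longrightarrow> x = (0::'a::unital_cstar_algebra)"
  using cstar_identity[of x] by simp

section \<open>Real polynomials evaluated at an element of a noncommutative algebra\<close>

definition peval :: "real poly \<Rightarrow> 'a::real_algebra_1 \<Rightarrow> 'a" where
  "peval p x = (\<Sum>i\<le>degree p. coeff p i *\<^sub>R x ^ i)"

lemma peval_eq_sum: "degree p \<le> n \<Longrightarrow> peval p x = (\<Sum>i\<le>n. coeff p i *\<^sub>R x ^ i)"
  unfolding peval_def
  by (rule sum.mono_neutral_left) (auto simp: coeff_eq_0)

lemma peval_0 [simp]: "peval 0 x = 0"
  by (simp add: peval_def)

lemma peval_pCons: "peval (pCons a p) x = a *\<^sub>R 1 + x * peval p x"
proof -
  have "peval (pCons a p) x = (\<Sum>i\<le>Suc (degree p). coeff (pCons a p) i *\<^sub>R x ^ i)"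
    by (rule peval_eq_sum) (simp add: degree_pCons_le)
  also have "\<dots> = a *\<^sub>R 1 + x * peval p x"
    by (simp add: sum.atMost_Suc_shift peval_def sum_distrib_left del: sum.atMost_Suc)
  finally show ?thesis .
qed

lemma peval_add: "peval (p + q) x = peval p x + peval q x"
proof -
  let ?n = "max (degree p) (degree q)"
  have "degree (p + q) \<le> ?n" by (rule degree_add_le) auto
  then show ?thesis
    by (simp add: peval_eq_sum[of _ ?n] scaleR_add_left sum.distrib)
qed

lemma peval_smult: "peval (smult c p) x = c *\<^sub>R peval p x"
  by (simp add: peval_eq_sum[of _ "degree p"] degree_smult_le scaleR_sum_right)

lemma peval_mult: "peval (p * q) x = peval p x * peval q x"
  by (induction p) (auto simp: peval_add peval_smult peval_pCons algebra_simps)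

lemma peval_1: "peval 1 x = 1"
  by (simp add: one_pCons peval_pCons)

lemma peval_power: "peval (p ^ n) x = peval p x ^ n"
  by (induction n) (auto simp: peval_mult peval_1)

lemma peval_pcompose: "peval (pcompose p q) x = peval p (peval q x)"
  by (induction p) (auto simp: pcompose_pCons peval_add peval_mult peval_pCons)

lemma peval_real: "peval p (t::real) = poly p t"
  by (induction p) (auto simp: peval_pCons)

lemma adj_peval: "adj x = (x::'a::unital_cstar_algebra) \<Longrightarrow> adj (peval p x) = peval p x"
  by (simp add: peval_def adj_sum adj_power)

text \<open>In the limit this gives both the commutation of functions of one element and the
  transfer of functions between \<open>adj z * z\<close> and \<open>z * adj z\<close>.\<close>

lemma peval_intertwine:
  assumes "x * z = z * y"
  shows "peval p x * z = z * peval p y"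
proof (induction p)
  case (pCons a p)
  have "x * (peval p x * z) = (x * z) * peval p y"
    by (simp add: pCons mult.assoc)
  then show ?case
    by (simp add: peval_pCons distrib_left distrib_right assms mult.assoc)
qed simp

lemma tendsto_peval:
  fixes f :: "'b \<Rightarrow> 'a::real_normed_algebra_1"
  assumes "(f \<longlongrightarrow> l) F"
  shows "((\<lambda>i. peval p (f i)) \<longlongrightarrow> peval p l) F"
  unfolding peval_def by (intro tendsto_intros assms)

section \<open>The norm of a polynomial in a self-adjoint element\<close>

text \<open>The root is the binomial series of (1 - t)^(1/2) at s. As a limit of polynomials in s it
  is self-adjoint and commutes with whatever commutes with s; the latter is what makes x + iy
  unitary later on.\<close>

lemma ex_sqrt_one_minus:
  fixes s :: "'a::unital_cstar_algebra"
  assumes s: "adj s = s" "norm s < 1"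
  obtains y where "adj y = y" "y * y = 1 - s" "\<And>z. z * s = s * z \<Longrightarrow> z * y = y * z"
proof -
  define c where "c k = ((1/2::real) gchoose k) * (-1) ^ k" for k
  have c1: "\<bar>c k\<bar> \<le> 1" for k
  proof -
    have "\<bar>(1/2::real) gchoose k\<bar> \<le> 1"
    proof (induction k)
      case (Suc k)
      have "\<bar>(1/2 - real k) / real (Suc k)\<bar> \<le> 1"
        by (cases k) (auto simp: abs_if field_simps)
      moreover have "(1/2::real) gchoose Suc k = ((1/2) gchoose k) * ((1/2 - real k) / real (Suc k))"
        by (simp add: gbinomial_Suc_rec field_simps)
      ultimately show ?case
        using Suc by (simp only: abs_mult) (rule mult_le_one, auto)
    qed simp
    then show ?thesis by (simp add: c_def abs_mult)
  qed
  have summ: "summable (\<lambda>k. norm (c k *\<^sub>R s ^ k))"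
  proof (rule summable_comparison_test')
    show "summable (\<lambda>k. norm s ^ k)" using s by simp
    show "norm (norm (c k *\<^sub>R s ^ k)) \<le> norm s ^ k" for k
      using mult_mono[OF c1[of k] norm_power_ineq[of s k]] by simp
  qed
  define y where "y = (\<Sum>k. c k *\<^sub>R s ^ k)"
  have sums: "(\<lambda>k. c k *\<^sub>R s ^ k) sums y"
    unfolding y_def using summ by (rule summable_sums[OF summable_norm_cancel])
  have adj: "adj y = y"
  proof -
    have "(\<lambda>k. adj (c k *\<^sub>R s ^ k)) sums adj y"
      using bounded_linear.sums[OF bounded_linear_adj sums] .
    then show ?thesis using sums sums_unique2 by (simp add: adj_power s)
  qed
  have sq: "y * y = 1 - s"
  proof -
    \<comment> \<open>By Vandermonde, the coefficient of s^k in the square is (-1)^k times the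
      binomial coefficient of 1 over k, which vanishes beyond k = 1.\<close>
    have "(\<lambda>k. \<Sum>i\<le>k. (c i *\<^sub>R s ^ i) * (c (k - i) *\<^sub>R s ^ (k - i))) sums (y * y)"
      unfolding y_def by (rule Cauchy_product_sums[OF summ summ])
    moreover have "(\<Sum>i\<le>k. (c i *\<^sub>R s ^ i) * (c (k - i) *\<^sub>R s ^ (k - i)))
                = (if k = 0 then 1 else if k = 1 then - s else 0)" for k
    proof -
      have "(\<Sum>i\<le>k. (c i *\<^sub>R s ^ i) * (c (k - i) *\<^sub>R s ^ (k - i)))
          = (\<Sum>i\<le>k. (((1/2) gchoose i) * ((1/2) gchoose (k - i)) * (-1) ^ k) *\<^sub>R s ^ k)"
        by (intro sum.cong) (auto simp: c_def power_add[symmetric] mult_ac)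
      also have "\<dots> = ((\<Sum>i=0..k. ((1/2) gchoose i) * ((1/2) gchoose (k - i))) * (-1) ^ k) *\<^sub>R s ^ k"
        by (simp add: scaleR_sum_left sum_distrib_right atMost_atLeast0)
      also have "\<dots> = (((1::real) gchoose k) * (-1) ^ k) *\<^sub>R s ^ k"
        by (simp add: gbinomial_Vandermonde)
      also have "(1::real) gchoose k = (if k \<le> 1 then 1 else 0)"
        using binomial_gbinomial[of 1 k, where 'a = real] binomial_eq_0[of "Suc 0" k]
        by (cases "k \<le> 1") (auto simp: le_Suc_eq)
      finally show ?thesis
        by (cases k; cases "k - 1") auto
    qed
    ultimately have "(\<lambda>k. if k = 0 then 1 else if k = 1 then - s else 0) sums (y * y)"
      by simp
    moreover have "(\<lambda>k. if k = 0 then 1 else if k = 1 then - s else 0) sums 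
        (\<Sum>k\<in>{0,1::nat}. if k = 0 then 1 else if k = 1 then - s else 0)"
      by (rule sums_finite) auto
    ultimately show ?thesis using sums_unique2 by fastforce
  qed
  have "z * y = y * z" if z: "z * s = s * z" for z
  proof -
    have "z * s ^ k = s ^ k * z" for k
      using z by (metis power_commuting_commutes)
    then have "(\<lambda>k. z * (c k *\<^sub>R s ^ k)) = (\<lambda>k. (c k *\<^sub>R s ^ k) * z)" by simp
    then show ?thesis
      using sums_mult[OF sums, of z] sums_mult2[OF sums, of z] sums_unique2 by metis
  qed
  with adj sq show ?thesis by (rule that)
qed

text \<open>A geometric sum in exp(2 pi i (A - B)/M). The two inequalities say |A - B| < M, so that
  A and B are congruent modulo M only if they are equal.\<close>

lemma sum_roots_of_unity:
  fixes M A B :: nat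
  assumes "0 < M" "A < B + M" "B < A + M"
  shows "(\<Sum>l<M. cis (2 * pi * l / M) ^ A * cnj (cis (2 * pi * l / M)) ^ B) = (if A = B then of_nat M else 0)"
proof -
  define w where "w = cis (2 * pi * (real A - real B) / M)"
  have *: "cis (2 * pi * l / M) ^ A * cnj (cis (2 * pi * l / M)) ^ B = w ^ l" for l
    by (simp add: w_def Complex.DeMoivre cis_cnj cis_mult divide_simps algebra_simps)
  have wM: "w ^ M = 1"
  proof -
    have "w ^ M = cis (2 * pi * of_int (int A - int B))"
      using assms by (simp add: w_def Complex.DeMoivre)
    also have "\<dots> = 1" by (rule cis_multiple_2pi) auto
    finally show ?thesis .
  qed
  show ?thesis
  proof (cases "A = B")
    case True
    then show ?thesis unfolding * by (simp add: w_def)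
  next
    case False
    have "w \<noteq> 1"
    proof
      assume "w = 1"
      then have "cos (2 * pi * (real A - real B) / M) = 1"
        by (simp add: w_def complex_eq_iff)
      then obtain n :: int where "2 * pi * (real A - real B) / M = of_int n * 2 * pi"
        using cos_one_2pi_int by blast
      then have "(2 * pi) * (real A - real B) = (2 * pi) * (of_int n * real M)"
        using assms(1) by (simp add: field_simps)
      then have "real A - real B = of_int n * real M"
        by (simp only: mult_cancel_left) simp
      then have "int A - int B = n * int M"
        unfolding of_int_eq_iff[where 'a = real, symmetric] by simp
      moreover have "\<bar>int A - int B\<bar> < int M" using assms by auto
      ultimately have "\<bar>n\<bar> * int M < 1 * int M" by (simp add: abs_mult)
      then have "n = 0"
        using mult_right_mono[of 1 "\<bar>n\<bar>" "int M"] by linarith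
      then show False using \<open>int A - int B = n * int M\<close> False by simp
    qed
    then have "(\<Sum>l<M. w ^ l) = 0"
      using wM by (simp add: geometric_sum)
    then show ?thesis unfolding * using False by simp
  qed
qed

text \<open>Discrete Fourier inversion at the (2N+1)-th roots of unity z_l. Let K l be the Dirichlet
  kernel, the sum of z_l^(-k) u^k over |k| <= N. Then (2N+1) p(x) is the sum of p(Re z_l) K l; there
  are 2N+1 terms, each kernel has norm at most 2N+1, and one factor 2N+1 survives.\<close>

lemma norm_peval_le_degree:
  fixes u v x :: "'a::unital_cstar_algebra"
  assumes x: "x = (1/2) *\<^sub>R (u + v)" and uv: "u * v = 1" "v * u = 1"
    and norm: "norm u \<le> 1" "norm v \<le> 1" and deg: "degree p \<le> N"
    and M: "\<And>t. \<bar>t\<bar> \<le> 1 \<Longrightarrow> \<bar>poly p t\<bar> \<le> M"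
  shows "norm (peval p x) \<le> real (2 * N + 1) * M"
proof -
  define m where "m = 2 * N + 1"
  have m0: "0 < m" by (simp add: m_def)
  define z where "z l = cis (2 * pi * real l / real m)" for l :: nat
  \<comment> \<open>The N-th powers shift the exponents -N, ..., N to 0, ..., 2N:
    \<open>v ^ N * u ^ j\<close> is u^(j-N), and the scalar in front is z_l^(N-j).\<close>
  define K where "K l = (\<Sum>j\<le>2*N. (z l ^ N * cnj (z l) ^ j) *\<^sub>C (v ^ N * u ^ j))" for l
  have z1: "cmod (z l) = 1" for l by (simp add: z_def)
  have K: "norm (K l) \<le> m" for l
  proof -
    have "norm (K l) \<le> (\<Sum>j\<le>2*N. norm ((z l ^ N * cnj (z l) ^ j) *\<^sub>C (v ^ N * u ^ j)))"
      unfolding K_def by (rule norm_sum)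
    also have "\<dots> \<le> (\<Sum>j\<le>2*N. 1)"
    proof (rule sum_mono)
      fix j
      have "norm (v ^ N * u ^ j) \<le> norm v ^ N * norm u ^ j"
        by (meson mult_mono norm_ge_zero norm_mult_ineq norm_power_ineq order_trans zero_le_power)
      also have "\<dots> \<le> 1" using norm by (simp add: mult_le_one power_le_one)
      finally show "norm ((z l ^ N * cnj (z l) ^ j) *\<^sub>C (v ^ N * u ^ j)) \<le> 1"
        by (simp add: norm_scaleC norm_mult norm_power z1)
    qed
    finally show ?thesis by (simp add: m_def)
  qed
  have comm: "u ^ a * v ^ b = v ^ b * u ^ a" for a b
    using uv by (metis power_commuting_commutes)
  have base: "(\<Sum>l<m. (z l ^ a * cnj (z l) ^ b) *\<^sub>C K l) = of_nat m *\<^sub>C (u ^ a * v ^ b)"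
    if ab: "a \<le> N" "b \<le> N" for a b
  proof -
    have "(\<Sum>l<m. (z l ^ a * cnj (z l) ^ b) *\<^sub>C K l) 
       = (\<Sum>l<m. \<Sum>j\<le>2*N. (z l ^ (a + N) * cnj (z l) ^ (b + j)) *\<^sub>C (v ^ N * u ^ j))"
      by (simp add: K_def scaleC_sum_right scaleC_scaleC power_add mult_ac)
    also have "\<dots> = (\<Sum>j\<le>2*N. (\<Sum>l<m. z l ^ (a + N) * cnj (z l) ^ (b + j)) *\<^sub>C (v ^ N * u ^ j))"
      by (subst sum.swap) (simp add: scaleC_sum_left)
    also have "\<dots> = (\<Sum>j\<le>2*N. (if j = a + N - b then of_nat m else 0) *\<^sub>C (v ^ N * u ^ j))"
    proof (rule sum.cong[OF refl])
      fix j assume "j \<in> {..2*N}"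
      then have "(\<Sum>l<m. z l ^ (a + N) * cnj (z l) ^ (b + j)) = (if a + N = b + j then of_nat m else 0)"
        unfolding z_def using ab by (intro sum_roots_of_unity[OF m0]) (auto simp: m_def)
      moreover have "a + N = b + j \<longleftrightarrow> j = a + N - b" using ab by auto
      ultimately show "(\<Sum>l<m. z l ^ (a + N) * cnj (z l) ^ (b + j)) *\<^sub>C (v ^ N * u ^ j)
         = (if j = a + N - b then of_nat m else 0) *\<^sub>C (v ^ N * u ^ j)" by simp
    qed
    also have "\<dots> = of_nat m *\<^sub>C (v ^ N * u ^ (a + N - b))"
      using ab by (subst sum.remove[of _ "a + N - b"]) auto
    also have "v ^ N * u ^ (a + N - b) = v ^ b * (v ^ (N - b) * u ^ (N - b)) * u ^ a"
      using ab by (simp add: mult.assoc power_add[symmetric])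
        (simp add: mult.assoc[symmetric] power_add[symmetric] add.commute)
    also have "v ^ (N - b) * u ^ (N - b) = 1"
      by (rule left_right_inverse_power) (rule uv)
    finally show ?thesis by (simp add: comm)
  qed
  \<comment> \<open>The induction on k expands one factor Re z = (z + cnj z)/2 and one factor x = (u
    + v)/2 at the same time; the free exponents a and b absorb the resulting summands.\<close>
  have claim: "(\<Sum>l<m. (z l ^ a * cnj (z l) ^ b * of_real (Re (z l)) ^ k) *\<^sub>C K l) = of_nat m *\<^sub>C (u ^ a * v ^ b * x ^ k)"
    if "a + k \<le> N" "b + k \<le> N" for a b k
    using that
  proof (induction k arbitrary: a b)
    case 0
    then show ?case using base by simp
  next
    case (Suc k)
    have Re: "of_real (Re w) = (1/2) * (w + cnj w)" for w by (simp add: complex_eq_iff)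
    have "(\<Sum>l<m. (z l ^ a * cnj (z l) ^ b * of_real (Re (z l)) ^ Suc k) *\<^sub>C K l)
       = (\<Sum>l<m. (1/2) *\<^sub>C ((z l ^ Suc a * cnj (z l) ^ b * of_real (Re (z l)) ^ k) *\<^sub>C K l
            + (z l ^ a * cnj (z l) ^ Suc b * of_real (Re (z l)) ^ k) *\<^sub>C K l))"
      by (intro sum.cong refl)
        (simp add: Re scaleC_scaleC scaleC_add_left[symmetric] algebra_simps del: complex_add_cnj)
    also have "\<dots> = (1/2) *\<^sub>C (of_nat m *\<^sub>C (u ^ Suc a * v ^ b * x ^ k) + of_nat m *\<^sub>C (u ^ a * v ^ Suc b * x ^ k))"
      using Suc by (simp add: scaleC_sum_right[symmetric] sum.distrib del: power_Suc)
    also have "u ^ Suc a * v ^ b * x ^ k = u ^ a * v ^ b * (u * x ^ k)"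
    proof -
      have "u ^ Suc a * v ^ b = u ^ a * (u * v ^ b)" by (simp add: power_commutes mult.assoc[symmetric])
      also have "u * v ^ b = v ^ b * u" using comm[of 1 b] by simp
      finally show ?thesis by (simp add: mult.assoc)
    qed
    also have "u ^ a * v ^ Suc b * x ^ k = u ^ a * v ^ b * (v * x ^ k)"
      by (simp only: power_Suc2 mult.assoc)
    also have "(1/2) *\<^sub>C (of_nat m *\<^sub>C (u ^ a * v ^ b * (u * x ^ k)) + of_nat m *\<^sub>C (u ^ a * v ^ b * (v * x ^ k)))
       = of_nat m *\<^sub>C (u ^ a * v ^ b * ((1/2) *\<^sub>R (u + v) * x ^ k))"
      by (simp add: scaleR_scaleC scaleC_add_right mult_scaleC_right mult_scaleC_left scaleC_scaleC
          distrib_left distrib_right mult.commute)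
    finally show ?case by (simp add: x[symmetric])
  qed
  have "real m * norm (peval p x) = norm (of_nat m *\<^sub>C peval p x)"
    by (simp add: norm_scaleC)
  also have "of_nat m *\<^sub>C peval p x = (\<Sum>i\<le>N. coeff p i *\<^sub>R (of_nat m *\<^sub>C x ^ i))"
    by (simp add: peval_eq_sum[OF deg] scaleC_sum_right scaleR_scaleC scaleC_scaleC mult.commute)
  also have "\<dots> = (\<Sum>i\<le>N. \<Sum>l<m. of_real (coeff p i * Re (z l) ^ i) *\<^sub>C K l)"
  proof (rule sum.cong[OF refl])
    fix i assume "i \<in> {..N}"
    then have "of_nat m *\<^sub>C x ^ i = (\<Sum>l<m. of_real (Re (z l)) ^ i *\<^sub>C K l)"
      using claim[of 0 i 0] by simp
    then show "coeff p i *\<^sub>R (of_nat m *\<^sub>C x ^ i) = (\<Sum>l<m. of_real (coeff p i * Re (z l) ^ i) *\<^sub>C K l)"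
      by (simp add: scaleR_scaleC scaleC_sum_right scaleC_scaleC)
  qed
  also have "\<dots> = (\<Sum>l<m. of_real (poly p (Re (z l))) *\<^sub>C K l)"
    by (subst sum.swap) (simp add: peval_real[symmetric] peval_eq_sum[OF deg] scaleC_sum_left del: of_real_mult of_real_power)
  also have "norm \<dots> \<le> (\<Sum>l<m. norm (of_real (poly p (Re (z l))) *\<^sub>C K l))"
    by (rule norm_sum)
  also have "\<dots> \<le> (\<Sum>l<m. M * real m)"
  proof (rule sum_mono)
    fix l
    have "\<bar>Re (z l)\<bar> \<le> 1" using abs_Re_le_cmod[of "z l"] z1 by simp
    then have "\<bar>poly p (Re (z l))\<bar> \<le> M" by (rule M)
    then show "norm (of_real (poly p (Re (z l))) *\<^sub>C K l) \<le> M * real m"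
      using K[of l] by (simp add: norm_scaleC) (meson abs_ge_zero mult_mono norm_ge_zero order_trans)
  qed
  finally have "real m * norm (peval p x) \<le> real m * (M * real m)" by simp
  then show ?thesis using m0 by (simp add: m_def mult.commute)
qed

text \<open>The 2^k-th root of a factor linear in 2^k tends to 1; equivalently, n q^n tends to 0 for
  q = M/c < 1.\<close>

lemma exponential_beats_linear:
  fixes c M d :: real
  assumes c: "0 \<le> c" and M: "0 \<le> M" and bd: "\<And>k::nat. c ^ (2^k) \<le> (d * real (2^k) + 1) * M ^ (2^k)"
  shows "c \<le> M"
proof (rule ccontr)
  assume less: "\<not> c \<le> M"
  then have c0: "0 < c" using M by simp
  define q where "q = M / c"
  have q: "0 \<le> q" "q < 1" using less M c0 by (auto simp: q_def)
  have one: "1 \<le> d * (real (2^k) * q ^ (2^k)) + q ^ (2^k)" for k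
  proof -
    have "1 = c ^ (2^k) / c ^ (2^k)" using c0 by simp
    also have "\<dots> \<le> (d * real (2^k) + 1) * M ^ (2^k) / c ^ (2^k)"
      using bd[of k] c0 by (intro divide_right_mono) auto
    also have "\<dots> = d * (real (2^k) * q ^ (2^k)) + q ^ (2^k)"
      by (simp add: q_def power_divide algebra_simps add_divide_distrib)
    finally show ?thesis .
  qed
  have sub: "filterlim (\<lambda>k::nat. 2^k :: nat) at_top at_top"
    by (rule filterlim_subseq) (simp add: strict_mono_def)
  have "(\<lambda>k. d * (real (2^k) * q ^ (2^k)) + q ^ (2^k)) \<longlonglongrightarrow> d * 0 + 0"
  proof (intro tendsto_intros)
    show "(\<lambda>k. real (2^k) * q ^ (2^k)) \<longlonglongrightarrow> 0"
      using q filterlim_compose[OF powser_times_n_limit_0[of q] sub] by simp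
    show "(\<lambda>k::nat. q ^ (2^k)) \<longlonglongrightarrow> 0"
      using q filterlim_compose[OF LIMSEQ_power_zero[of q] sub] by simp
  qed
  then have "1 \<le> d * 0 + (0::real)"
    by (rule LIMSEQ_le_const) (use one in auto)
  then show False by simp
qed

lemma norm_peval_le_unit:
  fixes x :: "'a::unital_cstar_algebra"
  assumes x: "adj x = x" "norm x < 1" and M: "\<And>t. \<bar>t\<bar> \<le> 1 \<Longrightarrow> \<bar>poly p t\<bar> \<le> M"
  shows "norm (peval p x) \<le> M"
proof -
  have "norm (x * x) < 1"
    using x(2) mult_strict_mono'[of "norm x" 1 "norm x" 1] norm_mult_ineq[of x x] by auto
  then obtain y where y: "adj y = y" "y * y = 1 - x * x" "\<And>z. z * (x * x) = (x * x) * z \<Longrightarrow> z * y = y * z"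
    using ex_sqrt_one_minus[of "x * x"] x(1) by (metis adj_mult)
  have xy: "x * y = y * x" by (rule y) (simp add: mult.assoc)
  define u where "u = x + \<i> *\<^sub>C y"
  define v where "v = x + (- \<i>) *\<^sub>C y"
  have i: "\<i> *\<^sub>C \<i> *\<^sub>C y = - y" for y :: 'a
    by (simp add: scaleC_scaleC scaleC_minus_left)
  have uv: "u * v = 1" "v * u = 1"
    by (simp_all add: u_def v_def algebra_simps scaleC_minus_left mult_scaleC_left mult_scaleC_right
        scaleC_add_right scaleC_diff_right xy i y(1,2))
  have adju: "adj u = v" "adj v = u"
    by (simp_all add: u_def v_def adj_add adj_scaleC x y(1))
  have nu: "norm u = 1" "norm v = 1"
    using cstar_identity[of u] cstar_identity[of v] by (simp_all add: adju uv abs_square_eq_1 power2_eq_1_iff)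
  have xu: "x = (1/2) *\<^sub>R (u + v)"
    by (simp add: u_def v_def scaleC_minus_left)
  show ?thesis
  proof (rule exponential_beats_linear)
    show "0 \<le> M" using M[of 0] by simp
    fix k :: nat
    have "norm (peval p x) ^ (2^k) = norm (peval (p ^ (2^k)) x)"
      by (simp add: peval_power norm_power_self_adjoint[OF adj_peval[OF x(1)]])
    also have "\<dots> \<le> real (2 * (2^k * degree p) + 1) * M ^ (2^k)"
    proof (rule norm_peval_le_degree[OF xu uv])
      show "degree (p ^ 2 ^ k) \<le> 2 ^ k * degree p" 
        using degree_power_le[of p "2^k"] by (simp add: mult.commute)
      show "\<bar>poly (p ^ 2 ^ k) t\<bar> \<le> M ^ 2 ^ k" if "\<bar>t\<bar> \<le> 1" for t
        using M[OF that] by (simp add: poly_power power_abs power_mono)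
    qed (simp_all add: nu)
    finally show "norm (peval p x) ^ (2^k) \<le> (real (2 * degree p) * real (2^k) + 1) * M ^ (2^k)"
      by (simp add: algebra_simps)
  qed simp
qed

lemma norm_peval_le_strict:
  fixes x :: "'a::unital_cstar_algebra"
  assumes x: "adj x = x" "norm x < R" and M: "\<And>t. \<bar>t\<bar> \<le> R \<Longrightarrow> \<bar>poly p t\<bar> \<le> M"
  shows "norm (peval p x) \<le> M"
proof -
  have R: "0 < R" using x(2) norm_ge_zero[of x] by linarith
  let ?q = "pcompose p [:0, R:]"
  have "norm (peval ?q ((1/R) *\<^sub>R x)) \<le> M"
  proof (rule norm_peval_le_unit)
    show "\<bar>poly ?q t\<bar> \<le> M" if "\<bar>t\<bar> \<le> 1" for t
    proof -
      have "\<bar>R * t\<bar> \<le> R * 1" using that R by (simp add: abs_mult)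
      then show ?thesis using M[of "R * t"] by (simp add: poly_pcompose mult.commute)
    qed
  qed (use x R in auto)
  then show ?thesis using R by (simp add: peval_pcompose peval_pCons)
qed

text \<open>The symmetric interval given by the norm stands in for the spectrum throughout the
  functional calculus. Shrinking x slightly makes its norm strictly smaller than the radius, as the
  power series behind the unitary requires.\<close>

proposition norm_peval_le:
  fixes x :: "'a::unital_cstar_algebra"
  assumes x: "adj x = x" and M: "\<And>t. \<bar>t\<bar> \<le> norm x \<Longrightarrow> \<bar>poly p t\<bar> \<le> M"
  shows "norm (peval p x) \<le> M"
proof (cases "x = 0")
  case True
  have "peval p 0 = poly p 0 *\<^sub>R (1::'a)"
    by (cases p) (simp add: peval_pCons)
  then show ?thesis using M[of 0] True by simp
next
  case False
  define X where "X k = (1 - 1 / real (Suc k)) *\<^sub>R x" for k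
  have "X \<longlonglongrightarrow> (1 - 0) *\<^sub>R x"
    unfolding X_def by (intro tendsto_intros LIMSEQ_Suc[OF lim_1_over_n])
  then have "(\<lambda>k. norm (peval p (X k))) \<longlonglongrightarrow> norm (peval p x)"
    by (intro tendsto_norm tendsto_peval) simp
  moreover have "norm (peval p (X k)) \<le> M" for k
  proof (rule norm_peval_le_strict[OF _ _ M])
    show "norm (X k) < norm x" using False by (simp add: X_def)
  qed (simp_all add: X_def x)
  ultimately show ?thesis
    by (intro LIMSEQ_le_const2[where X = "\<lambda>k. norm (peval p (X k))"]) auto
qed

section \<open>Continuous functional calculus for self-adjoint elements\<close>

lemma peval_diff: "peval (p - q) x = peval p x - peval q x"
  using peval_add[of "p - q" q x] by (simp add: algebra_simps)

abbreviation poly_approx :: "real \<Rightarrow> (nat \<Rightarrow> real poly) \<Rightarrow> (real \<Rightarrow> real) \<Rightarrow> bool" where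
  "poly_approx R p f \<equiv> uniform_limit {-R..R} (\<lambda>n. poly (p n)) f sequentially"

lemma ex_poly_approx:
  fixes f :: "real \<Rightarrow> real"
  assumes "continuous_on {-R..R} f"
  obtains p where "poly_approx R p f"
proof -
  have "\<exists>p. \<forall>t\<in>{-R..R}. \<bar>f t - poly p t\<bar> < 1 / real (Suc n)" for n
  proof -
    obtain g where g: "real_polynomial_function g" "\<And>t. t \<in> {-R..R} \<Longrightarrow> \<bar>f t - g t\<bar> < 1 / real (Suc n)"
      using Stone_Weierstrass_real_polynomial_function[OF _ assms, of "1 / real (Suc n)"] by auto
    obtain a m where "g = (\<lambda>x. \<Sum>i\<le>m. a i * x ^ i)"
      using g(1) by (auto simp: real_polynomial_function_iff_sum)
    then have "g = poly (\<Sum>i\<le>m. monom (a i) i)"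
      by (auto simp: poly_sum poly_monom)
    with g(2) show ?thesis by blast
  qed
  then obtain p where p: "\<And>n t. t \<in> {-R..R} \<Longrightarrow> \<bar>f t - poly (p n) t\<bar> < 1 / real (Suc n)"
    by metis
  have "poly_approx R p f"
  proof (rule uniform_limitI)
    fix e :: real assume "0 < e"
    then obtain N where N: "N > 0" "1 / real N < e"
      by (metis nat_approx_posE zero_less_Suc)
    show "\<forall>\<^sub>F n in sequentially. \<forall>t\<in>{-R..R}. dist (poly (p n) t) (f t) < e"
    proof (rule eventually_sequentiallyI[of N], intro ballI)
      fix n t assume n: "N \<le> n" and t: "t \<in> {-R..R}"
      have "1 / real (Suc n) \<le> 1 / real N" using n N by (intro divide_left_mono) auto
      then show "dist (poly (p n) t) (f t) < e"
        using p[OF t, of n] N by (simp add: dist_real_def abs_minus_commute)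
    qed
  qed
  then show ?thesis by (rule that)
qed

lemma peval_diff_tendsto_0:
  fixes x :: "'a::unital_cstar_algebra"
  assumes "adj x = x"
    and p: "poly_approx (norm x) p f"
    and q: "poly_approx (norm x) q f"
  shows "(\<lambda>n. peval (p n) x - peval (q n) x) \<longlonglongrightarrow> 0"
proof (rule LIMSEQ_I)
  fix e :: real assume e: "0 < e"
  have e3: "0 < e / 3" using e by simp
  have "\<forall>\<^sub>F n in sequentially. norm (peval (p n) x - peval (q n) x - 0) < e"
    using uniform_limitD[OF p e3] uniform_limitD[OF q e3]
  proof eventually_elim
    case (elim n)
    have "norm (peval (p n - q n) x) \<le> 2 * e / 3"
    proof (rule norm_peval_le[OF assms(1)])
      fix t assume "\<bar>t\<bar> \<le> norm x"
      then have "t \<in> {-norm x..norm x}" by auto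
      then have "\<bar>poly (p n) t - f t\<bar> < e / 3" "\<bar>poly (q n) t - f t\<bar> < e / 3"
        using elim by (auto simp: dist_real_def)
      then show "\<bar>poly (p n - q n) t\<bar> \<le> 2 * e / 3"
        by (simp add: abs_if split: if_splits)
    qed
    then show ?case using e by (simp add: peval_diff)
  qed
  then show "\<exists>no. \<forall>n\<ge>no. norm (peval (p n) x - peval (q n) x - 0) < e"
    by (simp add: eventually_sequentially)
qed

lemma convergent_peval:
  fixes x :: "'a::unital_cstar_algebra"
  assumes "adj x = x"
    and p: "poly_approx (norm x) p f"
  shows "convergent (\<lambda>n. peval (p n) x)"
proof -
  have "Cauchy (\<lambda>n. peval (p n) x)"
  proof (rule CauchyI)
    fix e :: real assume e: "0 < e"
    then have "\<forall>\<^sub>F n in sequentially. \<forall>t\<in>{-norm x..norm x}. dist (poly (p n) t) (f t) < e/3"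
      by (intro uniform_limitD[OF p]) simp
    then obtain N where N: "\<And>n t. N \<le> n \<Longrightarrow> t \<in> {-norm x..norm x} \<Longrightarrow> \<bar>poly (p n) t - f t\<bar> < e/3"
      unfolding eventually_sequentially dist_real_def by blast
    have "norm (peval (p m) x - peval (p n) x) < e" if "N \<le> m" "N \<le> n" for m n
    proof -
      have "norm (peval (p m - p n) x) \<le> 2 * e / 3"
      proof (rule norm_peval_le[OF assms(1)])
        fix t assume "\<bar>t\<bar> \<le> norm x"
        then have "t \<in> {-norm x..norm x}" by auto
        then show "\<bar>poly (p m - p n) t\<bar> \<le> 2 * e / 3"
          using N[OF that(1), of t] N[OF that(2), of t] by (simp add: abs_if split: if_splits)
      qed
      then show ?thesis using e by (simp add: peval_diff)
    qed
    then show "\<exists>M. \<forall>m\<ge>M. \<forall>n\<ge>M. norm (peval (p m) x - peval (p n) x) < e" by blast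
  qed
  then show ?thesis by (simp add: Cauchy_convergent_iff)
qed

text \<open>By \<open>peval_diff_tendsto_0\<close> the limit does not depend on the approximating
  polynomials, so the description is proper whenever x is self-adjoint and f is continuous on the
  symmetric interval.\<close>

definition cfc :: "'a::unital_cstar_algebra \<Rightarrow> (real \<Rightarrow> real) \<Rightarrow> 'a" where
  "cfc x f = (THE y. \<exists>p. poly_approx (norm x) p f \<and>
     (\<lambda>n. peval (p n) x) \<longlonglongrightarrow> y)"

lemma tendsto_cfc:
  fixes x :: "'a::unital_cstar_algebra"
  assumes "adj x = x"
    and p: "poly_approx (norm x) p f"
  shows "(\<lambda>n. peval (p n) x) \<longlonglongrightarrow> cfc x f"
proof -
  obtain y where y: "(\<lambda>n. peval (p n) x) \<longlonglongrightarrow> y"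
    using convergent_peval[OF assms] by (auto simp: convergent_def)
  have "cfc x f = y"
    unfolding cfc_def
  proof (rule the_equality)
    fix z assume "\<exists>p. poly_approx (norm x) p f \<and>
     (\<lambda>n. peval (p n) x) \<longlonglongrightarrow> z"
    then obtain q where q: "poly_approx (norm x) q f" 
      "(\<lambda>n. peval (q n) x) \<longlonglongrightarrow> z" by blast
    have "(\<lambda>n. peval (p n) x - (peval (p n) x - peval (q n) x)) \<longlonglongrightarrow> y - 0"
      by (intro tendsto_diff y peval_diff_tendsto_0[OF assms(1) p q(1)])
    then show "z = y" using q(2) LIMSEQ_unique by auto
  qed (use p y in blast)
  with y show ?thesis by simp
qed

text \<open>The radius R may exceed the norm so that one sequence of polynomials can serve two
  elements at once, or an element together with the range of a polynomial.\<close>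

lemma cfc_approx:
  fixes x :: "'a::unital_cstar_algebra"
  assumes "adj x = x" "continuous_on UNIV f" "norm x \<le> R"
  obtains p where "poly_approx R p f" "(\<lambda>n. peval (p n) x) \<longlonglongrightarrow> cfc x f"
proof -
  obtain p where p: "poly_approx R p f"
    using ex_poly_approx[of R f] assms(2) continuous_on_subset by blast
  then have "poly_approx (norm x) p f"
    by (rule uniform_limit_on_subset) (use assms(3) in auto)
  from tendsto_cfc[OF assms(1) this] p that show ?thesis by blast
qed

lemma cfc_cong:
  assumes "\<And>t. \<bar>t\<bar> \<le> norm x \<Longrightarrow> f t = g t"
  shows "cfc x f = cfc x g"
proof -
  have "uniform_limit {-norm x..norm x} P f sequentially = uniform_limit {-norm x..norm x} P g sequentially" for P
    by (rule uniform_limit_cong) (use assms in auto)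
  then show ?thesis by (simp add: cfc_def)
qed

lemma cfc_poly: "adj x = x \<Longrightarrow> cfc x (poly p) = peval p x"
  using tendsto_cfc[of x "\<lambda>_. p" "poly p"] by (simp add: LIMSEQ_const_iff uniform_limit_const)

lemma cfc_id: "adj x = x \<Longrightarrow> cfc x (\<lambda>t. t) = x"
  using cfc_poly[of x "[:0, 1:]"] by (simp add: peval_pCons poly_pCons[abs_def])

lemma cfc_const: "adj x = x \<Longrightarrow> cfc x (\<lambda>t. c) = of_real c"
  using cfc_poly[of x "[:c:]"] by (simp add: peval_pCons of_real_def poly_pCons[abs_def])

lemma cfc_power: "adj x = x \<Longrightarrow> cfc x (\<lambda>t. t ^ n) = x ^ n"
  using cfc_poly[of x "[:0, 1:] ^ n"] by (simp add: peval_pCons peval_power poly_power[abs_def])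

lemma cfc_add:
  assumes x: "adj x = x" and f: "continuous_on UNIV f" and g: "continuous_on UNIV g"
  shows "cfc x (\<lambda>t. f t + g t) = cfc x f + cfc x g"
proof -
  obtain p where p: "poly_approx (norm x) p f" "(\<lambda>n. peval (p n) x) \<longlonglongrightarrow> cfc x f"
    using cfc_approx[OF x f order_refl] .
  obtain q where q: "poly_approx (norm x) q g" "(\<lambda>n. peval (q n) x) \<longlonglongrightarrow> cfc x g"
    using cfc_approx[OF x g order_refl] .
  have "uniform_limit {-norm x..norm x} (\<lambda>n t. poly (p n + q n) t) (\<lambda>t. f t + g t) sequentially"
    using uniform_limit_add[OF p(1) q(1)] by simp
  from tendsto_cfc[OF x this] show ?thesis
    using tendsto_add[OF p(2) q(2)] LIMSEQ_unique by (simp add: peval_add) blast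
qed

lemma cfc_mult:
  assumes x: "adj x = x" and f: "continuous_on UNIV f" and g: "continuous_on UNIV g"
  shows "cfc x (\<lambda>t. f t * g t) = cfc x f * cfc x g"
proof -
  obtain p where p: "poly_approx (norm x) p f" "(\<lambda>n. peval (p n) x) \<longlonglongrightarrow> cfc x f"
    using cfc_approx[OF x f order_refl] .
  obtain q where q: "poly_approx (norm x) q g" "(\<lambda>n. peval (q n) x) \<longlonglongrightarrow> cfc x g"
    using cfc_approx[OF x g order_refl] .
  have "bounded (f ` {-norm x..norm x})" "bounded (g ` {-norm x..norm x})"
    using f g by (auto intro!: compact_imp_bounded compact_continuous_image intro: continuous_on_subset)
  then have "uniform_limit {-norm x..norm x} (\<lambda>n t. poly (p n * q n) t) (\<lambda>t. f t * g t) sequentially"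
    using uniform_lim_mult[OF p(1) q(1)] by simp
  from tendsto_cfc[OF x this] show ?thesis
    using tendsto_mult[OF p(2) q(2)] LIMSEQ_unique by (simp add: peval_mult) blast
qed

lemma cfc_minus:
  assumes "adj x = x" "continuous_on UNIV f"
  shows "cfc x (\<lambda>t. - f t) = - cfc x f"
  using cfc_mult[OF assms(1) continuous_on_const[of UNIV "-1"] assms(2)] by (simp add: cfc_const assms)

lemma cfc_diff:
  assumes "adj x = x" "continuous_on UNIV f" "continuous_on UNIV g"
  shows "cfc x (\<lambda>t. f t - g t) = cfc x f - cfc x g"
  using cfc_add[OF assms(1,2), of "\<lambda>t. - g t"] assms by (simp add: cfc_minus continuous_on_minus)

lemma adj_cfc:
  assumes x: "adj x = x" and f: "continuous_on UNIV f"
  shows "adj (cfc x f) = cfc x f"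
proof -
  obtain p where "(\<lambda>n. peval (p n) x) \<longlonglongrightarrow> cfc x f"
    using cfc_approx[OF x f order_refl] .
  from tendsto_adj[OF this] this show ?thesis
    using LIMSEQ_unique by (simp add: adj_peval x) blast
qed

lemma norm_cfc_le:
  assumes x: "adj x = x" and f: "continuous_on UNIV f" and M: "\<And>t. \<bar>t\<bar> \<le> norm x \<Longrightarrow> \<bar>f t\<bar> \<le> M"
  shows "norm (cfc x f) \<le> M"
proof (rule field_le_epsilon)
  fix e :: real assume e: "0 < e"
  obtain p where p: "poly_approx (norm x) p f" "(\<lambda>n. peval (p n) x) \<longlonglongrightarrow> cfc x f"
    using cfc_approx[OF x f order_refl] .
  have "\<forall>\<^sub>F n in sequentially. norm (peval (p n) x) \<le> M + e"
    using uniform_limitD[OF p(1) e]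
  proof eventually_elim
    case (elim n)
    show ?case
    proof (rule norm_peval_le[OF x])
      fix t assume t: "\<bar>t\<bar> \<le> norm x"
      then have "t \<in> {-norm x..norm x}" by auto
      then show "\<bar>poly (p n) t\<bar> \<le> M + e"
        using elim M[OF t] by (fastforce simp: dist_real_def)
    qed
  qed
  then show "norm (cfc x f) \<le> M + e"
    by (intro tendsto_upperbound[OF tendsto_norm[OF p(2)]]) auto
qed

lemma cfc_intertwine:
  assumes x: "adj x = x" and y: "adj y = y" and f: "continuous_on UNIV f" and z: "x * z = z * y"
  shows "cfc x f * z = z * cfc y f"
proof -
  define R where "R = max (norm x) (norm y)"
  obtain p where p: "poly_approx R p f" "(\<lambda>n. peval (p n) x) \<longlonglongrightarrow> cfc x f"
    using cfc_approx[OF x f, of R] by (auto simp: R_def)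
  have "poly_approx (norm y) p f"
    by (rule uniform_limit_on_subset[OF p(1)]) (auto simp: R_def)
  then have "(\<lambda>n. z * peval (p n) y) \<longlonglongrightarrow> z * cfc y f"
    by (intro tendsto_mult_left tendsto_cfc y)
  moreover have "(\<lambda>n. peval (p n) x * z) \<longlonglongrightarrow> cfc x f * z"
    by (intro tendsto_mult_right p)
  ultimately show ?thesis
    using LIMSEQ_unique by (simp add: peval_intertwine[OF z]) blast
qed

lemma cfc_compose_poly:
  assumes x: "adj x = x" and f: "continuous_on UNIV f"
  shows "cfc (peval q x) f = cfc x (\<lambda>t. f (poly q t))"
proof -
  have "bounded (poly q ` {-norm x..norm x})"
    by (intro compact_imp_bounded compact_continuous_image continuous_intros) auto
  then obtain B where B: "\<And>t. \<bar>t\<bar> \<le> norm x \<Longrightarrow> \<bar>poly q t\<bar> \<le> B"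
    unfolding bounded_iff by (force simp: abs_le_iff)
  define R where "R = max B (norm (peval q x))"
  obtain p where p: "poly_approx R p f" "(\<lambda>n. peval (p n) (peval q x)) \<longlonglongrightarrow> cfc (peval q x) f"
    by (rule cfc_approx[OF adj_peval[OF x] f, of q R]) (auto simp: R_def)
  have in_R: "poly q t \<in> {-R..R}" if "t \<in> {-norm x..norm x}" for t
    using B[of t] that by (auto simp: R_def abs_le_iff)
  have "uniform_limit {-norm x..norm x} (\<lambda>n. poly (pcompose (p n) q)) (\<lambda>t. f (poly q t)) sequentially"
  proof (rule uniform_limitI)
    fix e :: real assume "0 < e"
    from uniform_limitD[OF p(1) this]
    show "\<forall>\<^sub>F n in sequentially. \<forall>t\<in>{-norm x..norm x}. dist (poly (pcompose (p n) q) t) (f (poly q t)) < e"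
      by eventually_elim (use in_R in \<open>auto simp: poly_pcompose\<close>)
  qed
  from tendsto_cfc[OF x this] p(2) show ?thesis
    using LIMSEQ_unique by (simp add: peval_pcompose) blast
qed

lemma cfc_power_compose:
  assumes "adj x = x" "continuous_on UNIV f"
  shows "cfc (x ^ n) f = cfc x (\<lambda>t. f (t ^ n))"
  using cfc_compose_poly[OF assms, of "[:0,1:] ^ n"] by (simp add: peval_power peval_pCons)

section \<open>Positive elements\<close>

text \<open>Positivity without a spectrum. That \<open>adj y * y\<close> is of this form is a
  theorem, \<open>cpos_adj_mult\<close>.\<close>

definition cpos :: "'a::unital_cstar_algebra \<Rightarrow> bool" where
  "cpos a \<longleftrightarrow> (\<exists>e. adj e = e \<and> a = e * e)"

lemma cposE:
  assumes "cpos a"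
  obtains e where "adj e = e" "a = e * e"
  using assms by (auto simp: cpos_def)

lemma cpos_square: "adj e = e \<Longrightarrow> cpos (e * e)"
  by (auto simp: cpos_def)

lemma cpos_adj: "cpos a \<Longrightarrow> adj a = a"
  by (auto simp: cpos_def adj_mult)

lemma cfc_square:
  assumes "adj e = e" "continuous_on UNIV f"
  shows "cfc (e * e) f = cfc e (\<lambda>t. f (t\<^sup>2))"
  using cfc_power_compose[OF assms, of 2] by (simp add: power2_eq_square)

lemma cpos_cfc:
  assumes x: "adj x = x" and f: "continuous_on UNIV f" and nn: "\<And>t. \<bar>t\<bar> \<le> norm x \<Longrightarrow> 0 \<le> f t"
  shows "cpos (cfc x f)"
proof -
  have c: "continuous_on UNIV (\<lambda>t. sqrt \<bar>f t\<bar>)" by (intro continuous_intros f)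
  have "cfc x f = cfc x (\<lambda>t. sqrt \<bar>f t\<bar> * sqrt \<bar>f t\<bar>)"
    by (rule cfc_cong) (use nn in auto)
  also have "\<dots> = cfc x (\<lambda>t. sqrt \<bar>f t\<bar>) * cfc x (\<lambda>t. sqrt \<bar>f t\<bar>)"
    by (rule cfc_mult[OF x c c])
  finally show ?thesis by (simp add: cpos_square adj_cfc[OF x c])
qed

text \<open>For a = e * e, the element \<open>cfc a f\<close> is the function f(t^2) evaluated at e,
  which sees f on [0, norm a] only. This takes the place of the statement that the spectrum of a is
  nonnegative.\<close>

lemma cfc_cong_cpos:
  assumes "cpos a" "continuous_on UNIV f" "continuous_on UNIV g"
    and "\<And>t. 0 \<le> t \<Longrightarrow> t \<le> norm a \<Longrightarrow> f t = g t"
  shows "cfc a f = cfc a g"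
proof -
  obtain e where e: "adj e = e" "a = e * e" using assms(1) by (rule cposE)
  have na: "norm a = (norm e)\<^sup>2" using cstar_identity[of e] e by simp
  show ?thesis
    unfolding e(2) cfc_square[OF e(1) assms(2)] cfc_square[OF e(1) assms(3)]
  proof (rule cfc_cong)
    fix t assume "\<bar>t\<bar> \<le> norm e"
    then have "t\<^sup>2 \<le> norm a" unfolding na by (metis abs_le_square_iff abs_norm_cancel)
    then show "f (t\<^sup>2) = g (t\<^sup>2)" by (intro assms) auto
  qed
qed

lemma norm_cfc_le_cpos:
  assumes "cpos a" "continuous_on UNIV f" and M: "\<And>t. 0 \<le> t \<Longrightarrow> t \<le> norm a \<Longrightarrow> \<bar>f t\<bar> \<le> M"
  shows "norm (cfc a f) \<le> M"
proof -
  have M0: "0 \<le> M" using M[of 0] by auto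
  \<comment> \<open>Clamping f to [-M, M] changes nothing on [0, norm a] and makes the bound hold on
    the whole symmetric interval.\<close>
  have "cfc a f = cfc a (\<lambda>t. max (-M) (min M (f t)))"
    using assms(2) M by (intro cfc_cong_cpos assms(1) continuous_intros) fastforce+
  also have "norm \<dots> \<le> M"
    using M0 by (intro norm_cfc_le cpos_adj[OF assms(1)] continuous_intros assms(2)) auto
  finally show ?thesis .
qed

lemma cpos_iff_cfc:
  assumes a: "adj a = a"
  shows "cpos a \<longleftrightarrow> cfc a (\<lambda>t. max 0 (- t)) = 0"
proof
  assume "cpos a"
  then have "cfc a (\<lambda>t. max 0 (- t)) = cfc a (\<lambda>t. 0)"
    by (rule cfc_cong_cpos) (auto intro!: continuous_intros)
  then show "cfc a (\<lambda>t. max 0 (- t)) = 0" using a by (simp add: cfc_const)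
next
  assume *: "cfc a (\<lambda>t. max 0 (- t)) = 0"
  have "a = cfc a (\<lambda>t. max 0 t - max 0 (- t))"
    using cfc_id[OF a] cfc_cong[of a "\<lambda>t. t" "\<lambda>t. max 0 t - max 0 (- t)"] by (simp add: max_def)
  also have "\<dots> = cfc a (\<lambda>t. max 0 t)"
    using * a by (subst cfc_diff) (auto intro!: continuous_intros)
  finally have "a = cfc a (\<lambda>t. max 0 t)" .
  moreover have "cpos (cfc a (\<lambda>t. max 0 t))"
    by (rule cpos_cfc[OF a continuous_on_max[OF continuous_on_const continuous_on_id]]) simp
  ultimately show "cpos a" by simp
qed

text \<open>With w = r - a one has a = r - w, and r - t is nonnegative for |t| <= norm w <= r.
  Together with its converse \<open>norm_of_cpos\<close> this turns positivity into a norm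
  inequality, which the triangle inequality makes stable under sums.\<close>

lemma cpos_of_norm:
  assumes a: "adj a = a" and "norm (of_real r - a) \<le> r"
  shows "cpos a"
proof -
  let ?w = "of_real r - a"
  have w: "adj ?w = ?w" using a by (simp add: adj_diff)
  have "cpos (cfc ?w (\<lambda>t. r - t))"
    by (rule cpos_cfc[OF w]) (use assms(2) in \<open>auto intro!: continuous_intros\<close>)
  moreover have "cfc ?w (\<lambda>t. r - t) = a"
    using w by (subst cfc_diff) (auto intro!: continuous_intros simp: cfc_const cfc_id)
  ultimately show ?thesis by simp
qed

lemma norm_of_cpos:
  assumes "cpos a" "norm a \<le> r"
  shows "norm (of_real r - a) \<le> r"
proof -
  have a: "adj a = a" using assms by (simp add: cpos_adj)
  have "of_real r - a = cfc a (\<lambda>t. r - t)"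
    using a by (subst cfc_diff) (auto intro!: continuous_intros simp: cfc_const cfc_id)
  also have "norm \<dots> \<le> r"
    by (rule norm_cfc_le_cpos[OF assms(1)]) (use assms(2) in \<open>auto intro!: continuous_intros\<close>)
  finally show ?thesis .
qed

lemma cpos_add:
  assumes "cpos a" "cpos b"
  shows "cpos (a + b)"
proof (rule cpos_of_norm[of _ "norm a + norm b"])
  have "norm (of_real (norm a + norm b) - (a + b)) = norm ((of_real (norm a) - a) + (of_real (norm b) - b))"
    by (simp add: algebra_simps)
  also have "\<dots> \<le> norm a + norm b"
    by (intro norm_triangle_le add_mono norm_of_cpos assms order_refl)
  finally show "norm (of_real (norm a + norm b) - (a + b)) \<le> norm a + norm b" .
qed (simp add: adj_add cpos_adj assms)

lemma cpos_0 [simp]: "cpos 0"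
  by (auto simp: cpos_def intro: exI[of _ 0])

lemma cpos_sum: "(\<And>i. i \<in> I \<Longrightarrow> cpos (f i)) \<Longrightarrow> cpos (\<Sum>i\<in>I. f i)"
  by (induction I rule: infinite_finite_induct) (auto intro: cpos_add)

lemma cpos_scaleR: "cpos a \<Longrightarrow> 0 \<le> r \<Longrightarrow> cpos (r *\<^sub>R a)"
  by (erule cposE) (auto simp: cpos_def intro!: exI[of _ "sqrt r *\<^sub>R _"])

text \<open>Written as a function of g, where - a = g * g, the negative part of a is t^2, that is, -
  a itself; and it is 0 because a is positive.\<close>

lemma cpos_antisym:
  assumes "cpos a" "cpos (- a)"
  shows "a = 0"
proof -
  obtain g where g: "adj g = g" "- a = g * g" using assms(2) by (rule cposE)
  have a: "a = peval [:0, 0, -1:] g" using g(2) by (simp add: peval_pCons) (metis minus_equation_iff)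
  have "0 = cfc a (\<lambda>t. max 0 (- t))"
    using assms(1) cpos_iff_cfc cpos_adj by metis
  also have "\<dots> = cfc g (\<lambda>t. max 0 (- (poly [:0, 0, -1:] t)))"
    unfolding a by (rule cfc_compose_poly[OF g(1)]) (auto intro!: continuous_intros)
  also have "\<dots> = cfc g (\<lambda>t. t ^ 2)"
    by (rule cfc_cong) (simp add: power2_eq_square max_def)
  also have "\<dots> = - a" using cfc_power[OF g(1), of 2] g(2) by (simp add: power2_eq_square)
  finally show ?thesis by simp
qed

text \<open>The elements \<open>z * adj z\<close> and \<open>adj z * z\<close> are intertwined by z,
  hence so are their positive parts. The positive part of \<open>adj z * z\<close> is 0, so that of
  \<open>z * adj z\<close> annihilates \<open>z * adj z\<close> and has square 0.\<close>

lemma cpos_minus_mult_adj: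
  assumes "cpos (- (adj z * z))"
  shows "cpos (- (z * adj z))"
proof -
  let ?a = "adj z * z" and ?b = "z * adj z"
  have a: "adj ?a = ?a" and b: "adj ?b = ?b" by (simp_all add: adj_mult adj_adj)
  have c: "continuous_on UNIV (\<lambda>t::real. max 0 t)" by (intro continuous_intros)
  obtain c where c': "adj c = c" "- ?a = c * c" using assms by (rule cposE)
  have "?a = peval [:0, 0, -1:] c" using c'(2) by (simp add: peval_pCons) (metis minus_equation_iff)
  then have "cfc ?a (\<lambda>t. max 0 t) = cfc c (\<lambda>t. max 0 (poly [:0, 0, -1:] t))"
    using cfc_compose_poly[OF c'(1) c] by simp
  also have "\<dots> = cfc c (\<lambda>t. 0)"
    by (rule cfc_cong) (simp add: max.absorb1)
  finally have a0: "cfc ?a (\<lambda>t. max 0 t) = 0" using c' by (simp add: cfc_const)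
  have int: "?b * z = z * ?a" by (simp add: mult.assoc)
  have "cfc ?b (\<lambda>t. max 0 t) * ?b = 0"
    using cfc_intertwine[OF b a c int] a0 by (simp add: mult.assoc[symmetric])
  moreover have "cfc ?b (\<lambda>t. max 0 t) * ?b = cfc ?b (\<lambda>t. max 0 t * t)"
    using b by (subst cfc_mult) (auto intro!: continuous_intros simp: cfc_id)
  moreover have "cfc ?b (\<lambda>t. max 0 t * t) = cfc ?b (\<lambda>t. max 0 t * max 0 t)"
    by (rule cfc_cong) (auto simp: max_def)
  moreover have "\<dots> = cfc ?b (\<lambda>t. max 0 t) * cfc ?b (\<lambda>t. max 0 t)"
    by (rule cfc_mult[OF b c c])
  ultimately have "cfc ?b (\<lambda>t. max 0 t) = 0"
    using adj_mult_self_eq_0[of "cfc ?b (\<lambda>t. max 0 t)"] adj_cfc[OF b c] by simp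
  moreover have "?b = peval [:0, -1:] (- ?b)" by (simp add: peval_pCons)
  then have "cfc ?b (\<lambda>t. max 0 t) = cfc (- ?b) (\<lambda>t. max 0 (- t))"
    using cfc_compose_poly[of "- ?b" "\<lambda>t. max 0 t" "[:0,-1:]"] b c by simp
  ultimately show ?thesis
    using b by (simp add: cpos_iff_cfc)
qed

lemma ex_real_imaginary_parts:
  obtains h k where "adj h = h" "adj k = k" "z = h + \<i> *\<^sub>C (k::'a::unital_cstar_algebra)"
proof
  let ?h = "(1/2) *\<^sub>C (z + adj z)" and ?k = "(- \<i> / 2) *\<^sub>C (z - adj z)"
  show "adj ?h = ?h" by (simp add: adj_scaleC adj_add adj_adj add.commute)
  show "adj ?k = ?k"
    by (simp add: adj_scaleC adj_diff adj_adj scaleC_diff_right scaleC_minus_left)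
  show "z = ?h + \<i> *\<^sub>C ?k"
    by (simp add: scaleC_scaleC scaleC_add_right scaleC_diff_right scaleC_add_left[symmetric])
qed

text \<open>Kaplansky's argument: the negative part \<open>n\<close> of \<open>y\<^sup>*y\<close> gives \<open>z = y n\<close> with \<open>-z\<^sup>*z\<close> positive,
  which is impossible for \<open>z \<noteq> 0\<close> because \<open>z\<^sup>*z + z z\<^sup>*\<close> is a sum of squares.\<close>

theorem cpos_adj_mult: "cpos (adj y * (y::'a::unital_cstar_algebra))"
proof -
  let ?x = "adj y * y"
  have x: "adj ?x = ?x" by (simp add: adj_mult adj_adj)
  define f where "f t = max 0 (- t)" for t :: real
  have cf: "continuous_on UNIV f" unfolding f_def by (intro continuous_intros)
  define n where "n = cfc ?x f"
  have n: "adj n = n" unfolding n_def by (rule adj_cfc[OF x cf])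
  define z where "z = y * n"
  have c3: "continuous_on UNIV (\<lambda>t. f t * t * f t)" by (intro continuous_intros cf)
  have "adj z * z = n * ?x * n" by (simp add: z_def adj_mult n mult.assoc)
  also have "\<dots> = cfc ?x (\<lambda>t. f t * t * f t)"
    using x cf by (simp add: n_def cfc_mult cfc_id continuous_on_mult)
  finally have zz: "adj z * z = cfc ?x (\<lambda>t. f t * t * f t)" .
  then have "- (adj z * z) = cfc ?x (\<lambda>t. - (f t * t * f t))"
    by (simp add: cfc_minus[OF x c3])
  moreover have "cpos (cfc ?x (\<lambda>t. - (f t * t * f t)))"
  proof (rule cpos_cfc[OF x])
    show "continuous_on UNIV (\<lambda>t. - (f t * t * f t))" by (intro continuous_intros cf)
  qed (auto simp: f_def max_def mult_nonneg_nonpos)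
  ultimately have neg: "cpos (- (adj z * z))" by simp
  obtain h k where hk: "adj h = h" "adj k = k" "z = h + \<i> *\<^sub>C k" by (rule ex_real_imaginary_parts)
  have "adj z * z + z * adj z = (h * h + h * h) + (k * k + k * k)"
    by (simp add: hk adj_add adj_scaleC algebra_simps mult_scaleC_left mult_scaleC_right scaleC_scaleC
        scaleC_minus_left scaleC_minus_right scaleC_add_right scaleC_diff_right)
  then have "cpos (adj z * z + z * adj z)"
    using hk by (simp add: cpos_add cpos_square)
  from cpos_add[OF this cpos_minus_mult_adj[OF neg]] have "cpos (adj z * z)" by simp
  from cpos_antisym[OF this neg] have "cfc ?x (\<lambda>t. f t * t * f t) = 0" by (simp add: zz)
  \<comment> \<open>Here \<open>f t\<close> is 0 or -t, so the vanishing of \<open>adj z * z\<close>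
    means that the cube of n vanishes.\<close>
  moreover have "cfc ?x (\<lambda>t. f t * t * f t) = cfc ?x (\<lambda>t. - (f t ^ 3))"
    by (rule cfc_cong) (simp add: f_def max_def power3_eq_cube)
  moreover have "cfc ?x (\<lambda>t. f t ^ 3) = n ^ 3"
    using x cf by (simp add: n_def power3_eq_cube cfc_mult continuous_on_mult)
  ultimately have "n ^ 3 = 0"
    using cfc_minus[OF x, of "\<lambda>t. f t ^ 3"] cf by (simp add: continuous_on_power)
  then have "n = 0" using self_adjoint_power_eq_0 n by blast
  then show ?thesis
    using x by (simp add: cpos_iff_cfc n_def f_def[abs_def])
qed

section \<open>Norm estimates from the order, and roots of positive elements\<close>

lemma cpos_conj: 
  assumes "cpos a" shows "cpos (adj c * a * c)"
proof -
  obtain e where "adj e = e" "a = e * e" using assms by (rule cposE)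
  then have "adj c * a * c = adj (e * c) * (e * c)" by (simp add: adj_mult mult.assoc)
  then show ?thesis by (metis cpos_adj_mult)
qed

lemma cpos_norm_diff:
  assumes a: "adj a = a" "norm a \<le> r" shows "cpos (of_real r - a)"
proof -
  have "of_real r - a = cfc a (\<lambda>t. r - t)"
    using a by (subst cfc_diff) (auto intro!: continuous_intros simp: cfc_const cfc_id)
  then show ?thesis
    using cpos_cfc[OF a(1), of "\<lambda>t. r - t"] a(2) by (simp add: continuous_on_diff)
qed

text \<open>The part of a above r, given by max(0, t - r), is the negative part of r - a and so
  vanishes; what remains is min(t, r) evaluated at a.\<close>

lemma norm_le_of_cpos_diff:
  assumes a: "cpos a" and r: "cpos (of_real r - a)" "0 \<le> r"
  shows "norm a \<le> r"
proof -
  have aa: "adj a = a" using a by (rule cpos_adj)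
  have ra: "adj (of_real r - a) = of_real r - a" using r(1) by (rule cpos_adj)
  have "of_real r - a = peval [:r, -1:] a" by (simp add: peval_pCons of_real_def)
  then have "0 = cfc (peval [:r, -1:] a) (\<lambda>t. max 0 (- t))"
    using r(1) ra cpos_iff_cfc by metis
  also have "\<dots> = cfc a (\<lambda>t. max 0 (t - r))"
    using cfc_compose_poly[OF aa, of "\<lambda>t. max 0 (- t)" "[:r, -1:]"] by (simp add: continuous_intros)
  finally have 0: "cfc a (\<lambda>t. max 0 (t - r)) = 0" ..
  have "a = cfc a (\<lambda>t. min t r + max 0 (t - r))"
    using cfc_id[OF aa] cfc_cong[of a "\<lambda>t. t" "\<lambda>t. min t r + max 0 (t - r)"] by (simp add: min_def max_def)
  also have "\<dots> = cfc a (\<lambda>t. min t r)"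
    using 0 aa by (subst cfc_add) (auto intro!: continuous_intros)
  also have "norm \<dots> \<le> r"
    by (rule norm_cfc_le_cpos[OF a]) (use r(2) in \<open>auto intro!: continuous_intros\<close>)
  finally show ?thesis .
qed

lemma norm_mono_cpos:
  assumes "cpos a" "cpos (b - a)" shows "norm a \<le> norm b"
proof -
  have "cpos b" using cpos_add[OF assms] by simp
  then have "cpos (of_real (norm b) - b)" by (intro cpos_norm_diff cpos_adj) auto
  from cpos_add[OF this assms(2)] show ?thesis
    by (intro norm_le_of_cpos_diff assms(1)) auto
qed

text \<open>A positive d is a function of its power d^k; this is the uniqueness behind
  \<open>mroot\<close>.\<close>

lemma cpos_root_unique:
  fixes d :: "'a::unital_cstar_algebra"
  assumes "cpos d" "0 < k"
  shows "d = cfc (d ^ k) (\<lambda>t. root k \<bar>t\<bar>)"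
proof -
  have d: "adj d = d" using assms(1) by (rule cpos_adj)
  have "cfc (d ^ k) (\<lambda>t. root k \<bar>t\<bar>) = cfc d (\<lambda>t. root k \<bar>t ^ k\<bar>)"
    by (rule cfc_power_compose[OF d]) (auto intro!: continuous_intros)
  also have "\<dots> = cfc d (\<lambda>t. t)"
    by (rule cfc_cong_cpos[OF assms(1)])
      (auto intro!: continuous_intros simp: power_abs[symmetric] real_root_power_cancel assms(2))
  finally show ?thesis by (simp add: cfc_id d)
qed

lemma cpos_root_exists:
  assumes b: "cpos b" and "0 < k"
  shows "cpos (cfc b (\<lambda>t. root k \<bar>t\<bar>)) \<and> cfc b (\<lambda>t. root k \<bar>t\<bar>) ^ k = b"
proof
  have bb: "adj b = b" using b by (rule cpos_adj)
  have c: "continuous_on UNIV (\<lambda>t. root k \<bar>t\<bar>)" by (intro continuous_intros)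
  show "cpos (cfc b (\<lambda>t. root k \<bar>t\<bar>))" by (rule cpos_cfc[OF bb c]) (simp add: assms)
  have "cfc b (\<lambda>t. root k \<bar>t\<bar>) ^ j = cfc b (\<lambda>t. root k \<bar>t\<bar> ^ j)" for j
    by (induction j) (simp_all add: cfc_const bb cfc_mult[OF bb c] continuous_on_power[OF c])
  then have "cfc b (\<lambda>t. root k \<bar>t\<bar>) ^ k = cfc b (\<lambda>t. root k \<bar>t\<bar> ^ k)" .
  also have "\<dots> = cfc b (\<lambda>t. t)"
    by (rule cfc_cong_cpos[OF b]) (auto intro!: continuous_intros simp: assms)
  finally show "cfc b (\<lambda>t. root k \<bar>t\<bar>) ^ k = b" by (simp add: cfc_id bb)
qed

section \<open>Quasitraces and Cuntz comparison of multiples\<close>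

text \<open>What a quasitrace satisfies, stated without subalgebras: additivity for commuting
  self-adjoint pairs. There is no normalization, because the extension to n by n matrices takes the
  value n at the unit.\<close>

definition cqt :: "('a::unital_cstar_algebra \<Rightarrow> complex) \<Rightarrow> bool" where
  "cqt \<sigma> \<longleftrightarrow>
     (\<forall>x. \<sigma> (x * adj x) \<in> \<real>\<^sub>\<ge>\<^sub>0 \<and> \<sigma> (x * adj x) = \<sigma> (adj x * x)) \<and>
     (\<forall>x y. adj x = x \<longrightarrow> adj y = y \<longrightarrow> x * y = y * x \<longrightarrow> \<sigma> (x + y) = \<sigma> x + \<sigma> y) \<and>
     (\<forall>r x. adj x = x \<longrightarrow> \<sigma> (r *\<^sub>R x) = of_real r * \<sigma> x)"

lemma cqt_add: "cqt \<sigma> \<Longrightarrow> adj x = x \<Longrightarrow> adj y = y \<Longrightarrow> x * y = y * x \<Longrightarrow> \<sigma> (x + y) = \<sigma> x + \<sigma> y"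
  by (simp add: cqt_def)

lemma cqt_scaleR: "cqt \<sigma> \<Longrightarrow> adj x = x \<Longrightarrow> \<sigma> (r *\<^sub>R x) = of_real r * \<sigma> x"
  by (simp add: cqt_def)

lemma cqt_commute: "cqt \<sigma> \<Longrightarrow> \<sigma> (x * adj x) = \<sigma> (adj x * x)"
  by (simp add: cqt_def)

lemma cqt_cpos:
  assumes "cqt \<sigma>" "cpos a"
  shows "\<sigma> a \<in> \<real>\<^sub>\<ge>\<^sub>0"
proof -
  obtain e where "adj e = e" "a = e * e" using assms(2) by (rule cposE)
  moreover have "\<sigma> (e * adj e) \<in> \<real>\<^sub>\<ge>\<^sub>0" using assms(1) unfolding cqt_def by blast
  ultimately show ?thesis by (metis (no_types))
qed

lemma cqt_0: "cqt \<sigma> \<Longrightarrow> \<sigma> 0 = 0"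
  using cqt_scaleR[of \<sigma> 0 0] by simp

lemma of_real_commute: "of_real r * x = x * (of_real r :: 'a::real_algebra_1)"
  by (simp add: of_real_def)

text \<open>Both norm a + a and norm a - a are positive, and scalars commute with a, so additivity
  applies to these sums.\<close>

lemma cqt_bound:
  assumes s: "cqt \<sigma>" and a: "adj a = a"
  shows "cmod (\<sigma> a) \<le> norm a * Re (\<sigma> 1)"
proof -
  have n1: "\<sigma> (of_real r) = of_real r * \<sigma> 1" for r
    using cqt_scaleR[OF s, of 1 r] by (simp add: of_real_def[where 'a = 'a])
  have "\<sigma> (of_real (norm a) + a) = of_real (norm a) * \<sigma> 1 + \<sigma> a"
    using cqt_add[OF s, of "of_real (norm a)" a] a by (simp add: n1 of_real_commute)
  moreover have "cpos (of_real (norm a) + a)"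
    using cpos_norm_diff[of "- a" "norm a"] a by simp
  ultimately have 1: "of_real (norm a) * \<sigma> 1 + \<sigma> a \<in> \<real>\<^sub>\<ge>\<^sub>0"
    using cqt_cpos[OF s] by metis
  have "\<sigma> (of_real (norm a) + (- a)) = of_real (norm a) * \<sigma> 1 + \<sigma> (- a)"
    using cqt_add[OF s, of "of_real (norm a)" "- a"] a by (simp add: n1 of_real_commute)
  moreover have "\<sigma> (- a) = - \<sigma> a" using cqt_scaleR[OF s a, of "-1"] by simp
  moreover have "cpos (of_real (norm a) + (- a))"
    using cpos_norm_diff[of a "norm a"] a by simp
  ultimately have 2: "of_real (norm a) * \<sigma> 1 - \<sigma> a \<in> \<real>\<^sub>\<ge>\<^sub>0"
    using cqt_cpos[OF s] by (metis diff_conv_add_uminus)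
  have 3: "\<sigma> 1 \<in> \<real>\<^sub>\<ge>\<^sub>0" using cqt_cpos[OF s, of 1] cpos_square[of "1::'a"] by simp
  have "Im (\<sigma> a) = 0" "\<bar>Re (\<sigma> a)\<bar> \<le> norm a * Re (\<sigma> 1)"
    using 1 2 3 by (auto simp: complex_nonneg_Reals_iff)
  then show ?thesis by (simp add: cmod_eq_Re)
qed

lemma ex_left_inverse_one_plus:
  fixes z :: "'a::{real_normed_algebra_1, banach}"
  assumes "norm z < 1"
  shows "\<exists>s. s * (1 + z) = 1"
proof -
  have "summable (\<lambda>k. norm ((- z) ^ k))"
  proof (rule summable_comparison_test')
    show "summable (\<lambda>k. norm z ^ k)" using assms by simp
    show "norm (norm ((- z) ^ k)) \<le> norm z ^ k" for k
      using norm_power_ineq[of "- z" k] by simp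
  qed
  then have summ: "summable (\<lambda>k. (- z) ^ k)" by (rule summable_norm_cancel)
  have "(\<lambda>k. (- z) ^ k * (1 + z)) sums ((\<Sum>k. (- z) ^ k) * (1 + z))"
    by (intro sums_mult2 summable_sums summ)
  moreover have "(\<lambda>k. (- z) ^ k - (- z) ^ Suc k) sums ((- z) ^ 0 - 0)"
    by (rule telescope_sums') (rule summable_LIMSEQ_zero[OF summ])
  moreover have "(- z) ^ k * (1 + z) = (- z) ^ k - (- z) ^ Suc k" for k
    by (simp only: power_Suc2) (simp add: distrib_left)
  ultimately have "(\<Sum>k. (- z) ^ k) * (1 + z) = 1"
    using sums_unique2 by (metis (no_types, lifting) diff_zero power_0 sums_cong)
  then show ?thesis ..
qed

text \<open>The element g - g * p has vanishing \<open>adj\<close> square. Hence a self-adjoint root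
  of an element under p is itself under p.\<close>

lemma mult_projection_of_square:
  fixes g p :: "'a::unital_cstar_algebra"
  assumes g: "adj g = g" and p: "adj p = p" "p * p = p" and gp: "g * g * p = g * g"
  shows "g * p = g"
proof -
  have "p * g * g = g * g" using arg_cong[OF gp, of adj] g p by (simp add: adj_mult mult.assoc)
  then have "adj (g - g * p) * (g - g * p) = 0"
    using gp g p by (simp add: adj_diff adj_mult algebra_simps)
  then show ?thesis using adj_mult_self_eq_0 by fastforce
qed

text \<open>The \<open>w i\<close> are partial isometries with common initial projection p and
  orthogonal ranges. The sum of \<open>w i * a * adj (w i)\<close> models K orthogonal copies of a,
  multiplicatively for elements under p.\<close>

lemma sum_conj_mult:
  fixes w :: "nat \<Rightarrow> 'a::unital_cstar_algebra"
  assumes w: "\<And>i. i < K \<Longrightarrow> adj (w i) * w i = p" "\<And>i j. i < K \<Longrightarrow> j < K \<Longrightarrow> i \<noteq> j \<Longrightarrow> adj (w i) * w j = 0"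
  shows "(\<Sum>i<K. w i * a * adj (w i)) * (\<Sum>i<K. w i * b * adj (w i)) = (\<Sum>i<K. w i * (a * p * b) * adj (w i))"
proof -
  have "(\<Sum>i<K. w i * a * adj (w i)) * (\<Sum>j<K. w j * b * adj (w j))
      = (\<Sum>i<K. \<Sum>j<K. w i * a * (adj (w i) * w j) * b * adj (w j))"
    by (simp add: sum_product mult.assoc)
  also have "\<dots> = (\<Sum>i<K. \<Sum>j<K. if j = i then w i * (a * p * b) * adj (w i) else 0)"
  proof (intro sum.cong refl)
    fix i j assume "i \<in> {..<K}" "j \<in> {..<K}"
    then show "w i * a * (adj (w i) * w j) * b * adj (w j) = (if j = i then w i * (a * p * b) * adj (w i) else 0)"
      using w(1)[of i] w(2)[of i j] by (cases "j = i") (simp_all, simp add: mult.assoc)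
  qed
  also have "\<dots> = (\<Sum>i<K. w i * (a * p * b) * adj (w i))" by simp
  finally show ?thesis .
qed

text \<open>Each copy has the value of c, by \<open>cqt_commute\<close> for \<open>w i * e\<close>
  where c = e * e. Distinct copies multiply to 0, hence commute, and their values add up.\<close>

lemma cqt_sum_conj:
  fixes w :: "nat \<Rightarrow> 'a::unital_cstar_algebra"
  assumes s: "cqt \<sigma>"
    and w: "\<And>i. i < K \<Longrightarrow> adj (w i) * w i = p" "\<And>i j. i < K \<Longrightarrow> j < K \<Longrightarrow> i \<noteq> j \<Longrightarrow> adj (w i) * w j = 0"
    and c: "cpos c" "c * p = c" and p: "adj p = p" "p * p = p"
  shows "\<sigma> (\<Sum>i<K. w i * c * adj (w i)) = of_nat K * \<sigma> c"
proof -
  obtain e where e: "adj e = e" "c = e * e" using c(1) by (rule cposE)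
  have ep: "e * p = e" by (rule mult_projection_of_square[OF e(1) p]) (use e c in simp)
  have cc: "adj c = c" using c(1) by (rule cpos_adj)
  have one: "\<sigma> (w i * c * adj (w i)) = \<sigma> c" if "i < K" for i
  proof -
    have "\<sigma> (w i * c * adj (w i)) = \<sigma> ((w i * e) * adj (w i * e))"
      by (simp add: adj_mult e mult.assoc)
    also have "\<dots> = \<sigma> (adj (w i * e) * (w i * e))" by (rule cqt_commute[OF s])
    also have "adj (w i * e) * (w i * e) = e * (adj (w i) * w i) * e" by (simp add: adj_mult e mult.assoc)
    also have "\<dots> = c" using w(1)[OF that] ep e by simp
    finally show ?thesis .
  qed
  have "\<sigma> (\<Sum>i<n. w i * c * adj (w i)) = of_nat n * \<sigma> c" if "n \<le> K" for n
    using that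
  proof (induction n)
    case (Suc n)
    let ?S = "\<Sum>i<n. w i * c * adj (w i)" and ?T = "w n * c * adj (w n)"
    have "?S * ?T = (\<Sum>i<n. w i * c * (adj (w i) * w n) * c * adj (w n))"
      by (simp add: sum_distrib_right mult.assoc)
    also have "\<dots> = 0" using w(2)[of _ n] Suc.prems by (intro sum.neutral) auto
    finally have ST: "?S * ?T = 0" .
    have "?T * ?S = (\<Sum>i<n. w n * c * (adj (w n) * w i) * c * adj (w i))"
      by (simp add: sum_distrib_left mult.assoc)
    also have "\<dots> = 0" using w(2)[of n] Suc.prems by (intro sum.neutral) auto
    finally have TS: "?T * ?S = 0" .
    have "\<sigma> (?S + ?T) = \<sigma> ?S + \<sigma> ?T"
      using ST TS by (intro cqt_add[OF s]) (simp_all add: adj_sum adj_mult adj_adj cc mult.assoc)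
    then show ?case using Suc one[of n] by (simp add: distrib_right)
  qed (simp add: cqt_0[OF s])
  then show ?thesis by simp
qed

text \<open>Let P be the sum of the range projections. Then norm c minus the sum equals norm c (1 -
  P) plus the copies of norm c - c, which is positive. It matters that the bound does not grow with
  K.\<close>

lemma norm_sum_conj_le:
  fixes w :: "nat \<Rightarrow> 'a::unital_cstar_algebra"
  assumes w: "\<And>i. i < K \<Longrightarrow> adj (w i) * w i = p" "\<And>i j. i < K \<Longrightarrow> j < K \<Longrightarrow> i \<noteq> j \<Longrightarrow> adj (w i) * w j = 0"
    and c: "cpos c" and p: "adj p = p" "p * p = p"
  shows "norm (\<Sum>i<K. w i * c * adj (w i)) \<le> norm c"
proof (rule norm_le_of_cpos_diff)
  have cc: "cpos (w i * a * adj (w i))" if "cpos a" for i a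
    using cpos_conj[OF that, of "adj (w i)"] by (simp add: adj_adj)
  show "cpos (\<Sum>i<K. w i * c * adj (w i))" by (intro cpos_sum cc c)
  let ?P = "\<Sum>i<K. w i * adj (w i)"
  have wp: "w i * p = w i" if "i < K" for i
  proof -
    have "adj (w i - w i * p) * (w i - w i * p) = adj (w i) * w i - adj (w i) * w i * p - p * (adj (w i) * w i) + p * (adj (w i) * w i) * p"
      by (simp add: adj_diff adj_mult p algebra_simps)
    also have "\<dots> = 0" using w(1)[OF that] p by simp
    finally show ?thesis using adj_mult_self_eq_0 by fastforce
  qed
  have "?P * ?P = (\<Sum>i<K. w i * p * adj (w i))"
    using sum_conj_mult[OF w, where a = 1 and b = 1] by simp
  also have "\<dots> = ?P" by (simp add: wp)
  finally have PP: "?P * ?P = ?P" .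
  have "adj (1 - ?P) = 1 - ?P" by (simp add: adj_diff adj_sum adj_mult adj_adj)
  moreover have "(1 - ?P) * (1 - ?P) = 1 - ?P" using PP by (simp add: algebra_simps)
  ultimately have "cpos (1 - ?P)" by (metis cpos_square)
  then have "cpos (norm c *\<^sub>R (1 - ?P) + (\<Sum>i<K. w i * (of_real (norm c) - c) * adj (w i)))"
    by (intro cpos_add cpos_scaleR cpos_sum cc cpos_norm_diff cpos_adj c) auto
  also have "(\<Sum>i<K. w i * (of_real (norm c) - c) * adj (w i)) = norm c *\<^sub>R ?P - (\<Sum>i<K. w i * c * adj (w i))"
    by (simp add: algebra_simps sum_subtractf scaleR_sum_right of_real_def)
  also have "norm c *\<^sub>R (1 - ?P) + (norm c *\<^sub>R ?P - (\<Sum>i<K. w i * c * adj (w i))) 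
      = of_real (norm c) - (\<Sum>i<K. w i * c * adj (w i))"
    by (simp add: scaleR_diff_right of_real_def)
  finally show "cpos (of_real (norm c) - (\<Sum>i<K. w i * c * adj (w i)))" .
qed simp

text \<open>The cut-down \<open>(C - \<delta>)\<^sub>+\<close> of \<open>C\<close>, where \<open>C\<^sup>k\<close> is approximately \<open>u u\<^sup>*\<close>, is exactly of the form \<open>v v\<^sup>*\<close> with
  \<open>v = v p\<close>: the element \<open>R = u u\<^sup>* + max(C, \<delta>)\<^sup>k - C\<^sup>k\<close> is invertible and agrees with \<open>u u\<^sup>*\<close> on the
  support of \<open>(C - \<delta>)\<^sub>+\<close>.\<close>

lemma cut_down_factorization:
  fixes C p u :: "'a::unital_cstar_algebra"
  assumes C: "cpos C" and d: "0 < \<delta>" and p: "adj p = p" "p * p = p" and up: "u * p = u"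
    and near: "norm (u * adj u - C ^ k) < \<delta> ^ k"
  obtains v where "v * adj v = cfc C (\<lambda>t. max 0 (t - \<delta>))" "v * p = v"
proof -
  have CC: "adj C = C" using C by (rule cpos_adj)
  define g where "g t = sqrt (max 0 (t - \<delta>))" for t
  define m where "m t = max t \<delta> ^ k" for t
  have cg: "continuous_on UNIV g" unfolding g_def by (intro continuous_intros)
  have cm: "continuous_on UNIV m" unfolding m_def by (intro continuous_intros)
  have m0: "m t \<noteq> 0" for t using d by (auto simp: m_def)
  have cm': "continuous_on UNIV (\<lambda>t. 1 / m t)" by (intro continuous_intros cm) (use m0 in auto)
  define G where "G = cfc C g"
  define D where "D = cfc C m"
  define I where "I = cfc C (\<lambda>t. 1 / m t)"
  have G: "adj G = G" unfolding G_def by (rule adj_cfc[OF CC cg])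
  have GG: "G * G = cfc C (\<lambda>t. max 0 (t - \<delta>))"
    unfolding G_def cfc_mult[OF CC cg cg, symmetric] by (rule cfc_cong) (simp add: g_def)
  have "I * D = cfc C (\<lambda>t. 1)"
    unfolding I_def D_def cfc_mult[OF CC cm' cm, symmetric] by (rule cfc_cong) (simp add: m0)
  then have ID: "I * D = 1" by (simp add: cfc_const CC)
  have "norm I \<le> 1 / \<delta> ^ k"
    unfolding I_def
  proof (rule norm_cfc_le[OF CC cm'])
    fix t
    have "\<delta> ^ k \<le> m t" unfolding m_def using d by (intro power_mono) auto
    then show "\<bar>1 / m t\<bar> \<le> 1 / \<delta> ^ k" using d by (simp add: frac_le)
  qed
  have "(D - C ^ k) * G = cfc C (\<lambda>t. (m t - t ^ k) * g t)"
    using CC cm cg by (simp add: D_def G_def cfc_mult cfc_diff cfc_power continuous_on_diff continuous_on_power)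
  also have "\<dots> = cfc C (\<lambda>t. 0)"
    by (rule cfc_cong) (auto simp: m_def g_def max_def)
  finally have DG: "(D - C ^ k) * G = 0" by (simp add: cfc_const CC)
  define R where "R = u * adj u + (D - C ^ k)"
  have RG: "R * G = u * adj u * G" using DG by (simp add: R_def distrib_right)
  have "norm (I * (R - D)) \<le> norm I * norm (u * adj u - C ^ k)"
    by (simp add: R_def norm_mult_ineq)
  also have "\<dots> \<le> 1 / \<delta> ^ k * norm (u * adj u - C ^ k)"
    by (rule mult_right_mono) (fact, simp)
  also have "\<dots> < 1" using near d by (simp add: field_simps)
  finally obtain s where "s * (1 + I * (R - D)) = 1"
    using ex_left_inverse_one_plus by blast
  \<comment> \<open>Since I D = 1, the element 1 + I (R - D) is I R, so s I is a left inverse of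
    R.\<close>
  then have SR: "s * I * R = 1" using ID by (simp add: algebra_simps)
  define S where "S = s * I"
  have SuG: "S * (u * adj u) * G = G"
    using SR RG by (metis S_def mult.assoc mult_1)
  have "cpos (adj (G * u) * (G * u))" by (rule cpos_adj_mult)
  \<comment> \<open>The candidate \<open>S * u * adj u * G\<close> for v has the right square but
    need not satisfy \<open>v * p = v\<close>. Replacing \<open>adj u * G\<close> by a self-adjoint
    h with \<open>h * h = adj u * G * G * u\<close> leaves \<open>v * adj v\<close> unchanged, and h
    p = h because its square is under p.\<close>
  then obtain h where h: "adj h = h" "adj (G * u) * (G * u) = h * h" by (rule cposE)
  have hp: "h * p = h"
    by (rule mult_projection_of_square[OF h(1) p]) (simp add: h(2)[symmetric] mult.assoc up)
  define v where "v = S * u * h"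
  have "v * adj v = S * u * (h * h) * adj u * adj S"
    by (simp add: v_def adj_mult h(1) mult.assoc)
  also have "\<dots> = (S * (u * adj u) * G) * (G * (u * adj u) * adj S)"
    by (simp add: h(2)[symmetric] adj_mult G mult.assoc)
  also have "G * (u * adj u) * adj S = adj (S * (u * adj u) * G)"
    by (simp add: adj_mult adj_adj G mult.assoc)
  finally have "v * adj v = G * G" by (simp add: SuG G)
  moreover have "v * p = v" by (simp add: v_def mult.assoc hp)
  ultimately show ?thesis using that GG by simp
qed

text \<open>The element \<open>adj v * v\<close> lies below r p, where r is the norm of
  \<open>v * adj v\<close>, and commutes with p, so \<sigma> is additive on \<open>adj v * v\<close>
  and the difference; \<open>cqt_commute\<close> carries the bound over to
  \<open>v * adj v\<close>.\<close>

lemma cqt_le_of_factorization: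
  fixes v p :: "'a::unital_cstar_algebra"
  assumes s: "cqt \<sigma>" and p: "adj p = p" "p * p = p" and v: "v * p = v"
  shows "Re (\<sigma> (v * adj v)) \<le> norm (v * adj v) * Re (\<sigma> p)"
proof -
  define r where "r = norm (v * adj v)"
  let ?b = "adj v * v"
  have b: "adj ?b = ?b" by (simp add: adj_mult adj_adj)
  have nb: "norm ?b = r"
    using cstar_identity[of v] cstar_identity[of "adj v"] by (simp add: adj_adj r_def)
  have pv: "p * adj v = adj v" using arg_cong[OF v, of adj] p by (simp add: adj_mult)
  have bp: "?b * p = ?b" "p * ?b = ?b" using v pv by (simp_all add: mult.assoc[symmetric]) (simp add: mult.assoc v)
  have "cpos (adj p * (of_real r - ?b) * p)"
    by (intro cpos_conj cpos_norm_diff b) (simp add: nb)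
  also have "adj p * (of_real r - ?b) * p = r *\<^sub>R p - ?b"
    using bp p by (simp add: algebra_simps of_real_def)
  finally have pos: "cpos (r *\<^sub>R p - ?b)" .
  have "\<sigma> (?b + (r *\<^sub>R p - ?b)) = \<sigma> ?b + \<sigma> (r *\<^sub>R p - ?b)"
    using b bp p by (intro cqt_add[OF s]) (simp_all add: adj_diff right_diff_distrib left_diff_distrib)
  then have "\<sigma> (r *\<^sub>R p) = \<sigma> ?b + \<sigma> (r *\<^sub>R p - ?b)" by simp
  moreover have "\<sigma> (r *\<^sub>R p) = of_real r * \<sigma> p" by (rule cqt_scaleR[OF s p(1)])
  ultimately have "of_real r * \<sigma> p = \<sigma> ?b + \<sigma> (r *\<^sub>R p - ?b)" by simp
  from arg_cong[OF this, of Re] have "r * Re (\<sigma> p) = Re (\<sigma> ?b) + Re (\<sigma> (r *\<^sub>R p - ?b))" by simp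
  moreover have "0 \<le> Re (\<sigma> (r *\<^sub>R p - ?b))"
    using cqt_cpos[OF s pos] by (simp add: complex_nonneg_Reals_iff)
  ultimately have "Re (\<sigma> ?b) \<le> r * Re (\<sigma> p)" by linarith
  then show ?thesis by (simp add: cqt_commute[OF s] r_def)
qed

text \<open>The comparison is assumed for c^k, the bound is obtained for its root c. Let C be the
  sum of K copies of c. Its cut-down by \<delta> factors through p, so its value is at most norm c
  times \<sigma>(p), whatever K is; undoing the cut costs at most \<delta> \<sigma>(1), and \<delta>
  is arbitrarily small.\<close>

proposition cqt_multiple_le:
  fixes w :: "nat \<Rightarrow> 'a::unital_cstar_algebra"
  assumes s: "cqt \<sigma>"
    and w: "\<And>i. i < K \<Longrightarrow> adj (w i) * w i = p" "\<And>i j. i < K \<Longrightarrow> j < K \<Longrightarrow> i \<noteq> j \<Longrightarrow> adj (w i) * w j = 0"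
    and c: "cpos c" "c * p = c" and p: "adj p = p" "p * p = p" and k: "0 < k"
    and le: "\<And>e. 0 < e \<Longrightarrow> \<exists>x. norm (x * c ^ k * adj x - (\<Sum>i<K. w i * c ^ k * adj (w i))) < e"
  shows "real K * Re (\<sigma> c) \<le> norm c * Re (\<sigma> p)"
proof -
  obtain e where e: "adj e = e" "c = e * e" using c(1) by (rule cposE)
  have ep: "e * p = e" by (rule mult_projection_of_square[OF e(1) p]) (use e c in simp)
  have pc: "p * c = c" using arg_cong[OF c(2), of adj] p cpos_adj[OF c(1)] by (simp add: adj_mult)
  define C where "C = (\<Sum>i<K. w i * c * adj (w i))"
  \<comment> \<open>The powers of C consist of copies of the powers of c, so the hypothesis
    \<open>le\<close> compares c^k with C^k.\<close>
  have Ck: "C ^ Suc j = (\<Sum>i<K. w i * c ^ Suc j * adj (w i))" for j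
  proof (induction j)
    case (Suc j)
    have "C ^ Suc (Suc j) = C * (\<Sum>i<K. w i * c ^ Suc j * adj (w i))"
      by (simp only: power_Suc[of C "Suc j"] Suc)
    also have "\<dots> = (\<Sum>i<K. w i * (c * p * c ^ Suc j) * adj (w i))"
      unfolding C_def by (rule sum_conj_mult[OF w])
    finally show ?case by (simp add: c mult.assoc)
  qed (simp add: C_def)
  have C: "cpos C"
    unfolding C_def using cpos_conj[OF c(1), of "adj (w _)"] by (intro cpos_sum) (simp add: adj_adj)
  have CC: "adj C = C" using C by (rule cpos_adj)
  have nC: "norm C \<le> norm c" unfolding C_def by (rule norm_sum_conj_le[OF w c(1) p])
  have sC: "\<sigma> C = of_nat K * \<sigma> c" unfolding C_def by (rule cqt_sum_conj[OF s w c p])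
  have p0: "0 \<le> Re (\<sigma> p)" using cqt_cpos[OF s, of p] cpos_square[OF p(1)] p by (simp add: complex_nonneg_Reals_iff)
  have bound: "real K * Re (\<sigma> c) \<le> norm c * Re (\<sigma> p) + \<delta> * Re (\<sigma> 1)" if d: "0 < \<delta>" for \<delta>
  proof -
    obtain x where x: "norm (x * c ^ k * adj x - C ^ k) < \<delta> ^ k"
      using le[of "\<delta> ^ k"] Ck[of "k - 1"] d k by auto
    define u where "u = x * e ^ k"
    have "u * adj u = x * (e ^ k * e ^ k) * adj x" by (simp add: u_def adj_mult adj_power e mult.assoc)
    also have "e ^ k * e ^ k = c ^ k" by (simp add: e(2) power_add[symmetric] power_mult[symmetric] mult_2[symmetric] power2_eq_square[symmetric] mult.commute)
    finally have uu: "norm (u * adj u - C ^ k) < \<delta> ^ k" using x by simp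
    have "e ^ k * p = e ^ k" using ep k by (cases k) (simp_all add: power_Suc2 mult.assoc del: power_Suc)
    then have up: "u * p = u" by (simp add: u_def mult.assoc)
    obtain v where v: "v * adj v = cfc C (\<lambda>t. max 0 (t - \<delta>))" "v * p = v"
      using cut_down_factorization[OF C d p up uu] .
    define H where "H = cfc C (\<lambda>t. max 0 (t - \<delta>))"
    define Q where "Q = cfc C (\<lambda>t. max 0 (\<delta> - t))"
    have cH: "continuous_on UNIV (\<lambda>t. max 0 (t - \<delta>))" and cQ: "continuous_on UNIV (\<lambda>t. max 0 (\<delta> - t))"
      by (intro continuous_intros)+
    have nH: "norm H \<le> norm c"
      unfolding H_def by (rule norm_cfc_le_cpos[OF C cH]) (use d nC in auto)
    have sH: "Re (\<sigma> H) \<le> norm c * Re (\<sigma> p)"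
      using cqt_le_of_factorization[OF s p v(2)] mult_right_mono[OF nH p0] unfolding v(1) H_def[symmetric] by simp
    have aH: "adj H = H" and aQ: "adj Q = Q" unfolding H_def Q_def by (rule adj_cfc[OF CC] cH cQ)+
    \<comment> \<open>Monotonicity of \<sigma> is replaced by the identity t + max(0, \<delta> - t)
      = \<delta> + max(0, t - \<delta>): both sides are sums of commuting functions of C, and Q has
      nonnegative value.\<close>
    have "C + Q = cfc C (\<lambda>t. t + max 0 (\<delta> - t))"
      unfolding Q_def using CC cQ by (simp add: cfc_add cfc_id)
    also have "\<dots> = cfc C (\<lambda>t. \<delta> + max 0 (t - \<delta>))" by (rule cfc_cong) (simp add: max_def)
    also have "\<dots> = of_real \<delta> + H"
      unfolding H_def using CC cH by (simp add: cfc_add cfc_const)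
    finally have "\<sigma> (C + Q) = \<sigma> (of_real \<delta> + H)" by simp
    moreover have "\<sigma> (C + Q) = \<sigma> C + \<sigma> Q"
      by (intro cqt_add[OF s] CC aQ) (simp add: Q_def cfc_intertwine[OF CC CC cQ, symmetric])
    moreover have "\<sigma> (of_real \<delta> + H) = of_real \<delta> * \<sigma> 1 + \<sigma> H"
      using cqt_add[OF s, of "of_real \<delta>" H] cqt_scaleR[OF s, of 1 \<delta>] aH by (simp add: of_real_def)
    ultimately have "\<sigma> C + \<sigma> Q = of_real \<delta> * \<sigma> 1 + \<sigma> H" by simp
    from arg_cong[OF this, of Re] have "Re (\<sigma> C) + Re (\<sigma> Q) = \<delta> * Re (\<sigma> 1) + Re (\<sigma> H)" by simp
    moreover have "0 \<le> Re (\<sigma> Q)"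
      using cqt_cpos[OF s cpos_cfc[OF CC cQ]] by (simp add: complex_nonneg_Reals_iff Q_def)
    ultimately have "Re (\<sigma> C) \<le> \<delta> * Re (\<sigma> 1) + Re (\<sigma> H)"
      by linarith
    then show ?thesis using sH sC by simp
  qed
  have one: "0 \<le> Re (\<sigma> 1)" using cqt_cpos[OF s, of 1] cpos_square[of "1::'a"] by (simp add: complex_nonneg_Reals_iff)
  show ?thesis
  proof (rule field_le_epsilon)
    fix \<epsilon> :: real assume "0 < \<epsilon>"
    \<comment> \<open>The summand 1 in the denominator covers \<sigma>(1) = 0.\<close>
    then have "0 < \<epsilon> / (1 + Re (\<sigma> 1))" using one by simp
    from bound[OF this] have "real K * Re (\<sigma> c) \<le> norm c * Re (\<sigma> p) + \<epsilon> / (1 + Re (\<sigma> 1)) * Re (\<sigma> 1)" .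
    also have "\<epsilon> / (1 + Re (\<sigma> 1)) * Re (\<sigma> 1) \<le> \<epsilon>"
      using one \<open>0 < \<epsilon>\<close> by (simp add: field_simps)
    finally show "real K * Re (\<sigma> c) \<le> norm c * Re (\<sigma> p) + \<epsilon>" by simp
  qed
qed

section \<open>The matrix algebras\<close>

lemma matricesI: "(\<And>i j. \<not> (i < n \<and> j < n) \<Longrightarrow> x i j = 0) \<Longrightarrow> x \<in> matrices n"
  by (auto simp: matrices_def)

lemma matrices_0: "x \<in> matrices n \<Longrightarrow> \<not> (i < n \<and> j < n) \<Longrightarrow> x i j = 0"
  by (auto simp: matrices_def)

lemma matrices_mono: "m \<le> n \<Longrightarrow> matrices m \<subseteq> matrices n"
  by (fastforce simp: matrices_def)

lemma matrices_in_mono: "x \<in> matrices m \<Longrightarrow> m \<le> n \<Longrightarrow> x \<in> matrices n"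
  using matrices_mono by blast

lemma zero_in_matrices [simp]: "(\<lambda>i j. 0) \<in> matrices n"
  by (simp add: matrices_def)

lemma mplus_in_matrices: "x \<in> matrices n \<Longrightarrow> y \<in> matrices n \<Longrightarrow> mplus x y \<in> matrices n"
  by (rule matricesI) (simp add: mplus_def matrices_0)

lemma mminus_in_matrices: "x \<in> matrices n \<Longrightarrow> y \<in> matrices n \<Longrightarrow> mminus x y \<in> matrices n"
  by (rule matricesI) (simp add: mminus_def matrices_0)

lemma mscale_in_matrices: "x \<in> matrices n \<Longrightarrow> mscale c x \<in> matrices n"
  by (rule matricesI) (simp add: mscale_def matrices_0)

lemma madj_in_matrices: "x \<in> matrices n \<Longrightarrow> madj x \<in> matrices n"
  by (rule matricesI) (auto simp add: madj_def matrices_0)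

lemma corner_in_matrices: "1 \<le> n \<Longrightarrow> corner a \<in> matrices n"
  by (rule matricesI) (auto simp: corner_def)

text \<open>The size of the left factor is decisive, as \<open>mmult\<close> sums over the nonzero
  entries in one of its rows.\<close>

lemma mmult_eq:
  assumes "x \<in> matrices n"
  shows "mmult x y i j = (\<Sum>k<n. x i k * y k j)"
  unfolding mmult_def
  by (rule sum.mono_neutral_left) (use assms in \<open>auto simp: matrices_def\<close>)

lemma mmult_in_matrices: "x \<in> matrices n \<Longrightarrow> y \<in> matrices n \<Longrightarrow> mmult x y \<in> matrices n"
  by (rule matricesI) (auto simp: mmult_eq[of x n] matrices_0 intro!: sum.neutral)

lemma mmult_assoc:
  assumes "x \<in> matrices n" "y \<in> matrices n"
  shows "mmult (mmult x y) z = mmult x (mmult y z)"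
proof (intro ext)
  fix i j
  have "mmult (mmult x y) z i j = (\<Sum>l<n. (\<Sum>k<n. x i k * y k l) * z l j)"
    by (simp add: mmult_eq[OF mmult_in_matrices[OF assms]] mmult_eq[OF assms(1)])
  also have "\<dots> = (\<Sum>l<n. \<Sum>k<n. x i k * (y k l * z l j))"
    by (simp add: sum_distrib_right mult.assoc)
  also have "\<dots> = (\<Sum>k<n. x i k * (\<Sum>l<n. y k l * z l j))"
    by (subst sum.swap) (simp add: sum_distrib_left)
  also have "\<dots> = mmult x (mmult y z) i j"
    by (simp add: mmult_eq[OF assms(1)] mmult_eq[OF assms(2)])
  finally show "mmult (mmult x y) z i j = mmult x (mmult y z) i j" .
qed

lemma madj_mmult:
  assumes "x \<in> matrices n" "y \<in> matrices n"
  shows "madj (mmult x y) = mmult (madj y) (madj x)"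
proof (intro ext)
  fix i j
  show "madj (mmult x y) i j = mmult (madj y) (madj x) i j"
    unfolding mmult_eq[OF madj_in_matrices[OF assms(2)]]
    by (simp add: madj_def mmult_eq[OF assms(1)] adj_sum adj_mult)
qed

lemma madj_madj [simp]: "madj (madj x) = x"
  by (simp add: madj_def adj_adj)

lemma mmult_mplus_left: "x \<in> matrices n \<Longrightarrow> y \<in> matrices n \<Longrightarrow> mmult (mplus x y) z = mplus (mmult x z) (mmult y z)"
  using mmult_eq[OF mplus_in_matrices, of x n y z]
  by (intro ext) (simp add: mplus_def mmult_eq[of _ n] distrib_right sum.distrib)

lemma mmult_mplus_right: "x \<in> matrices n \<Longrightarrow> mmult x (mplus y z) = mplus (mmult x y) (mmult x z)"
  by (intro ext) (simp add: mmult_eq[of _ n] mplus_def distrib_left sum.distrib)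

lemma mmult_mscale_left: "x \<in> matrices n \<Longrightarrow> mmult (mscale c x) y = mscale c (mmult x y)"
  using mmult_eq[OF mscale_in_matrices, of x n c y]
  by (intro ext) (simp add: mscale_def mmult_eq[of _ n] mult_scaleC_left scaleC_sum_right)

lemma mmult_mscale_right: "x \<in> matrices n \<Longrightarrow> mmult x (mscale c y) = mscale c (mmult x y)"
  by (intro ext) (simp add: mmult_eq[of _ n] mscale_def mult_scaleC_right scaleC_sum_right)

definition mid :: "nat \<Rightarrow> 'a::unital_cstar_algebra mat_array" where
  "mid n = (\<lambda>i j. if i = j \<and> i < n then 1 else 0)"

lemma mid_in_matrices: "mid n \<in> matrices n"
  by (rule matricesI) (auto simp: mid_def)

lemma madj_mid [simp]: "madj (mid n) = mid n"
  by (auto simp: madj_def mid_def fun_eq_iff)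

lemma mmult_mid_left: "x \<in> matrices n \<Longrightarrow> mmult (mid n) x = x"
proof (intro ext)
  fix i j assume x: "x \<in> matrices n"
  have "mmult (mid n) x i j = (\<Sum>k<n. if k = i then x k j else 0)"
    unfolding mmult_eq[OF mid_in_matrices] by (intro sum.cong) (auto simp: mid_def)
  then show "mmult (mid n) x i j = x i j" using matrices_0[OF x] by simp
qed

lemma mmult_mid_right: "x \<in> matrices n \<Longrightarrow> mmult x (mid n) = x"
proof (intro ext)
  fix i j assume x: "x \<in> matrices n"
  have "mmult x (mid n) i j = (\<Sum>k<n. if k = j then x i k else 0)"
    unfolding mmult_eq[OF x] by (intro sum.cong) (auto simp: mid_def)
  then show "mmult x (mid n) i j = x i j" using matrices_0[OF x] by simp
qed

section \<open>The Hilbert module norm\<close>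

definition vip :: "nat \<Rightarrow> (nat \<Rightarrow> 'a::unital_cstar_algebra) \<Rightarrow> (nat \<Rightarrow> 'a) \<Rightarrow> 'a" where
  "vip n v w = (\<Sum>i<n. adj (v i) * w i)"

lemma vnorm_vip: "vnorm n v = sqrt (norm (vip n v v))"
  by (simp add: vnorm_def vip_def)

lemma vnorm_sq: "(vnorm n v)\<^sup>2 = norm (vip n v v)"
  by (simp add: vnorm_vip)

lemma vnorm_ge_0 [simp]: "0 \<le> vnorm n v"
  by (simp add: vnorm_vip)

lemma cpos_vip: "cpos (vip n v v)"
  unfolding vip_def by (intro cpos_sum cpos_adj_mult)

lemma adj_vip: "adj (vip n v w) = vip n w v"
  by (simp add: vip_def adj_sum adj_mult adj_adj)

lemma vip_diff_mult:
  "vip n (\<lambda>i. w i - v i * t) (\<lambda>i. w i - v i * t) 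
    = vip n w w - vip n w v * t - adj t * vip n v w + adj t * vip n v v * t"
  unfolding vip_def sum_distrib_left sum_distrib_right sum_subtractf[symmetric] sum.distrib[symmetric]
  by (rule sum.cong) (simp_all add: adj_diff adj_mult algebra_simps)

text \<open>Expand the inner square of w - v t for t = z/r, where z is \<open>vip n v w\<close> and
  r > 0 bounds the norm of \<open>vip n v v\<close>. As \<open>adj z * vip n v v * z\<close> is at
  most r times \<open>adj z * z\<close>, positivity leaves \<open>adj z * z\<close> divided by r
  below \<open>vip n w w\<close>. Letting r approach the norm also covers
  \<open>vip n v v = 0\<close>.\<close>

lemma vip_Cauchy_Schwarz: "norm (vip n v w) \<le> vnorm n v * vnorm n w"
proof -
  let ?z = "vip n v w"
  have *: "(norm ?z)\<^sup>2 \<le> r * norm (vip n w w)" if r: "norm (vip n v v) \<le> r" "0 < r" for r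
  proof -
    let ?u = "\<lambda>i. w i - v i * ((1/r) *\<^sub>R ?z)"
    have 1: "vip n ?u ?u = vip n w w - ((1/r) *\<^sub>R (adj ?z * ?z) + (1/r) *\<^sub>R (adj ?z * ?z)) + (1/r\<^sup>2) *\<^sub>R (adj ?z * vip n v v * ?z)"
    proof -
      have "vip n ?u ?u = vip n w w - vip n w v * ((1/r) *\<^sub>R ?z) - adj ((1/r) *\<^sub>R ?z) * vip n v w
          + adj ((1/r) *\<^sub>R ?z) * vip n v v * ((1/r) *\<^sub>R ?z)"
        by (rule vip_diff_mult)
      also have "vip n w v = adj ?z" by (simp add: adj_vip)
      finally show ?thesis
        by (simp add: power2_eq_square)
    qed
    have "cpos (adj ?z * (of_real r - vip n v v) * ?z)"
      by (intro cpos_conj cpos_norm_diff cpos_adj[OF cpos_vip] r)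
    then have "cpos (vip n ?u ?u + (1/r\<^sup>2) *\<^sub>R (adj ?z * (of_real r - vip n v v) * ?z))"
      by (intro cpos_add cpos_vip cpos_scaleR) auto
    also have "(1/r\<^sup>2) *\<^sub>R (adj ?z * (of_real r - vip n v v) * ?z) = (1/r) *\<^sub>R (adj ?z * ?z) - (1/r\<^sup>2) *\<^sub>R (adj ?z * vip n v v * ?z)"
      using r by (simp add: right_diff_distrib left_diff_distrib of_real_def scaleR_diff_right power2_eq_square)
    finally have "cpos (vip n w w - (1/r) *\<^sub>R (adj ?z * ?z))"
      unfolding 1 by (simp add: algebra_simps)
    moreover have "cpos ((1/r) *\<^sub>R (adj ?z * ?z))" using r by (intro cpos_scaleR cpos_adj_mult) auto
    ultimately have "norm ((1/r) *\<^sub>R (adj ?z * ?z)) \<le> norm (vip n w w)"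
      by (intro norm_mono_cpos)
    then show ?thesis using r by (simp add: cstar_identity field_simps)
  qed
  have "(norm ?z)\<^sup>2 \<le> norm (vip n v v) * norm (vip n w w)"
  proof (rule field_le_epsilon)
    fix e :: real assume e: "0 < e"
    define d where "d = e / (1 + norm (vip n w w))"
    have p: "0 < 1 + norm (vip n w w)" using norm_ge_zero[of "vip n w w"] by linarith
    have d: "0 < d" "d * norm (vip n w w) \<le> e" using e p by (auto simp: d_def field_simps)
    have "(norm ?z)\<^sup>2 \<le> (norm (vip n v v) + d) * norm (vip n w w)"
      using d by (intro *) (auto intro: add_nonneg_pos)
    then show "(norm ?z)\<^sup>2 \<le> norm (vip n v v) * norm (vip n w w) + e"
      using d by (simp add: distrib_right)
  qed
  then have "(norm ?z)\<^sup>2 \<le> (vnorm n v * vnorm n w)\<^sup>2"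
    by (simp add: power_mult_distrib vnorm_sq)
  then show ?thesis by (rule power2_le_imp_le) simp
qed

lemma vnorm_add: "vnorm n (\<lambda>i. v i + w i) \<le> vnorm n v + vnorm n w"
proof (rule power2_le_imp_le)
  have "vip n (\<lambda>i. v i + w i) (\<lambda>i. v i + w i) = (vip n v v + vip n v w) + (vip n w v + vip n w w)"
    by (simp add: vip_def adj_add distrib_left distrib_right sum.distrib)
  also have "norm \<dots> \<le> ((vnorm n v)\<^sup>2 + vnorm n v * vnorm n w) + (vnorm n w * vnorm n v + (vnorm n w)\<^sup>2)"
    unfolding vnorm_sq by (intro norm_triangle_le add_mono vip_Cauchy_Schwarz) auto
  finally show "(vnorm n (\<lambda>i. v i + w i))\<^sup>2 \<le> (vnorm n v + vnorm n w)\<^sup>2"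
    by (simp add: vnorm_sq[of n "\<lambda>i. v i + w i"] power2_sum algebra_simps)
qed simp

lemma vnorm_scaleC: "vnorm n (\<lambda>i. c *\<^sub>C v i) = cmod c * vnorm n v"
proof -
  have "vip n (\<lambda>i. c *\<^sub>C v i) (\<lambda>i. c *\<^sub>C v i) = (cnj c * c) *\<^sub>C vip n v v"
    by (simp add: vip_def adj_scaleC mult_scaleC_left mult_scaleC_right scaleC_scaleC scaleC_sum_right mult.commute)
  then show ?thesis
    by (simp add: vnorm_vip norm_scaleC norm_mult real_sqrt_mult)
qed

lemma norm_le_vnorm:
  assumes "i < n" shows "norm (v i) \<le> vnorm n v"
proof (rule power2_le_imp_le)
  have "vip n v v - adj (v i) * v i = (\<Sum>j\<in>{..<n} - {i}. adj (v j) * v j)"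
    using assms by (simp add: vip_def sum_diff1)
  then have "norm (adj (v i) * v i) \<le> norm (vip n v v)"
    by (intro norm_mono_cpos cpos_adj_mult) (simp add: cpos_sum cpos_adj_mult)
  then show "(norm (v i))\<^sup>2 \<le> (vnorm n v)\<^sup>2" by (simp add: vnorm_sq cstar_identity)
qed simp

lemma vnorm_le_sum: "vnorm n v \<le> (\<Sum>i<n. norm (v i))"
proof (rule power2_le_imp_le)
  have "(vnorm n v)\<^sup>2 \<le> (\<Sum>i<n. norm (adj (v i) * v i))"
    unfolding vnorm_sq vip_def by (rule norm_sum)
  also have "\<dots> = (\<Sum>i<n. norm (v i) * norm (v i))" by (simp add: cstar_identity power2_eq_square)
  also have "\<dots> \<le> (\<Sum>i<n. norm (v i) * (\<Sum>i<n. norm (v i)))"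
    by (intro sum_mono mult_left_mono member_le_sum) auto
  also have "\<dots> = (\<Sum>i<n. norm (v i))\<^sup>2" by (simp add: power2_eq_square sum_distrib_right)
  finally show "(vnorm n v)\<^sup>2 \<le> (\<Sum>i<n. norm (v i))\<^sup>2" .
qed (simp add: sum_nonneg)

lemma vnorm_cong: "(\<And>i. i < n \<Longrightarrow> v i = w i) \<Longrightarrow> vnorm n v = vnorm n w"
  by (simp add: vnorm_def)

lemma vnorm_zero [simp]: "vnorm n (\<lambda>i. 0) = 0"
  by (simp add: vnorm_def)

section \<open>Operator norm of a matrix acting on the Hilbert module\<close>

definition mapp :: "nat \<Rightarrow> 'a::unital_cstar_algebra mat_array \<Rightarrow> (nat \<Rightarrow> 'a) \<Rightarrow> nat \<Rightarrow> 'a" where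
  "mapp n x v = (\<lambda>i. \<Sum>j<n. x i j * v j)"

lemma mnorm_mapp: "mnorm n x = (SUP v\<in>{v. vnorm n v \<le> 1}. vnorm n (mapp n x v))"
  by (simp add: mnorm_def mapp_def)

text \<open>A crude bound, which makes the supremum in \<open>mnorm\<close> finite.\<close>

lemma vnorm_mapp_le_sum: "vnorm n (mapp n x v) \<le> (\<Sum>i<n. \<Sum>j<n. norm (x i j)) * vnorm n v"
proof -
  have "vnorm n (mapp n x v) \<le> (\<Sum>i<n. norm (mapp n x v i))" by (rule vnorm_le_sum)
  also have "\<dots> \<le> (\<Sum>i<n. (\<Sum>j<n. norm (x i j)) * vnorm n v)"
  proof (rule sum_mono)
    fix i
    have "norm (mapp n x v i) \<le> (\<Sum>j<n. norm (x i j) * vnorm n v)"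
      unfolding mapp_def
    proof (rule sum_norm_le)
      fix j assume "j \<in> {..<n}"
      then show "norm (x i j * v j) \<le> norm (x i j) * vnorm n v"
        using norm_mult_ineq[of "x i j" "v j"] mult_left_mono[OF norm_le_vnorm[of j n v] norm_ge_zero[of "x i j"]] by simp
    qed
    then show "norm (mapp n x v i) \<le> (\<Sum>j<n. norm (x i j)) * vnorm n v" by (simp add: sum_distrib_right)
  qed
  finally show ?thesis by (simp add: sum_distrib_right)
qed

lemma bdd_above_mapp: "bdd_above ((\<lambda>v. vnorm n (mapp n x v)) ` {v. vnorm n v \<le> 1})"
proof (rule bdd_aboveI2)
  fix v :: "nat \<Rightarrow> 'a" assume "v \<in> {v. vnorm n v \<le> 1}"
  then have "(\<Sum>i<n. \<Sum>j<n. norm (x i j)) * vnorm n v \<le> (\<Sum>i<n. \<Sum>j<n. norm (x i j)) * 1"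
    by (intro mult_left_mono sum_nonneg) auto
  then show "vnorm n (mapp n x v) \<le> (\<Sum>i<n. \<Sum>j<n. norm (x i j))"
    using vnorm_mapp_le_sum[of n x v] by simp
qed

lemma mnorm_ge_0: "0 \<le> mnorm n x"
  unfolding mnorm_mapp by (rule cSUP_upper2[OF bdd_above_mapp, of "\<lambda>i. 0"]) auto

lemma vnorm_mapp_le: "vnorm n (mapp n x v) \<le> mnorm n x * vnorm n v"
proof (cases "vnorm n v = 0")
  case True
  then show ?thesis using vnorm_mapp_le_sum[of n x v] by simp
next
  case False
  define r where "r = vnorm n v"
  have r: "0 < r" using False vnorm_ge_0[of n v] unfolding r_def by linarith
  let ?v = "\<lambda>i. of_real (1/r) *\<^sub>C v i"
  have "vnorm n ?v = 1" using r by (simp only: vnorm_scaleC) (simp add: r_def norm_divide)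
  then have "vnorm n (mapp n x ?v) \<le> mnorm n x"
    unfolding mnorm_mapp by (intro cSUP_upper[OF _ bdd_above_mapp]) auto
  moreover have "mapp n x ?v = (\<lambda>i. of_real (1/r) *\<^sub>C mapp n x v i)"
    by (simp add: mapp_def mult_scaleC_right scaleC_sum_right)
  ultimately have "vnorm n (mapp n x v) / r \<le> mnorm n x"
    using r by (simp add: vnorm_scaleC norm_divide)
  then show ?thesis using r by (simp add: r_def[symmetric] divide_le_eq)
qed

lemma mnorm_leI:
  assumes "\<And>v. vnorm n (mapp n x v) \<le> c * vnorm n v" "0 \<le> c"
  shows "mnorm n x \<le> c"
  unfolding mnorm_mapp
proof (rule cSUP_least)
  show "{v :: nat \<Rightarrow> 'a. vnorm n v \<le> 1} \<noteq> {}" using vnorm_zero by (metis (mono_tags) empty_iff mem_Collect_eq zero_le_one)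
  fix v :: "nat \<Rightarrow> 'a" assume "v \<in> {v. vnorm n v \<le> 1}"
  then have "c * vnorm n v \<le> c * 1" using assms(2) by (intro mult_left_mono) auto
  then show "vnorm n (mapp n x v) \<le> c" using assms(1)[of v] by simp
qed

lemma mnorm_le_sum: "mnorm n x \<le> (\<Sum>i<n. \<Sum>j<n. norm (x i j))"
  by (rule mnorm_leI[OF vnorm_mapp_le_sum]) (simp add: sum_nonneg)

lemma norm_le_mnorm:
  assumes "i < n" "j < n" shows "norm (x i j) \<le> mnorm n x"
proof -
  let ?e = "\<lambda>k. if k = j then 1 else (0::'a)"
  have "vip n ?e ?e = 1"
    unfolding vip_def using assms(2) by (simp add: if_distrib cong: if_cong)
  then have e: "vnorm n ?e = 1" by (simp add: vnorm_vip)
  have "mapp n x ?e i = x i j"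
    unfolding mapp_def using assms(2) by (simp add: if_distrib cong: if_cong)
  then show ?thesis
    using norm_le_vnorm[OF assms(1), of "mapp n x ?e"] vnorm_mapp_le[of n x ?e] e by simp
qed

lemma mnorm_mplus: "mnorm n (mplus x y) \<le> mnorm n x + mnorm n y"
proof (rule mnorm_leI)
  fix v :: "nat \<Rightarrow> 'a"
  have "mapp n (mplus x y) v = (\<lambda>i. mapp n x v i + mapp n y v i)"
    by (simp add: mapp_def mplus_def distrib_right sum.distrib)
  then show "vnorm n (mapp n (mplus x y) v) \<le> (mnorm n x + mnorm n y) * vnorm n v"
    using vnorm_add[of n "mapp n x v" "mapp n y v"] vnorm_mapp_le[of n x v] vnorm_mapp_le[of n y v]
    by (simp add: distrib_right)
qed (simp add: mnorm_ge_0)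

lemma mnorm_zero [simp]: "mnorm n (\<lambda>i j. 0 :: 'a::unital_cstar_algebra) = 0"
  using mnorm_le_sum[of n "\<lambda>i j. 0 :: 'a"] mnorm_ge_0[of n "\<lambda>i j. 0 :: 'a"] by simp

lemma mnorm_mscale: "mnorm n (mscale c x) = cmod c * mnorm n x"
proof -
  have le: "mnorm n (mscale c x) \<le> cmod c * mnorm n x" for c and x :: "'a mat_array"
  proof (rule mnorm_leI)
    fix v :: "nat \<Rightarrow> 'a"
    have "mapp n (mscale c x) v = (\<lambda>i. c *\<^sub>C mapp n x v i)"
      by (simp add: mapp_def mscale_def mult_scaleC_left scaleC_sum_right)
    then show "vnorm n (mapp n (mscale c x) v) \<le> cmod c * mnorm n x * vnorm n v"
      using mult_left_mono[OF vnorm_mapp_le[of n x v], of "cmod c"] by (simp add: vnorm_scaleC mult.assoc)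
  qed (simp add: mnorm_ge_0)
  show ?thesis
  proof (cases "c = 0")
    case True
    then have "mscale c x = (\<lambda>i j. 0)" by (simp add: mscale_def)
    then show ?thesis using True by simp
  next
    case False
    then have "mscale (1/c) (mscale c x) = x" by (simp add: mscale_def scaleC_scaleC)
    then have "mnorm n x \<le> mnorm n (mscale c x) / cmod c"
      using le[of "1/c" "mscale c x"] by (simp add: norm_divide)
    then show ?thesis using le[of c x] False by (simp add: field_simps)
  qed
qed

lemma mapp_mmult: "x \<in> matrices n \<Longrightarrow> mapp n (mmult x y) v = mapp n x (mapp n y v)"
proof
  fix i assume x: "x \<in> matrices n"
  have "mapp n (mmult x y) v i = (\<Sum>j<n. \<Sum>k<n. x i k * (y k j * v j))"
    by (simp add: mapp_def mmult_eq[OF x] sum_distrib_right mult.assoc)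
  also have "\<dots> = mapp n x (mapp n y v) i"
    by (subst sum.swap) (simp add: mapp_def sum_distrib_left)
  finally show "mapp n (mmult x y) v i = mapp n x (mapp n y v) i" .
qed

lemma mnorm_mmult: 
  assumes "x \<in> matrices n" shows "mnorm n (mmult x y) \<le> mnorm n x * mnorm n y"
proof (rule mnorm_leI)
  fix v :: "nat \<Rightarrow> 'a"
  have "vnorm n (mapp n (mmult x y) v) \<le> mnorm n x * vnorm n (mapp n y v)"
    by (simp add: mapp_mmult[OF assms] vnorm_mapp_le)
  also have "\<dots> \<le> mnorm n x * (mnorm n y * vnorm n v)"
    by (intro mult_left_mono vnorm_mapp_le mnorm_ge_0)
  finally show "vnorm n (mapp n (mmult x y) v) \<le> mnorm n x * mnorm n y * vnorm n v" by (simp add: mult.assoc)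
qed (simp add: mnorm_ge_0)

lemma vip_mapp: "vip n (mapp n x v) w = vip n v (mapp n (madj x) w)"
proof -
  have "vip n (mapp n x v) w = (\<Sum>i<n. \<Sum>j<n. adj (v j) * (adj (x i j) * w i))"
    by (simp add: vip_def mapp_def adj_sum adj_mult sum_distrib_right mult.assoc)
  also have "\<dots> = vip n v (mapp n (madj x) w)"
    by (subst sum.swap) (simp add: vip_def mapp_def madj_def sum_distrib_left)
  finally show ?thesis .
qed

text \<open>The inner square of x v is the inner product of v with \<open>mmult (madj x) x\<close>
  applied to v, to which Cauchy-Schwarz applies.\<close>

lemma mnorm_sq_le:
  assumes x: "x \<in> matrices n" shows "(mnorm n x)\<^sup>2 \<le> mnorm n (mmult (madj x) x)"
proof -
  let ?b = "mnorm n (mmult (madj x) x)"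
  have "mnorm n x \<le> sqrt ?b"
  proof (rule mnorm_leI)
    fix v :: "nat \<Rightarrow> 'a"
    have "(vnorm n (mapp n x v))\<^sup>2 = norm (vip n v (mapp n (mmult (madj x) x) v))"
      by (simp add: vnorm_sq vip_mapp mapp_mmult[OF madj_in_matrices[OF x]])
    also have "\<dots> \<le> vnorm n v * vnorm n (mapp n (mmult (madj x) x) v)"
      by (rule vip_Cauchy_Schwarz)
    also have "\<dots> \<le> vnorm n v * (?b * vnorm n v)"
      by (intro mult_left_mono vnorm_mapp_le) simp
    also have "\<dots> = (sqrt ?b * vnorm n v)\<^sup>2" by (simp add: power_mult_distrib mnorm_ge_0 power2_eq_square)
    finally show "vnorm n (mapp n x v) \<le> sqrt ?b * vnorm n v"
      by (rule power2_le_imp_le) (simp add: mnorm_ge_0)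
  qed (simp add: mnorm_ge_0)
  then have "(mnorm n x)\<^sup>2 \<le> (sqrt ?b)\<^sup>2" by (intro power_mono mnorm_ge_0)
  then show ?thesis by (simp add: mnorm_ge_0)
qed

lemma mnorm_madj:
  assumes x: "x \<in> matrices n" shows "mnorm n (madj x) = mnorm n x"
proof -
  have le: "mnorm n x \<le> mnorm n (madj x)" if x: "x \<in> matrices n" for x :: "'a mat_array"
  proof (cases "mnorm n x = 0")
    case False
    have "mnorm n x * mnorm n x \<le> mnorm n (madj x) * mnorm n x"
      using mnorm_sq_le[OF x] mnorm_mmult[OF madj_in_matrices[OF x], of x] by (simp add: power2_eq_square)
    then show ?thesis using False mnorm_ge_0[of n x] by simp
  qed (simp add: mnorm_ge_0)
  show ?thesis using le[OF x] le[OF madj_in_matrices[OF x]] by simp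
qed

lemma mnorm_cstar:
  assumes x: "x \<in> matrices n" shows "mnorm n (mmult (madj x) x) = (mnorm n x)\<^sup>2"
  using mnorm_sq_le[OF x] mnorm_mmult[OF madj_in_matrices[OF x], of x] mnorm_madj[OF x]
  by (simp add: power2_eq_square)

lemma mnorm_mid: "1 \<le> n \<Longrightarrow> mnorm n (mid n :: 'a::unital_cstar_algebra mat_array) = 1"
proof (rule antisym)
  assume n: "1 \<le> n"
  show "mnorm n (mid n :: 'a mat_array) \<le> 1"
  proof (rule mnorm_leI)
    fix v :: "nat \<Rightarrow> 'a"
    have "vnorm n (mapp n (mid n) v) = vnorm n v"
    proof (rule vnorm_cong)
      fix i assume "i < n"
      then have "mapp n (mid n) v i = (\<Sum>j<n. if j = i then v j else 0)"
        unfolding mapp_def by (intro sum.cong) (auto simp: mid_def)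
      then show "mapp n (mid n) v i = v i" using \<open>i < n\<close> by simp
    qed
    then show "vnorm n (mapp n (mid n) v) \<le> 1 * vnorm n v" by simp
  qed simp
  show "1 \<le> mnorm n (mid n :: 'a mat_array)"
    using norm_le_mnorm[of 0 n 0 "mid n :: 'a mat_array"] n by (simp add: mid_def)
qed

lemma mnorm_0_dim: "mnorm 0 x = 0"
  using mnorm_le_sum[of 0 x] mnorm_ge_0[of 0 x] by simp

text \<open>The operator norm lies between the norm of each entry and the sum of all entry norms.
  Hence a limit of matrices in one corner is the same limit in every larger size.\<close>

lemma mtendsto_iff: "mtendsto n x a \<longleftrightarrow> (\<forall>i<n. \<forall>j<n. (\<lambda>k. x k i j) \<longlonglongrightarrow> a i j)"
proof
  assume m: "mtendsto n x a"
  show "\<forall>i<n. \<forall>j<n. (\<lambda>k. x k i j) \<longlonglongrightarrow> a i j"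
  proof (intro allI impI)
    fix i j assume "i < n" "j < n"
    then have "norm (x k i j - a i j) \<le> mnorm n (mminus (x k) a)" for k
      using norm_le_mnorm[of i n j "mminus (x k) a"] by (simp add: mminus_def)
    then have "(\<lambda>k. x k i j - a i j) \<longlonglongrightarrow> 0"
      by (intro Lim_null_comparison[OF _ m[unfolded mtendsto_def]]) auto
    then show "(\<lambda>k. x k i j) \<longlonglongrightarrow> a i j" by (simp add: LIM_zero_iff)
  qed
next
  assume e: "\<forall>i<n. \<forall>j<n. (\<lambda>k. x k i j) \<longlonglongrightarrow> a i j"
  have "(\<lambda>k. \<Sum>i<n. \<Sum>j<n. norm (x k i j - a i j)) \<longlonglongrightarrow> (\<Sum>i<n. \<Sum>j<n. 0)"
    using e by (intro tendsto_sum tendsto_norm_zero) (auto simp: LIM_zero_iff)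
  then have lim: "(\<lambda>k. \<Sum>i<n. \<Sum>j<n. norm (x k i j - a i j)) \<longlonglongrightarrow> 0" by simp
  have "\<forall>k. norm (mnorm n (mminus (x k) a)) \<le> (\<Sum>i<n. \<Sum>j<n. norm (x k i j - a i j))"
  proof
    fix k
    show "norm (mnorm n (mminus (x k) a)) \<le> (\<Sum>i<n. \<Sum>j<n. norm (x k i j - a i j))"
      using mnorm_le_sum[of n "mminus (x k) a"] mnorm_ge_0[of n "mminus (x k) a"]
      by (simp add: mminus_def[of "x k" a])
  qed
  then show "mtendsto n x a"
    unfolding mtendsto_def by (rule Lim_null_comparison[OF always_eventually lim])
qed

section \<open>The bounded product of the matrix algebras\<close>

text \<open>There is no type for \<open>M\<^sub>n(A)\<close> with \<open>n\<close> a variable, so the facts about unital C*-algebras are applied to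
  the type of bounded sequences \<open>(x\<^sub>n)\<close> with \<open>x\<^sub>n \<in> M\<^sub>n(A)\<close>, into which \<open>M\<^sub>n(A)\<close> embeds.\<close>

typedef (overloaded) ('a::unital_cstar_algebra) mat_prod =
  "{X :: nat \<Rightarrow> 'a mat_array. (\<forall>n. X n \<in> matrices n) \<and> bdd_above (range (\<lambda>n. mnorm n (X n)))}"
  by (rule exI[of _ "\<lambda>n i j. 0"]) simp

abbreviation mpr :: "nat \<Rightarrow> 'a::unital_cstar_algebra mat_prod \<Rightarrow> 'a mat_array" where
  "mpr n X \<equiv> Rep_mat_prod X n"

lemma mpr_in_matrices [simp]: "mpr n X \<in> matrices n"
  using Rep_mat_prod[of X] by simp

lemma mat_prod_eqI: "(\<And>n. mpr n X = mpr n Y) \<Longrightarrow> X = Y"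
  by (metis Rep_mat_prod_inject ext)

lemma mpr_Abs:
  assumes "\<And>n. X n \<in> matrices n" "\<And>n. mnorm n (X n) \<le> B"
  shows "mpr n (Abs_mat_prod X) = X n"
  by (subst Abs_mat_prod_inverse) (use assms bdd_aboveI2[of UNIV "\<lambda>n. mnorm n (X n)" B] in auto)

lemma mminus_eq: "mminus x y = mplus x (mscale (-1) y)"
  by (simp add: mminus_def mplus_def mscale_def scaleC_minus_left)

lemma mnorm_mminus: "mnorm n (mminus x y) \<le> mnorm n x + mnorm n y"
  using mnorm_mplus[of n x "mscale (-1) y"] by (simp add: mminus_eq mnorm_mscale)

instantiation mat_prod :: (unital_cstar_algebra) real_normed_algebra_1
begin

definition "0 = Abs_mat_prod (\<lambda>n i j. 0 :: 'a)"
definition "1 = Abs_mat_prod (\<lambda>n. mid n :: 'a mat_array)"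
definition "X + Y = Abs_mat_prod (\<lambda>n. mplus (mpr n X) (mpr n Y))"
definition "X - Y = Abs_mat_prod (\<lambda>n. mminus (mpr n X) (mpr n Y))"
definition "- X = Abs_mat_prod (\<lambda>n. mscale (- 1) (mpr n X))"
definition "X * Y = Abs_mat_prod (\<lambda>n. mmult (mpr n X) (mpr n Y))"
definition "r *\<^sub>R X = Abs_mat_prod (\<lambda>n. mscale (of_real r) (mpr n X))"
definition "norm X = (SUP n. mnorm n (mpr n X))"
definition "sgn X = inverse (norm X) *\<^sub>R (X :: 'a mat_prod)"
definition "dist X Y = norm (X - Y :: 'a mat_prod)"
definition "uniformity = (INF e\<in>{0<..}. principal {(x, y :: 'a mat_prod). dist x y < e})"
definition "open U = (\<forall>x\<in>U. eventually (\<lambda>(x', y). x' = x \<longrightarrow> y \<in> (U :: 'a mat_prod set)) uniformity)"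

lemma bdd_above_mnorm: "bdd_above (range (\<lambda>n. mnorm n (mpr n X)))"
  using Rep_mat_prod[of X] by simp

lemma mnorm_mpr_le: "mnorm n (mpr n X) \<le> norm X"
  unfolding norm_mat_prod_def by (rule cSUP_upper[OF _ bdd_above_mnorm]) simp

lemma norm_mat_prod_leI: "(\<And>n. mnorm n (mpr n X) \<le> c) \<Longrightarrow> norm X \<le> c"
  unfolding norm_mat_prod_def by (rule cSUP_least) auto

lemma norm_mat_prod_ge_0: "0 \<le> norm (X :: 'a::unital_cstar_algebra mat_prod)"
  using order_trans[OF mnorm_ge_0 mnorm_mpr_le] .

lemma mpr_zero: "mpr n 0 = (\<lambda>i j. 0)"
  unfolding zero_mat_prod_def by (rule mpr_Abs[of _ 0]) simp_all

lemma mpr_one: "mpr n 1 = mid n"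
  unfolding one_mat_prod_def
proof (rule mpr_Abs)
  \<comment> \<open>The factor n = 0 is the zero algebra, whose unit has norm 0; that 1 has norm 1
    in the product is due to the factors with n >= 1.\<close>
  show "mnorm n (mid n) \<le> 1" for n by (cases "1 \<le> n") (simp_all add: mnorm_mid mnorm_0_dim not_le)
qed (rule mid_in_matrices)

lemma mpr_plus: "mpr n (X + Y) = mplus (mpr n X) (mpr n Y)"
  unfolding plus_mat_prod_def
proof (rule mpr_Abs)
  show "mnorm n (mplus (mpr n X) (mpr n Y)) \<le> norm X + norm Y" for n
    using mnorm_mplus[of n "mpr n X" "mpr n Y"] mnorm_mpr_le[of n X] mnorm_mpr_le[of n Y] by linarith
qed (simp add: mplus_in_matrices)

lemma mpr_minus: "mpr n (X - Y) = mminus (mpr n X) (mpr n Y)"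
  unfolding minus_mat_prod_def
proof (rule mpr_Abs)
  show "mnorm n (mminus (mpr n X) (mpr n Y)) \<le> norm X + norm Y" for n
    using mnorm_mminus[of n "mpr n X" "mpr n Y"] mnorm_mpr_le[of n X] mnorm_mpr_le[of n Y] by linarith
qed (simp add: mminus_in_matrices)

lemma mpr_uminus: "mpr n (- X) = mscale (-1) (mpr n X)"
  unfolding uminus_mat_prod_def
  by (rule mpr_Abs[of _ "norm X"]) (simp_all add: mscale_in_matrices mnorm_mscale mnorm_mpr_le)

lemma mpr_times: "mpr n (X * Y) = mmult (mpr n X) (mpr n Y)"
  unfolding times_mat_prod_def
proof (rule mpr_Abs)
  show "mnorm n (mmult (mpr n X) (mpr n Y)) \<le> norm X * norm Y" for n
    using mnorm_mmult[of "mpr n X" n "mpr n Y"]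
      mult_mono[OF mnorm_mpr_le[of n X] mnorm_mpr_le[of n Y] norm_mat_prod_ge_0 mnorm_ge_0] by simp
qed (simp add: mmult_in_matrices)

lemma mpr_scaleR: "mpr n (r *\<^sub>R X) = mscale (of_real r) (mpr n X)"
  unfolding scaleR_mat_prod_def
  by (rule mpr_Abs[of _ "\<bar>r\<bar> * norm X"]) (simp_all add: mscale_in_matrices mnorm_mscale mnorm_mpr_le mult_left_mono)

lemmas mpr_simps = mpr_zero mpr_one mpr_plus mpr_minus mpr_uminus mpr_times mpr_scaleR

instance
proof
  fix X Y Z :: "'a mat_prod" and a b :: real
  show "X + Y + Z = X + (Y + Z)" by (rule mat_prod_eqI) (simp add: mpr_simps mplus_def add.assoc)
  show "X + Y = Y + X" by (rule mat_prod_eqI) (simp add: mpr_simps mplus_def add.commute)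
  show "0 + X = X" by (rule mat_prod_eqI) (simp add: mpr_simps mplus_def)
  show "- X + X = 0" by (rule mat_prod_eqI) (simp add: mpr_simps mplus_def mscale_def scaleC_minus_left)
  show "X - Y = X + - Y" by (rule mat_prod_eqI) (simp add: mpr_simps mminus_eq)
  show "X * Y * Z = X * (Y * Z)" by (rule mat_prod_eqI) (simp add: mpr_simps mmult_assoc[of _ _ "_"] mmult_assoc[OF mpr_in_matrices mpr_in_matrices])
  show "(X + Y) * Z = X * Z + Y * Z" by (rule mat_prod_eqI) (simp add: mpr_simps mmult_mplus_left[OF mpr_in_matrices mpr_in_matrices])
  show "X * (Y + Z) = X * Y + X * Z" by (rule mat_prod_eqI) (simp add: mpr_simps mmult_mplus_right[OF mpr_in_matrices])
  show "1 * X = X" by (rule mat_prod_eqI) (simp add: mpr_simps mmult_mid_left)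
  show "X * 1 = X" by (rule mat_prod_eqI) (simp add: mpr_simps mmult_mid_right)
  have "mpr 1 (0 :: 'a mat_prod) 0 0 \<noteq> mpr 1 (1 :: 'a mat_prod) 0 0" by (simp add: mpr_simps mid_def)
  then show "0 \<noteq> (1 :: 'a mat_prod)" by metis
  show "a *\<^sub>R (X + Y) = a *\<^sub>R X + a *\<^sub>R Y" by (rule mat_prod_eqI) (simp add: mpr_simps mplus_def mscale_def scaleC_add_right)
  show "(a + b) *\<^sub>R X = a *\<^sub>R X + b *\<^sub>R X" by (rule mat_prod_eqI) (simp add: mpr_simps mplus_def mscale_def scaleC_add_left)
  show "a *\<^sub>R b *\<^sub>R X = (a * b) *\<^sub>R X" by (rule mat_prod_eqI) (simp add: mpr_simps mscale_def scaleC_scaleC)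
  show "1 *\<^sub>R X = X" by (rule mat_prod_eqI) (simp add: mpr_simps mscale_def)
  show "a *\<^sub>R X * Y = a *\<^sub>R (X * Y)" by (rule mat_prod_eqI) (simp add: mpr_simps mmult_mscale_left[OF mpr_in_matrices])
  show "X * a *\<^sub>R Y = a *\<^sub>R (X * Y)" by (rule mat_prod_eqI) (simp add: mpr_simps mmult_mscale_right[OF mpr_in_matrices])
  show "dist X Y = norm (X - Y)" by (rule dist_mat_prod_def)
  show "sgn X = inverse (norm X) *\<^sub>R X" by (rule sgn_mat_prod_def)
  show "uniformity = (INF e\<in>{0<..}. principal {(x, y :: 'a mat_prod). dist x y < e})" by (rule uniformity_mat_prod_def)
  show "open U = (\<forall>x\<in>U. eventually (\<lambda>(x', y). x' = x \<longrightarrow> y \<in> U) uniformity)" for U :: "'a mat_prod set"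
    by (rule open_mat_prod_def)
  show "norm X = 0 \<longleftrightarrow> X = 0"
  proof
    assume 0: "norm X = 0"
    show "X = 0"
    proof (rule mat_prod_eqI, intro ext)
      fix n i j
      show "mpr n X i j = mpr n 0 i j"
      proof (cases "i < n \<and> j < n")
        case True
        then have "norm (mpr n X i j) \<le> mnorm n (mpr n X)" by (intro norm_le_mnorm) auto
        then have "norm (mpr n X i j) \<le> 0" using mnorm_mpr_le[of n X] 0 by linarith
        then show ?thesis by (simp add: mpr_zero)
      qed (simp add: matrices_0[OF mpr_in_matrices])
    qed
  next
    assume "X = 0"
    then have "norm X \<le> 0" by (intro norm_mat_prod_leI) (simp add: mpr_zero)
    then show "norm X = 0" using norm_mat_prod_ge_0[of X] by simp
  qed
  show "norm (X + Y) \<le> norm X + norm Y"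
  proof (rule norm_mat_prod_leI)
    fix n
    show "mnorm n (mpr n (X + Y)) \<le> norm X + norm Y"
      using mnorm_mplus[of n "mpr n X" "mpr n Y"] mnorm_mpr_le[of n X] mnorm_mpr_le[of n Y] by (simp add: mpr_plus)
  qed
  have sc: "norm (a *\<^sub>R X) \<le> \<bar>a\<bar> * norm X" for a and X :: "'a mat_prod"
    by (rule norm_mat_prod_leI) (simp add: mpr_scaleR mnorm_mscale mnorm_mpr_le mult_left_mono)
  show "norm (a *\<^sub>R X) = \<bar>a\<bar> * norm X"
  proof (cases "a = 0")
    case True
    then show ?thesis using sc[of a X] norm_mat_prod_ge_0[of "a *\<^sub>R X"] by simp
  next
    case False
    have "(1/a) *\<^sub>R (a *\<^sub>R X) = X"
      using False by (intro mat_prod_eqI) (simp add: mpr_scaleR mscale_def scaleC_scaleC)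
    then have "norm X \<le> \<bar>1/a\<bar> * norm (a *\<^sub>R X)" using sc[of "1/a" "a *\<^sub>R X"] by simp
    then show ?thesis using sc[of a X] False by (simp add: field_simps)
  qed
  show "norm (X * Y) \<le> norm X * norm Y"
  proof (rule norm_mat_prod_leI)
    fix n
    show "mnorm n (mpr n (X * Y)) \<le> norm X * norm Y"
      using mnorm_mmult[of "mpr n X" n "mpr n Y"]
        mult_mono[OF mnorm_mpr_le[of n X] mnorm_mpr_le[of n Y] norm_mat_prod_ge_0 mnorm_ge_0] by (simp add: mpr_times)
  qed
  show "norm (1 :: 'a mat_prod) = 1"
  proof (rule antisym)
    show "norm (1 :: 'a mat_prod) \<le> 1"
    proof (rule norm_mat_prod_leI)
      show "mnorm n (mpr n (1 :: 'a mat_prod)) \<le> 1" for n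
        by (cases "1 \<le> n") (simp_all add: mpr_one mnorm_mid mnorm_0_dim not_le)
    qed
    show "1 \<le> norm (1 :: 'a mat_prod)"
      using mnorm_mpr_le[of 1 "1 :: 'a mat_prod"] by (simp add: mpr_one mnorm_mid)
  qed
qed

end

text \<open>Limits exist entry by entry. The Cauchy bounds are uniform in the factor and survive the
  limit in each factor, which gives both boundedness of the limit and convergence in the supremum
  norm.\<close>

instance mat_prod :: (unital_cstar_algebra) banach
proof
  fix X :: "nat \<Rightarrow> 'a mat_prod" assume C: "Cauchy X"
  have entry: "norm (mpr n (X l) i j - mpr n (X m) i j) \<le> norm (X l - X m)" for n i j l m
  proof (cases "i < n \<and> j < n")
    case True
    then have "norm (mpr n (X l - X m) i j) \<le> norm (X l - X m)"
      by (meson norm_le_mnorm mnorm_mpr_le order_trans)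
    then show ?thesis by (simp add: mpr_minus mminus_def)
  qed (simp add: matrices_0[OF mpr_in_matrices])
  have "Cauchy (\<lambda>k. mpr n (X k) i j)" for n i j
  proof (rule CauchyI)
    fix e :: real assume "0 < e"
    from CauchyD[OF C this] show "\<exists>M. \<forall>l\<ge>M. \<forall>m\<ge>M. norm (mpr n (X l) i j - mpr n (X m) i j) < e"
      using entry by (meson le_less_trans)
  qed
  then have "\<exists>l. (\<lambda>k. mpr n (X k) i j) \<longlonglongrightarrow> l" for n i j
    by (simp add: Cauchy_convergent_iff convergent_def)
  then obtain L where L: "\<And>n i j. (\<lambda>k. mpr n (X k) i j) \<longlonglongrightarrow> L n i j" by metis
  have Lm: "L n \<in> matrices n" for n
  proof (rule matricesI)
    fix i j assume "\<not> (i < n \<and> j < n)"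
    then have "mpr n (X k) i j = 0" for k by (intro matrices_0[OF mpr_in_matrices])
    then show "L n i j = 0" using L[of n i j] by (simp add: LIMSEQ_const_iff)
  qed
  have close: "mnorm n (mminus (mpr n (X m)) (L n)) \<le> e"
    if N: "\<And>l m. N \<le> l \<Longrightarrow> N \<le> m \<Longrightarrow> norm (X l - X m) < e" and m: "N \<le> m" for N n m e
  proof -
    have "mtendsto n (\<lambda>k. mpr n (X k)) (L n)" by (simp add: mtendsto_iff L)
    then have lim: "(\<lambda>k. e + mnorm n (mminus (mpr n (X k)) (L n))) \<longlonglongrightarrow> e + 0"
      unfolding mtendsto_def by (intro tendsto_intros)
    show ?thesis
    proof (rule LIMSEQ_le_const[of _ e])
      show "(\<lambda>k. e + mnorm n (mminus (mpr n (X k)) (L n))) \<longlonglongrightarrow> e" using lim by simp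
      have "mnorm n (mminus (mpr n (X m)) (L n)) \<le> e + mnorm n (mminus (mpr n (X k)) (L n))" if k: "N \<le> k" for k
      proof -
        have "mminus (mpr n (X m)) (L n) = mplus (mpr n (X m - X k)) (mminus (mpr n (X k)) (L n))"
          by (simp add: mminus_def mplus_def mpr_minus)
        then show ?thesis
          using mnorm_mplus[of n "mpr n (X m - X k)" "mminus (mpr n (X k)) (L n)"] mnorm_mpr_le[of n "X m - X k"] N[OF m k]
          by simp
      qed
      then show "\<exists>N. \<forall>k\<ge>N. mnorm n (mminus (mpr n (X m)) (L n)) \<le> e + mnorm n (mminus (mpr n (X k)) (L n))" by blast
    qed
  qed
  obtain N1 where N1: "\<And>l m. N1 \<le> l \<Longrightarrow> N1 \<le> m \<Longrightarrow> norm (X l - X m) < 1"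
    using CauchyD[OF C, of 1] by auto
  have "mnorm n (L n) \<le> norm (X N1) + 1" for n
  proof -
    have "L n = mminus (mpr n (X N1)) (mminus (mpr n (X N1)) (L n))" by (simp add: mminus_def)
    then have "mnorm n (L n) \<le> mnorm n (mpr n (X N1)) + mnorm n (mminus (mpr n (X N1)) (L n))"
      using mnorm_mminus[of n "mpr n (X N1)" "mminus (mpr n (X N1)) (L n)"] by simp
    moreover have "mnorm n (mminus (mpr n (X N1)) (L n)) \<le> 1"
      by (rule close[of N1]) (use N1 in auto)
    ultimately show ?thesis using mnorm_mpr_le[of n "X N1"] by simp
  qed
  then have LA: "mpr n (Abs_mat_prod L) = L n" for n by (intro mpr_Abs[OF Lm])
  have "X \<longlonglongrightarrow> Abs_mat_prod L"
  proof (rule LIMSEQ_I)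
    fix e :: real assume "0 < e"
    then obtain N where N: "\<And>l m. N \<le> l \<Longrightarrow> N \<le> m \<Longrightarrow> norm (X l - X m) < e/2"
      using CauchyD[OF C, of "e/2"] by auto
    have "norm (X m - Abs_mat_prod L) \<le> e/2" if "N \<le> m" for m
      by (rule norm_mat_prod_leI) (unfold mpr_minus LA, rule close[OF N that])
    then show "\<exists>no. \<forall>m\<ge>no. norm (X m - Abs_mat_prod L) < e" using \<open>0 < e\<close> by fastforce
  qed
  then show "convergent X" by (auto simp: convergent_def)
qed

instantiation mat_prod :: (unital_cstar_algebra) unital_cstar_algebra
begin

definition "c *\<^sub>C X = Abs_mat_prod (\<lambda>n. mscale c (mpr n X))"
definition "adj X = Abs_mat_prod (\<lambda>n. madj (mpr n X))"

lemma mpr_scaleC: "mpr n (c *\<^sub>C X) = mscale c (mpr n X)"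
  unfolding scaleC_mat_prod_def
  by (rule mpr_Abs[of _ "cmod c * norm X"]) (simp_all add: mscale_in_matrices mnorm_mscale mnorm_mpr_le mult_left_mono)

lemma mpr_adj: "mpr n (adj X) = madj (mpr n X)"
  unfolding adj_mat_prod_def
  by (rule mpr_Abs[of _ "norm X"]) (simp_all add: madj_in_matrices mnorm_madj mnorm_mpr_le)

instance
proof
  fix X Y :: "'a mat_prod" and c d :: complex and r :: real
  show "c *\<^sub>C (X + Y) = c *\<^sub>C X + c *\<^sub>C Y" by (rule mat_prod_eqI) (simp add: mpr_plus mpr_scaleC mplus_def mscale_def scaleC_add_right)
  show "(c + d) *\<^sub>C X = c *\<^sub>C X + d *\<^sub>C X" by (rule mat_prod_eqI) (simp add: mpr_plus mpr_scaleC mplus_def mscale_def scaleC_add_left)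
  show "c *\<^sub>C d *\<^sub>C X = (c * d) *\<^sub>C X" by (rule mat_prod_eqI) (simp add: mpr_scaleC mscale_def scaleC_scaleC)
  show "r *\<^sub>R X = complex_of_real r *\<^sub>C X" by (rule mat_prod_eqI) (simp add: mpr_scaleC mpr_scaleR)
  show "c *\<^sub>C X * Y = c *\<^sub>C (X * Y)" by (rule mat_prod_eqI) (simp add: mpr_scaleC mpr_times mmult_mscale_left[OF mpr_in_matrices])
  show "X * c *\<^sub>C Y = c *\<^sub>C (X * Y)" by (rule mat_prod_eqI) (simp add: mpr_scaleC mpr_times mmult_mscale_right[OF mpr_in_matrices])
  have le: "norm (c *\<^sub>C X) \<le> cmod c * norm X" for c and X :: "'a mat_prod"
    by (rule norm_mat_prod_leI) (simp add: mpr_scaleC mnorm_mscale mnorm_mpr_le mult_left_mono)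
  show "norm (c *\<^sub>C X) = cmod c * norm X"
  proof (cases "c = 0")
    case True
    then show ?thesis using le[of c X] by simp
  next
    case False
    have "(1/c) *\<^sub>C (c *\<^sub>C X) = X"
      using False by (intro mat_prod_eqI) (simp add: mpr_scaleC mscale_def scaleC_scaleC)
    then have "norm X \<le> cmod (1/c) * norm (c *\<^sub>C X)" using le[of "1/c" "c *\<^sub>C X"] by simp
    then show ?thesis using le[of c X] False by (simp add: field_simps norm_divide)
  qed
  show "adj (adj X) = X" by (rule mat_prod_eqI) (simp add: mpr_adj)
  show "adj (X + Y) = adj X + adj Y" by (rule mat_prod_eqI) (simp add: mpr_adj mpr_plus madj_def mplus_def adj_add)
  show "adj (c *\<^sub>C X) = cnj c *\<^sub>C adj X" by (rule mat_prod_eqI) (simp add: mpr_adj mpr_scaleC madj_def mscale_def adj_scaleC)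
  show "adj (X * Y) = adj Y * adj X" by (rule mat_prod_eqI) (simp add: mpr_adj mpr_times madj_mmult[OF mpr_in_matrices mpr_in_matrices])
  show "norm (adj X * X) = (norm X)\<^sup>2"
  proof (rule antisym)
    show "norm (adj X * X) \<le> (norm X)\<^sup>2"
      by (rule norm_mat_prod_leI) (simp add: mpr_adj mpr_times mnorm_cstar mnorm_mpr_le mnorm_ge_0 power_mono)
    have "norm X \<le> sqrt (norm (adj X * X))"
    proof (rule norm_mat_prod_leI)
      fix n
      have "(mnorm n (mpr n X))\<^sup>2 \<le> norm (adj X * X)"
        using mnorm_mpr_le[of n "adj X * X"] by (simp add: mpr_adj mpr_times mnorm_cstar)
      then show "mnorm n (mpr n X) \<le> sqrt (norm (adj X * X))" by (rule real_le_rsqrt)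
    qed
    then have "(norm X)\<^sup>2 \<le> (sqrt (norm (adj X * X)))\<^sup>2" by (intro power_mono) auto
    then show "(norm X)\<^sup>2 \<le> norm (adj X * X)" by simp
  qed
qed

end

text \<open>The embedding as n-th factor is isometric, multiplicative and respects
  \<open>adj\<close>, but \<open>mem n (mid n)\<close> is a proper projection and not 1. Units of
  corners therefore enter the arguments as projections.\<close>

definition mem :: "nat \<Rightarrow> 'a::unital_cstar_algebra mat_array \<Rightarrow> 'a mat_prod" where
  "mem n x = Abs_mat_prod (\<lambda>m. if m = n then x else (\<lambda>i j. 0))"

lemma mpr_mem:
  assumes "x \<in> matrices n"
  shows "mpr m (mem n x) = (if m = n then x else (\<lambda>i j. 0))"
  unfolding mem_def
  by (rule mpr_Abs[of _ "mnorm n x"]) (use assms mnorm_ge_0[of n x] in auto)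

lemma mpr_mem_same [simp]: "x \<in> matrices n \<Longrightarrow> mpr n (mem n x) = x"
  by (simp add: mpr_mem)

lemma mem_times:
  assumes "x \<in> matrices n" "y \<in> matrices n"
  shows "mem n x * mem n y = mem n (mmult x y)"
proof (rule mat_prod_eqI)
  have z: "mmult (\<lambda>i j. 0) (\<lambda>i j. 0) = (\<lambda>i j. 0 :: 'a)" by (simp add: mmult_def)
  show "mpr m (mem n x * mem n y) = mpr m (mem n (mmult x y))" for m
    using assms z by (simp add: mpr_times mpr_mem mmult_in_matrices)
qed

lemma mem_adj: "x \<in> matrices n \<Longrightarrow> adj (mem n x) = mem n (madj x)"
  by (rule mat_prod_eqI) (simp add: mpr_adj mpr_mem madj_in_matrices madj_def[of "\<lambda>i j. 0"])

lemma mem_minus: "x \<in> matrices n \<Longrightarrow> y \<in> matrices n \<Longrightarrow> mem n x - mem n y = mem n (mminus x y)"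
  by (rule mat_prod_eqI) (simp add: mpr_minus mpr_mem mminus_in_matrices mminus_def[of "\<lambda>i j. 0"])

lemma mem_plus: "x \<in> matrices n \<Longrightarrow> y \<in> matrices n \<Longrightarrow> mem n x + mem n y = mem n (mplus x y)"
  by (rule mat_prod_eqI) (simp add: mpr_plus mpr_mem mplus_in_matrices mplus_def[of "\<lambda>i j. 0"])

lemma norm_mem:
  assumes "x \<in> matrices n" shows "norm (mem n x) = mnorm n x"
proof (rule antisym)
  show "norm (mem n x) \<le> mnorm n x"
    by (rule norm_mat_prod_leI) (simp add: mpr_mem assms mnorm_ge_0)
  show "mnorm n x \<le> norm (mem n x)"
    using mnorm_mpr_le[of n "mem n x"] assms by simp
qed

lemma mem_zero: "mem n (\<lambda>i j. 0) = 0"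
  by (rule mat_prod_eqI) (simp add: mpr_mem mpr_zero)

section \<open>Positive matrices and their roots\<close>

lemma mem_power:
  assumes "b \<in> matrices n" "0 < k"
  shows "mem n b ^ k = mem n ((mmult b ^^ (k - 1)) b)"
proof -
  have *: "(mmult b ^^ j) b \<in> matrices n \<and> mem n b ^ Suc j = mem n ((mmult b ^^ j) b)" for j
    by (induction j) (simp_all add: assms(1) mmult_in_matrices mem_times del: power_Suc, simp add: assms(1) mem_times)
  show ?thesis using *[of "k - 1"] assms(2) by simp
qed

lemma mem_inject: "mem n x = mem n y \<Longrightarrow> x \<in> matrices n \<Longrightarrow> y \<in> matrices n \<Longrightarrow> x = y"
  by (metis mpr_mem_same)

lemma Minf_posE:
  assumes "a \<in> Minf_pos"
  obtains y n where "y \<in> matrices n" "a \<in> matrices n" "a = mmult (madj y) y"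
  using assms unfolding Minf_pos_def Minf_def by (auto intro: mmult_in_matrices madj_in_matrices)

lemma Minf_posI: "y \<in> matrices n \<Longrightarrow> mmult (madj y) y \<in> Minf_pos"
  unfolding Minf_pos_def Minf_def by auto

text \<open>A root found in a larger matrix algebra already lies in the corner of size n: the
  projection \<open>mid n\<close> fixes its square, hence the root, and this on both sides by
  self-adjointness.\<close>

lemma Minf_pos_square:
  assumes "a \<in> Minf_pos" "a \<in> matrices n"
  obtains e where "e \<in> matrices n" "madj e = e" "a = mmult e e"
proof -
  obtain y m where y: "y \<in> matrices m" "a \<in> matrices m" "a = mmult (madj y) y"
    using assms(1) by (rule Minf_posE)
  define N where "N = max m n"
  have N: "m \<le> N" "n \<le> N" by (auto simp: N_def)
  have yN: "y \<in> matrices N" and aN: "a \<in> matrices N" using y N matrices_in_mono by blast+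
  have "mem N a = adj (mem N y) * mem N y"
    using y yN by (simp add: mem_adj mem_times madj_in_matrices)
  then have "cpos (mem N a)" by (simp add: cpos_adj_mult)
  then obtain e where e: "adj e = e" "mem N a = e * e" by (rule cposE)
  let ?p = "mem N (mid n) :: 'a mat_prod" 
  have mid: "mid n \<in> matrices N" using mid_in_matrices N matrices_in_mono by blast
  have "e * ?p = e"
  proof (rule mult_projection_of_square[OF e(1)])
    show "adj ?p = ?p" by (simp add: mem_adj mid)
    show "?p * ?p = ?p" by (simp add: mem_times mid mmult_mid_left mid_in_matrices)
    show "e * e * ?p = e * e" by (simp add: e(2)[symmetric] mem_times mid aN mmult_mid_right assms(2))
  qed
  then have ep: "mmult (mpr N e) (mid n) = mpr N e" 
    using arg_cong[of _ _ "mpr N"] by (metis mpr_times mpr_mem_same mid)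
  have e': "madj (mpr N e) = mpr N e" using e(1) by (metis mpr_adj)
  show ?thesis
  proof
    show "mpr N e \<in> matrices n"
    proof (rule matricesI)
      fix i j assume ij: "\<not> (i < n \<and> j < n)"
      have col: "mpr N e i j = 0" if "\<not> j < n" for i j
      proof -
        have "mpr N e i j = mmult (mpr N e) (mid n) i j" by (simp only: ep)
        also have "\<dots> = 0" using that by (auto simp: mmult_eq[OF mpr_in_matrices] mid_def intro!: sum.neutral)
        finally show ?thesis .
      qed
      show "mpr N e i j = 0"
      proof (cases "j < n")
        case True
        then have "mpr N e j i = 0" using ij by (intro col) simp
        then show ?thesis using fun_cong[OF fun_cong[OF e'], of i j] by (simp add: madj_def)
      qed (rule col)
    qed
    show "madj (mpr N e) = mpr N e" by (rule e')
    show "a = mmult (mpr N e) (mpr N e)" using arg_cong[OF e(2), of "mpr N"] aN by (simp add: mpr_times)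
  qed
qed

lemma cpos_mem:
  assumes "a \<in> Minf_pos" "a \<in> matrices n"
  shows "cpos (mem n a)"
proof -
  obtain e where e: "e \<in> matrices n" "madj e = e" "a = mmult e e"
    using assms by (rule Minf_pos_square)
  then have "mem n a = mem n e * mem n e" "adj (mem n e) = mem n e" by (simp_all add: mem_times mem_adj)
  then show ?thesis by (metis cpos_square)
qed

lemma Minf_pos_mpr:
  assumes "cpos X" shows "mpr n X \<in> Minf_pos"
proof -
  obtain e where e: "adj e = e" "X = e * e" using assms by (rule cposE)
  have "mpr n X = mmult (madj (mpr n e)) (mpr n e)" using e by (metis mpr_adj mpr_times)
  then show ?thesis by (metis Minf_posI mpr_in_matrices)
qed

text \<open>The description in \<open>mroot\<close> ranges over matrices of all sizes, so uniqueness
  compares two roots inside a common larger algebra, while existence keeps the root in the size of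
  b.\<close>

lemma mroot:
  assumes b: "b \<in> Minf_pos" "b \<in> matrices m" and k: "0 < k"
  shows "mroot k b \<in> Minf_pos" "mroot k b \<in> matrices m" "(mmult (mroot k b) ^^ (k - 1)) (mroot k b) = b"
proof -
  define C where "C = cfc (mem m b) (\<lambda>t. root k \<bar>t\<bar>)"
  have C: "cpos C" "C ^ k = mem m b"
    using cpos_root_exists[OF cpos_mem[OF b] k] by (simp_all add: C_def)
  define c where "c = mpr m C"
  have c: "c \<in> Minf_pos" "c \<in> matrices m" using C by (simp_all add: c_def Minf_pos_mpr)
  have pow: "mpr m (X ^ Suc j) = (mmult (mpr m X) ^^ j) (mpr m X)" for X :: "'a mat_prod" and j
    by (induction j) (simp_all add: mpr_times)
  have cb: "(mmult c ^^ (k - 1)) c = b"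
    using pow[of C "k - 1"] C k b by (simp add: c_def)
  have uniq: "d = c" if d: "d \<in> Minf_pos" "(mmult d ^^ (k - 1)) d = b" for d
  proof -
    obtain n where n: "d \<in> matrices n" using d(1) by (rule Minf_posE)
    define N where "N = max m n"
    have N: "m \<le> N" "n \<le> N" by (auto simp: N_def)
    have dN: "d \<in> matrices N" "c \<in> matrices N" using n c N matrices_in_mono by blast+
    have "mem N d ^ k = mem N b" "mem N c ^ k = mem N b"
      using mem_power[OF dN(1) k] mem_power[OF dN(2) k] d cb by simp_all
    then have "mem N d = mem N c"
      using cpos_root_unique[OF cpos_mem[OF d(1) dN(1)] k] cpos_root_unique[OF cpos_mem[OF c(1) dN(2)] k] by metis
    then show ?thesis using dN mem_inject by blast
  qed
  have "mroot k b = c"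
    unfolding mroot_def by (rule the_equality) (use c(1) cb in blast, use uniq in blast)
  then show "mroot k b \<in> Minf_pos" "mroot k b \<in> matrices m" "(mmult (mroot k b) ^^ (k - 1)) (mroot k b) = b"
    using c cb by simp_all
qed

section \<open>Quasitraces on matrix algebras\<close>

text \<open>A quasitrace is linear on abelian subalgebras, and the double commutant B of two
  commuting self-adjoint matrices is one that contains both. It is abelian because a and b lie in
  their commutant S, whence B is contained in S.\<close>

lemma abelian_bicommutant:
  assumes a: "a \<in> matrices n" "madj a = a" and b: "b \<in> matrices n" "madj b = b" and ab: "mmult a b = mmult b a"
  obtains B where "abelian_subalgebra n B" "a \<in> B" "b \<in> B"
proof
  define S where "S = {y \<in> matrices n. mmult y a = mmult a y \<and> mmult y b = mmult b y}"
  define B where "B = {z \<in> matrices n. \<forall>y\<in>S. mmult z y = mmult y z}"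
  have Sm: "y \<in> matrices n" if "y \<in> S" for y using that by (simp add: S_def)
  have aS: "a \<in> S" "b \<in> S" using a b ab by (simp_all add: S_def)
  have BS: "B \<subseteq> S" using aS by (auto simp: B_def S_def)
  have adjS: "madj y \<in> S" if "y \<in> S" for y
    using that a b madj_mmult[of y n a] madj_mmult[of a n y] madj_mmult[of y n b] madj_mmult[of b n y]
    by (simp add: S_def madj_in_matrices)
  show "a \<in> B" "b \<in> B" using a b by (auto simp: B_def S_def)
  show "abelian_subalgebra n B"
    unfolding abelian_subalgebra_def
  proof (intro conjI ballI allI impI)
    show "B \<subseteq> matrices n" by (auto simp: B_def)
    show "(\<lambda>i j. 0) \<in> B" by (auto simp: B_def mmult_def)
    fix x y assume x: "x \<in> B" and y: "y \<in> B"
    then have xm: "x \<in> matrices n" "y \<in> matrices n" by (auto simp: B_def)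
    show "mplus x y \<in> B"
      using x y Sm by (auto simp: B_def mplus_in_matrices mmult_mplus_left[of _ n] mmult_mplus_right[of _ n])
    show "mmult x y = mmult y x" using x y BS unfolding B_def by blast
    have "mmult (mmult x y) z = mmult z (mmult x y)" if z: "z \<in> S" for z
    proof -
      have xz: "mmult x z = mmult z x" and yz: "mmult y z = mmult z y" using x y z by (auto simp: B_def)
      have "mmult (mmult x y) z = mmult x (mmult z y)" by (simp only: mmult_assoc[OF xm] yz)
      also have "\<dots> = mmult (mmult z x) y" by (simp only: mmult_assoc[OF xm(1) Sm[OF z], symmetric] xz)
      also have "\<dots> = mmult z (mmult x y)" by (rule mmult_assoc[OF Sm[OF z] xm(1)])
      finally show ?thesis .
    qed
    then show "mmult x y \<in> B" by (simp add: B_def mmult_in_matrices xm)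
  next
    fix c x assume x: "x \<in> B"
    then show "mscale c x \<in> B"
      using Sm by (auto simp: B_def mscale_in_matrices mmult_mscale_left[of _ n] mmult_mscale_right[of _ n])
  next
    fix x assume x: "x \<in> B"
    then have xm: "x \<in> matrices n" by (auto simp: B_def)
    have "mmult (madj x) z = mmult z (madj x)" if z: "z \<in> S" for z
    proof -
      have "mmult x (madj z) = mmult (madj z) x" using x adjS[OF z] by (auto simp: B_def)
      then have "madj (mmult x (madj z)) = madj (mmult (madj z) x)" by simp
      then show ?thesis
        using xm Sm[OF z] by (simp add: madj_mmult[of _ n] madj_in_matrices)
    qed
    then show "madj x \<in> B" by (simp add: B_def madj_in_matrices xm)
  next
    fix X c assume c: "c \<in> matrices n" and X: "\<forall>k. X k \<in> B" and lim: "mtendsto n X c"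
    have Xm: "X k \<in> matrices n" for k using X by (auto simp: B_def)
    have e: "(\<lambda>k. X k i j) \<longlonglongrightarrow> c i j" for i j
    proof (cases "i < n \<and> j < n")
      case False
      then show ?thesis using matrices_0[OF c] matrices_0[OF Xm] by simp
    qed (use lim in \<open>simp add: mtendsto_iff\<close>)
    have "mmult c z = mmult z c" if z: "z \<in> S" for z
    proof (intro ext)
      fix i j
      have "(\<lambda>k. mmult (X k) z i j) \<longlonglongrightarrow> mmult c z i j"
        unfolding mmult_eq[OF Xm] mmult_eq[OF c] by (intro tendsto_intros e)
      moreover have "(\<lambda>k. mmult z (X k) i j) \<longlonglongrightarrow> mmult z c i j"
        unfolding mmult_eq[OF Sm[OF z]] by (intro tendsto_intros e)
      moreover have "mmult (X k) z = mmult z (X k)" for k using X z by (auto simp: B_def)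
      ultimately show "mmult c z i j = mmult z c i j" using LIMSEQ_unique by auto
    qed
    then show "c \<in> B" by (simp add: B_def c)
  qed
qed

lemma quasitrace_on_cqt:
  assumes "quasitrace_on n \<sigma>"
  shows "cqt (\<lambda>X. \<sigma> (mpr n X))"
proof -
  have 1: "\<sigma> (mmult x (madj x)) \<in> \<real>\<^sub>\<ge>\<^sub>0 \<and> \<sigma> (mmult x (madj x)) = \<sigma> (mmult (madj x) x)" if "x \<in> matrices n" for x
    using assms that unfolding quasitrace_on_def by blast
  have 2: "\<sigma> (mplus x y) = \<sigma> x + \<sigma> y \<and> \<sigma> (mscale c x) = c * \<sigma> x"
    if xy: "x \<in> matrices n" "madj x = x" "y \<in> matrices n" "madj y = y" "mmult x y = mmult y x" for x y c
  proof -
    obtain B where "abelian_subalgebra n B" "x \<in> B" "y \<in> B" using abelian_bicommutant[OF xy] .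
    then show ?thesis using assms unfolding quasitrace_on_def by blast
  qed
  show ?thesis
    unfolding cqt_def
  proof (intro conjI allI impI)
    fix X Y :: "'a mat_prod" and r :: real
    show "\<sigma> (mpr n (X * adj X)) \<in> \<real>\<^sub>\<ge>\<^sub>0" "\<sigma> (mpr n (X * adj X)) = \<sigma> (mpr n (adj X * X))"
      unfolding mpr_times mpr_adj using 1[OF mpr_in_matrices] by blast+
    assume X: "adj X = X"
    then have Xm: "madj (mpr n X) = mpr n X" by (metis mpr_adj)
    then show "\<sigma> (mpr n (r *\<^sub>R X)) = of_real r * \<sigma> (mpr n X)"
      using 2[of "mpr n X" "mpr n X"] by (simp add: mpr_scaleR)
    assume Y: "adj Y = Y" and c: "X * Y = Y * X"
    have "madj (mpr n Y) = mpr n Y" "mmult (mpr n X) (mpr n Y) = mmult (mpr n Y) (mpr n X)"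
      using Y c by (metis mpr_adj, metis mpr_times)
    then show "\<sigma> (mpr n (X + Y)) = \<sigma> (mpr n X) + \<sigma> (mpr n Y)"
      using 2[of "mpr n X" "mpr n Y"] Xm by (simp add: mpr_plus)
  qed
qed

text \<open>Closedness is the point: limits formed in the larger algebra have entries 0 off the
  smaller corner and so lie in it.\<close>

lemma abelian_subalgebra_mono:
  assumes B: "abelian_subalgebra m B" and mn: "m \<le> n"
  shows "abelian_subalgebra n B"
proof -
  have Bm: "B \<subseteq> matrices m" using B by (simp add: abelian_subalgebra_def)
  have closed: "a \<in> B" if a: "a \<in> matrices n" and x: "\<And>k. x k \<in> B" and lim: "mtendsto n x a" for x a
  proof -
    have "a i j = 0" if "\<not> (i < m \<and> j < m)" for i j
    proof (cases "i < n \<and> j < n")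
      case True
      then have "(\<lambda>k. x k i j) \<longlonglongrightarrow> a i j" using lim by (simp add: mtendsto_iff)
      moreover have "x k i j = 0" for k using x[of k] Bm that matrices_0 by blast
      ultimately show ?thesis by (simp add: LIMSEQ_const_iff)
    qed (rule matrices_0[OF a])
    then have "a \<in> matrices m" by (intro matricesI)
    moreover have "mtendsto m x a" using lim mn by (simp add: mtendsto_iff)
    ultimately show ?thesis using B x unfolding abelian_subalgebra_def by blast
  qed
  then show ?thesis
    using B matrices_mono[OF mn] unfolding abelian_subalgebra_def by blast
qed

lemma quasitrace_on_mono:
  assumes "quasitrace_on n \<sigma>" "m \<le> n"
  shows "quasitrace_on m \<sigma>"
  using assms(1) matrices_mono[OF assms(2)] abelian_subalgebra_mono[OF _ assms(2)]
  unfolding quasitrace_on_def by blast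

section \<open>Normalization and norm bounds on matrix algebras\<close>

definition munit :: "nat \<Rightarrow> nat \<Rightarrow> 'a::unital_cstar_algebra mat_array" where
  "munit i j = (\<lambda>r s. if r = i \<and> s = j then 1 else 0)"

lemma munit_in_matrices: "i < n \<Longrightarrow> j < n \<Longrightarrow> munit i j \<in> matrices n"
  by (rule matricesI) (auto simp: munit_def)

lemma madj_munit: "madj (munit i j) = munit j i"
  by (auto simp: madj_def munit_def fun_eq_iff)

lemma mmult_munit: "mmult (munit i j) (munit j l) = (munit i l :: 'a::unital_cstar_algebra mat_array)"
proof (intro ext)
  fix r s
  obtain n where ij: "i < n" "j < n" by (meson gt_ex less_trans max_less_iff_conj)
  then have n: "munit i j \<in> matrices n" by (rule munit_in_matrices)
  have "mmult (munit i j) (munit j l) r s = (\<Sum>k<n. if k = j then munit i l r s else 0 :: 'a)"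
    unfolding mmult_eq[OF n] by (intro sum.cong) (auto simp: munit_def)
  then show "mmult (munit i j) (munit j l) r s = (munit i l r s :: 'a)" using ij by simp
qed

lemma quasitrace_mid:
  assumes s: "quasitrace_extension n \<tau> \<sigma>" and t: "\<tau> 1 = 1" and m: "m \<le> n"
  shows "\<sigma> (mid m) = of_nat m"
proof -
  have q: "quasitrace_on n \<sigma>" using s by (simp add: quasitrace_extension_def)
  note c = quasitrace_on_cqt[OF q]
  show ?thesis
    using m
  proof (induction m)
    case 0
    have "mid 0 = (\<lambda>i j. 0 :: 'a)" by (simp add: mid_def)
    then show ?case using cqt_0[OF c] by (simp add: mpr_zero)
  next
    case (Suc m)
    have mm: "mid m \<in> matrices n" using mid_in_matrices Suc.prems matrices_in_mono by (metis Suc_leD)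
    have u: "munit m m \<in> matrices n" using Suc.prems by (intro munit_in_matrices) auto
    have w: "munit m 0 \<in> matrices n" using Suc.prems by (intro munit_in_matrices) auto
    \<comment> \<open>The matrix unit \<open>munit m 0\<close> makes the two diagonal units
      equivalent.\<close>
    have "\<sigma> (munit m m) = \<sigma> (munit 0 0)"
      using q w unfolding quasitrace_on_def by (metis madj_munit mmult_munit)
    also have "munit 0 0 = corner 1" by (simp add: munit_def corner_def)
    also have "\<sigma> (corner 1) = 1" using s t by (simp add: quasitrace_extension_def)
    finally have su: "\<sigma> (munit m m) = 1" .
    have z: "mmult (mid m) (munit m m) = (\<lambda>i j. 0 :: 'a)" "mmult (munit m m) (mid m) = (\<lambda>i j. 0 :: 'a)"
      unfolding fun_eq_iff mmult_eq[OF mm] mmult_eq[OF u] by (auto simp: mid_def munit_def intro!: sum.neutral)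
    have "\<sigma> (mpr n (mem n (mid m) + mem n (munit m m))) = \<sigma> (mpr n (mem n (mid m))) + \<sigma> (mpr n (mem n (munit m m)))"
      by (rule cqt_add[OF c]) (simp_all add: mem_adj mem_times mm u madj_munit z)
    moreover have "mplus (mid m) (munit m m) = (mid (Suc m) :: 'a mat_array)"
      by (auto simp: mplus_def mid_def munit_def fun_eq_iff)
    moreover have "(mid (Suc m) :: 'a mat_array) \<in> matrices n"
      using mid_in_matrices Suc.prems matrices_in_mono by metis
    ultimately have "\<sigma> (mid (Suc m)) = \<sigma> (mid m) + 1"
      by (simp add: mem_plus[OF mm u] mm u su)
    then show ?case using Suc by simp
  qed
qed

text \<open>The factor 2 comes from real and imaginary part, the factor m from the value at the
  unit. The bound involves a size m of x and not the size n on which \<sigma> is a quasitrace; this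
  uniformity in n is what compactness needs.\<close>

lemma quasitrace_bound:
  assumes s: "quasitrace_extension n \<tau> \<sigma>" and t: "\<tau> 1 = 1" and m: "m \<le> n" and x: "x \<in> matrices m"
  shows "cmod (\<sigma> x) \<le> 2 * mnorm m x * m"
proof -
  have q: "quasitrace_on m \<sigma>" using s m quasitrace_on_mono by (auto simp: quasitrace_extension_def)
  have one: "\<sigma> (mpr m 1) = of_nat m" by (simp add: mpr_one quasitrace_mid[OF s t m])
  obtain h k where hk: "adj h = h" "adj k = k" "mem m x = h + \<i> *\<^sub>C k" by (rule ex_real_imaginary_parts)
  have adjx: "adj (mem m x) = h - \<i> *\<^sub>C k" by (simp add: hk adj_add adj_scaleC scaleC_minus_left)
  have "norm ((2 :: real) *\<^sub>R h) \<le> 2 * mnorm m x"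
  proof -
    have "(2 :: real) *\<^sub>R h = mem m x + adj (mem m x)" by (simp add: adjx) (simp add: hk(3) scaleR_2)
    also have "norm \<dots> \<le> 2 * mnorm m x" using norm_triangle_ineq[of "mem m x" "adj (mem m x)"] x by (simp add: norm_mem)
    finally show ?thesis .
  qed
  then have nh: "norm h \<le> mnorm m x" by simp
  have "norm ((2 * \<i>) *\<^sub>C k) \<le> 2 * mnorm m x"
  proof -
    have "(2 * \<i>) *\<^sub>C k = mem m x - adj (mem m x)"
      by (simp add: adjx) (simp add: hk(3) scaleC_add_left[symmetric] del: scaleC_scaleC)
    also have "norm \<dots> \<le> 2 * mnorm m x" using norm_triangle_ineq4[of "mem m x" "adj (mem m x)"] x by (simp add: norm_mem)
    finally show ?thesis .
  qed
  then have nk: "norm k \<le> mnorm m x" by (simp add: norm_scaleC norm_mult)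
  have "x = mplus (mpr m h) (mscale \<i> (mpr m k))"
    using arg_cong[OF hk(3), of "mpr m"] x by (simp add: mpr_plus mpr_scaleC)
  moreover have "madj (mpr m h) = mpr m h" "madj (mpr m k) = mpr m k" using hk by (metis mpr_adj)+
  ultimately have "\<sigma> x = \<sigma> (mpr m h) + \<i> * \<sigma> (mpr m k)"
    using q unfolding quasitrace_on_def by (metis mpr_in_matrices)
  then have "cmod (\<sigma> x) \<le> cmod (\<sigma> (mpr m h)) + cmod (\<sigma> (mpr m k))"
    using norm_triangle_ineq[of "\<sigma> (mpr m h)" "\<i> * \<sigma> (mpr m k)"] by (simp add: norm_mult)
  also have "\<dots> \<le> norm h * m + norm k * m"
    using cqt_bound[OF quasitrace_on_cqt[OF q] hk(1)] cqt_bound[OF quasitrace_on_cqt[OF q] hk(2)] one by simp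
  also have "\<dots> \<le> 2 * mnorm m x * m"
    using mult_right_mono[OF nh, of "real m"] mult_right_mono[OF nk, of "real m"] by simp
  finally show ?thesis .
qed

section \<open>Compatible extensions by compactness\<close>

lemma closed_Collect_Ball: "(\<And>x. x \<in> A \<Longrightarrow> closed {\<sigma>. P x \<sigma>}) \<Longrightarrow> closed {\<sigma>. \<forall>x\<in>A. P x \<sigma>}"
  using closed_INT[of A "\<lambda>x. {\<sigma>. P x \<sigma>}"] by (simp add: INTER_eq)

lemma closed_Collect_const_imp: "(P \<Longrightarrow> closed {\<sigma>. Q \<sigma>}) \<Longrightarrow> closed {\<sigma>. P \<longrightarrow> Q \<sigma>}"
  by (cases P) auto

text \<open>Each single condition is a closed one on the values of \<sigma> at finitely many arrays,
  hence closed in the product topology.\<close>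

lemma closed_quasitrace_extension: "closed {\<sigma>. quasitrace_extension n \<tau> \<sigma>}"
  unfolding quasitrace_extension_def quasitrace_on_def complex_nonneg_Reals_iff
  by (intro closed_Collect_conj closed_Collect_all closed_Collect_Ball closed_Collect_const_imp
      closed_Collect_eq closed_Collect_le continuous_intros continuous_on_product_coordinates)

text \<open>Tychonoff's theorem yields a compatible extension to all matrix algebras without using that extensions
  are unique.\<close>

lemma ex_quasitrace_extension:
  assumes "\<tau> \<in> QT"
  shows "\<exists>\<sigma>. \<forall>n\<ge>1. quasitrace_extension n \<tau> \<sigma>"
proof -
  have t: "\<tau> 1 = 1" and ex: "\<And>n. 1 \<le> n \<Longrightarrow> \<exists>\<sigma>. quasitrace_extension n \<tau> \<sigma>"
    using assms by (auto simp: QT_def)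
  \<comment> \<open>Taking the least size makes the radius \<beta> depend on x alone. Off
    \<open>Minf\<close> the size is arbitrary, and \<beta> >= 0 is enough there.\<close>
  define m where "m x = (LEAST m. x \<in> matrices m)" for x :: "'a mat_array"
  define \<beta> where "\<beta> x = 2 * mnorm (m x) x * m x" for x :: "'a mat_array"
  have b0: "0 \<le> \<beta> x" for x by (simp add: \<beta>_def mnorm_ge_0)
  define K where "K = (\<Pi>\<^sub>E x\<in>UNIV. cball (0::complex) (\<beta> x))"
  have "compact K"
    using compactin_PiE[of "\<lambda>_. euclidean" "UNIV :: 'a mat_array set" "\<lambda>x. cball (0::complex) (\<beta> x)"]
    by (simp add: K_def euclidean_product_topology)
  then have "K \<inter> (\<Inter>n\<in>{1..}. {\<sigma>. quasitrace_extension n \<tau> \<sigma>}) \<noteq> {}"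
  proof (rule compact_imp_fip_image)
    fix I :: "nat set" assume I: "finite I" "I \<subseteq> {1..}"
    define n where "n = Max (insert 1 I)"
    have n: "1 \<le> n" "\<And>i. i \<in> I \<Longrightarrow> i \<le> n" using I by (auto simp: n_def)
    obtain \<sigma> where s: "quasitrace_extension n \<tau> \<sigma>" using ex[OF n(1)] by blast
    \<comment> \<open>Nothing bounds \<sigma> off the n by n matrices, so it is replaced by 0 there
      in order to lie in K.\<close>
    define \<rho> where "\<rho> x = (if x \<in> matrices n then \<sigma> x else 0)" for x
    have "quasitrace_extension i \<tau> \<rho>" if i: "i \<in> I" for i
    proof -
      have q: "quasitrace_on i \<sigma>" using s n(2)[OF i] quasitrace_on_mono by (auto simp: quasitrace_extension_def)
      have eq: "\<rho> x = \<sigma> x" if "x \<in> matrices i" for x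
        using matrices_in_mono[OF that n(2)[OF i]] by (simp add: \<rho>_def)
      have "\<rho> (corner x) = \<tau> x" for x
        using s corner_in_matrices[OF n(1), of x] by (simp add: \<rho>_def quasitrace_extension_def)
      moreover have "quasitrace_on i \<rho>"
        unfolding quasitrace_on_def
      proof (intro conjI ballI allI impI)
        fix x :: "'a mat_array" assume x: "x \<in> matrices i"
        have "\<rho> (mmult x (madj x)) = \<sigma> (mmult x (madj x))" "\<rho> (mmult (madj x) x) = \<sigma> (mmult (madj x) x)"
          by (intro eq mmult_in_matrices madj_in_matrices x)+
        then show "\<rho> (mmult x (madj x)) \<in> \<real>\<^sub>\<ge>\<^sub>0" "\<rho> (mmult x (madj x)) = \<rho> (mmult (madj x) x)"
          using q x unfolding quasitrace_on_def by metis+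
        fix y :: "'a mat_array" assume y: "y \<in> matrices i" "madj x = x" "madj y = y"
        then show "\<rho> (mplus x (mscale \<i> y)) = \<rho> x + \<i> * \<rho> y"
          using q x by (simp add: quasitrace_on_def eq mplus_in_matrices mscale_in_matrices)
      next
        fix B and x y :: "'a mat_array" assume B: "abelian_subalgebra i B" and x: "x \<in> B" and y: "y \<in> B"
        then have "mplus x y \<in> matrices i" "x \<in> matrices i" "y \<in> matrices i"
          unfolding abelian_subalgebra_def by blast+
        moreover have "\<sigma> (mplus x y) = \<sigma> x + \<sigma> y" using q B x y unfolding quasitrace_on_def by blast
        ultimately show "\<rho> (mplus x y) = \<rho> x + \<rho> y" by (simp add: eq)
      next
        fix B c and x :: "'a mat_array" assume B: "abelian_subalgebra i B" and x: "x \<in> B"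
        then have "mscale c x \<in> matrices i" "x \<in> matrices i"
          unfolding abelian_subalgebra_def by blast+
        moreover have "\<sigma> (mscale c x) = c * \<sigma> x" using q B x unfolding quasitrace_on_def by blast
        ultimately show "\<rho> (mscale c x) = c * \<rho> x" by (simp add: eq)
      qed
      ultimately show ?thesis by (simp add: quasitrace_extension_def)
    qed
    moreover have "cmod (\<rho> x) \<le> \<beta> x" for x
    proof (cases "x \<in> matrices n")
      case True
      then have "x \<in> matrices (m x)" "m x \<le> n" unfolding m_def by (rule LeastI, rule Least_le)
      then show ?thesis using quasitrace_bound[OF s t] True by (simp add: \<rho>_def \<beta>_def)
    qed (simp add: \<rho>_def b0)
    ultimately have "\<rho> \<in> K \<inter> (\<Inter>i\<in>I. {\<sigma>. quasitrace_extension i \<tau> \<sigma>})" by (auto simp: K_def)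
    then show "K \<inter> (\<Inter>i\<in>I. {\<sigma>. quasitrace_extension i \<tau> \<sigma>}) \<noteq> {}" by blast
  qed (rule closed_quasitrace_extension)
  then show ?thesis by auto
qed

lemma qt_ext:
  assumes "\<tau> \<in> QT" "1 \<le> n"
  shows "quasitrace_extension n \<tau> (qt_ext \<tau>)"
  using someI_ex[OF ex_quasitrace_extension[OF assms(1)]] assms(2) by (simp add: qt_ext_def)

section \<open>Multiples of a matrix\<close>

fun mcopies :: "nat \<Rightarrow> nat \<Rightarrow> 'a::unital_cstar_algebra mat_array \<Rightarrow> 'a mat_array" where
  "mcopies m 0 b = (\<lambda>i j. 0)"
| "mcopies m (Suc K) b = dsum (K * m) (mcopies m K b) b"

lemma dsum_in_matrices: "b \<in> matrices m \<Longrightarrow> dsum n a b \<in> matrices (n + m)"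
  by (rule matricesI) (auto simp: dsum_def intro!: matrices_0)

lemma mcopies_in_matrices: "b \<in> matrices m \<Longrightarrow> mcopies m K b \<in> matrices (K * m)"
proof (induction K)
  case (Suc K)
  then show ?case using dsum_in_matrices[of b m "K * m"] by (simp add: add.commute)
qed simp

text \<open>The partial isometry that moves the first m coordinates to the positions d, ..., d + m -
  1. Conjugation by it expresses direct sums and multiples as sums inside one algebra.\<close>

definition mshift :: "nat \<Rightarrow> nat \<Rightarrow> 'a::unital_cstar_algebra mat_array" where
  "mshift m d = (\<lambda>r s. if s < m \<and> r = d + s then 1 else 0)"

lemma mshift_in_matrices: "d + m \<le> n \<Longrightarrow> mshift m d \<in> matrices n"
  by (rule matricesI) (auto simp: mshift_def)

lemma mshift_conj:
  assumes "d + m \<le> n" "b \<in> matrices m"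
  shows "mmult (mmult (mshift m d) b) (madj (mshift m d)) = (\<lambda>r s. if d \<le> r \<and> d \<le> s then b (r - d) (s - d) else 0)"
proof (intro ext)
  fix r s
  have w: "mshift m d \<in> matrices n" by (rule mshift_in_matrices[OF assms(1)])
  have bn: "b \<in> matrices n" using assms matrices_in_mono by (metis add_leD2)
  have 1: "mmult (mshift m d) b r t = (if d \<le> r then b (r - d) t else 0)" for r t
  proof -
    have "mmult (mshift m d) b r t = (\<Sum>k<n. if k = r - d then (if d \<le> r then b (r - d) t else 0) else 0)"
      unfolding mmult_eq[OF w] by (intro sum.cong refl) (auto simp: mshift_def matrices_0[OF assms(2)])
    then show ?thesis using matrices_0[OF bn, of "r - d" t] by auto
  qed
  have "mmult (mmult (mshift m d) b) (madj (mshift m d)) r s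
      = (\<Sum>k<n. if k = s - d then (if d \<le> r \<and> d \<le> s then b (r - d) (s - d) else 0) else 0)"
    unfolding mmult_eq[OF mmult_in_matrices[OF w bn]] 1 madj_def
    by (intro sum.cong refl) (auto simp: mshift_def matrices_0[OF assms(2)])
  then show "mmult (mmult (mshift m d) b) (madj (mshift m d)) r s = (if d \<le> r \<and> d \<le> s then b (r - d) (s - d) else 0)"
    using matrices_0[OF bn, of "r - d" "s - d"] by auto
qed

lemma mshift_adj_mult:
  assumes "d + m \<le> n" "d' + m \<le> n"
  shows "mmult (madj (mshift m d)) (mshift m d') = (\<lambda>s t. if s < m \<and> t < m \<and> d + s = d' + t then 1 else 0)"
proof (intro ext)
  fix s t
  have w: "madj (mshift m d) \<in> matrices n" by (intro madj_in_matrices mshift_in_matrices assms)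
  have "mmult (madj (mshift m d)) (mshift m d') s t
      = (\<Sum>r<n. if r = d + s then (if s < m \<and> t < m \<and> d + s = d' + t then 1 else 0) else 0)"
    unfolding mmult_eq[OF w] by (intro sum.cong refl) (auto simp: mshift_def madj_def)
  then show "mmult (madj (mshift m d)) (mshift m d') s t = (if s < m \<and> t < m \<and> d + s = d' + t then 1 else 0)"
    using assms by auto
qed

lemma mem_mshift_adj_mult:
  assumes "d + m \<le> N"
  shows "adj (mem N (mshift m d)) * mem N (mshift m d) = mem N (mid m :: 'a::unital_cstar_algebra mat_array)"
proof -
  have w: "(mshift m d :: 'a mat_array) \<in> matrices N" by (rule mshift_in_matrices[OF assms])
  have "mmult (madj (mshift m d)) (mshift m d) = (mid m :: 'a mat_array)"
    unfolding mshift_adj_mult[OF assms assms] by (auto simp: mid_def fun_eq_iff)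
  then show ?thesis by (simp add: mem_adj mem_times madj_in_matrices w)
qed

lemma mem_dsum:
  assumes a: "a \<in> matrices n" and b: "b \<in> matrices m" and N: "n + m \<le> N"
  shows "mem N (dsum n a b) = mem N a + mem N (mshift m n) * mem N b * adj (mem N (mshift m n))"
proof -
  have aN: "a \<in> matrices N" and bN: "b \<in> matrices N" using a b N matrices_in_mono by (metis add_leD1, metis add_leD2)
  have w: "mshift m n \<in> matrices N" by (rule mshift_in_matrices[OF N])
  let ?S = "\<lambda>r s. if n \<le> r \<and> n \<le> s then b (r - n) (s - n) else 0"
  have S: "mmult (mmult (mshift m n) b) (madj (mshift m n)) = ?S"
    by (rule mshift_conj[OF N b])
  have SN: "?S \<in> matrices N"
    unfolding S[symmetric] by (intro mmult_in_matrices madj_in_matrices w bN)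
  have "dsum n a b = mplus a ?S"
    using matrices_0[OF a] by (auto simp: dsum_def mplus_def fun_eq_iff)
  then have "mem N (dsum n a b) = mem N a + mem N ?S"
    by (simp only: mem_plus[OF aN SN])
  also have "mem N ?S = mem N (mshift m n) * mem N b * adj (mem N (mshift m n))"
    unfolding S[symmetric] by (simp add: w bN mem_times mem_adj mmult_in_matrices madj_in_matrices)
  finally show ?thesis .
qed

lemma mcopies_eq_sum:
  assumes "K * m \<le> N" "b \<in> matrices m"
  shows "mem N (mcopies m K b) = (\<Sum>i<K. mem N (mshift m (i * m)) * mem N b * adj (mem N (mshift m (i * m))))"
  using assms(1)
proof (induction K)
  case (Suc K)
  then have Km: "K * m + m \<le> N" by (simp add: add.commute)
  show ?case using Suc Km mem_dsum[OF mcopies_in_matrices[OF assms(2)] assms(2) Km] by simp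
qed (simp add: mem_zero)

text \<open>Convergence is entrywise, so a comparison in one size persists in every larger
  size.\<close>

lemma cuntz_le_approx:
  assumes "cuntz_le a b"
  obtains n where "\<And>N e. n \<le> N \<Longrightarrow> 0 < e \<Longrightarrow> \<exists>x\<in>matrices N. mnorm N (mminus (mmult (mmult x b) (madj x)) a) < e"
proof -
  obtain n x where n: "a \<in> matrices n" "b \<in> matrices n" "\<And>k. x k \<in> matrices n"
      "mtendsto n (\<lambda>k. mmult (mmult (x k) b) (madj (x k))) a"
    using assms unfolding cuntz_le_def by blast
  have "\<exists>x\<in>matrices N. mnorm N (mminus (mmult (mmult x b) (madj x)) a) < e" if N: "n \<le> N" and e: "0 < e" for N and e :: real
  proof -
    have "mtendsto N (\<lambda>k. mmult (mmult (x k) b) (madj (x k))) a"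
      unfolding mtendsto_iff
    proof (intro allI impI)
      fix i j
      show "(\<lambda>k. mmult (mmult (x k) b) (madj (x k)) i j) \<longlonglongrightarrow> a i j"
      proof (cases "i < n \<and> j < n")
        case False
        have "mmult (mmult (x k) b) (madj (x k)) \<in> matrices n" for k
          by (intro mmult_in_matrices madj_in_matrices n)
        then show ?thesis by (simp add: matrices_0[OF _ False] matrices_0[OF n(1) False])
      qed (use n(4) in \<open>simp add: mtendsto_iff\<close>)
    qed
    then have "(\<lambda>k. mnorm N (mminus (mmult (mmult (x k) b) (madj (x k))) a)) \<longlonglongrightarrow> 0" by (simp add: mtendsto_def)
    from LIMSEQ_D[OF this e] obtain k where "mnorm N (mminus (mmult (mmult (x k) b) (madj (x k))) a) < e"
      by (auto simp: mnorm_ge_0)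
    then show ?thesis using n(3) matrices_in_mono[OF _ N] by blast
  qed
  then show ?thesis by (rule that)
qed

text \<open>The ambient size will grow with the number of copies, while the bound on the norm must
  not.\<close>

lemma mnorm_le_sum_corner:
  assumes "x \<in> matrices m" "m \<le> n"
  shows "mnorm n x \<le> (\<Sum>i<m. \<Sum>j<m. norm (x i j))"
proof -
  have "(\<Sum>i<n. \<Sum>j<n. norm (x i j)) = (\<Sum>i<n. \<Sum>j<m. norm (x i j))"
    using assms by (intro sum.cong refl sum.mono_neutral_right) (auto simp: matrices_0)
  also have "\<dots> = (\<Sum>i<m. \<Sum>j<m. norm (x i j))"
    using assms by (intro sum.mono_neutral_right) (auto simp: matrices_0)
  finally show ?thesis using mnorm_le_sum[of n x] by simp
qed

text \<open>Every multiple K of the value at the root is at most the constant B m, so the value is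
  0. It is essential that \<open>qt_ext\<close> is one extension to all sizes: the ambient size N
  depends on K, the value at c does not.\<close>

lemma qt_ext_mroot_eq_0:
  assumes t: "\<tau> \<in> QT" and b: "b \<in> Minf_pos" "b \<in> matrices m" and k: "0 < k"
    and le: "\<And>K. cuntz_le (mcopies m K b) b"
  shows "qt_ext \<tau> (mroot k b) = 0"
proof -
  define \<sigma> where "\<sigma> = qt_ext \<tau>"
  define c where "c = mroot k b"
  have c: "c \<in> Minf_pos" "c \<in> matrices m" "(mmult c ^^ (k - 1)) c = b"
    using mroot[OF b k] by (simp_all add: c_def)
  define B where "B = (\<Sum>i<m. \<Sum>j<m. norm (c i j))"
  have bound: "real K * Re (\<sigma> c) \<le> B * m" for K
  proof -
    obtain n where n: "\<And>N e. n \<le> N \<Longrightarrow> 0 < e \<Longrightarrow>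
        \<exists>x\<in>matrices N. mnorm N (mminus (mmult (mmult x b) (madj x)) (mcopies m K b)) < e"
      using cuntz_le_approx[OF le[of K]] by blast
    \<comment> \<open>\<open>Suc K\<close> instead of K gives m <= N also for K = 0, and 1 <= N is
      there because extensions are provided from size 1 on.\<close>
    define N where "N = max 1 (max n (Suc K * m))"
    have N: "n \<le> N" "Suc K * m \<le> N" "1 \<le> N" by (auto simp: N_def)
    then have Km: "K * m \<le> N" and mN: "m \<le> N" by auto
    have im: "i * m + m \<le> N" if "i < K" for i
    proof -
      have "Suc i * m \<le> K * m" using that by (intro mult_le_mono1) auto
      then show ?thesis using Km by simp
    qed
    have cN: "c \<in> matrices N" and bN: "b \<in> matrices N" and pN: "mid m \<in> matrices N"
      using c(2) b(2) mid_in_matrices matrices_in_mono[OF _ mN] by blast+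
    have copN: "mcopies m K b \<in> matrices N" using mcopies_in_matrices[OF b(2)] matrices_in_mono[OF _ Km] by blast
    have ext: "quasitrace_extension N \<tau> \<sigma>" unfolding \<sigma>_def by (rule qt_ext[OF t N(3)])
    then have s: "cqt (\<lambda>X. \<sigma> (mpr N X))" by (intro quasitrace_on_cqt) (simp add: quasitrace_extension_def)
    let ?w = "\<lambda>i. mem N (mshift m (i * m)) :: 'a mat_prod"
    have w: "mshift m (i * m) \<in> matrices N" if "i < K" for i
      using im[OF that] by (rule mshift_in_matrices)
    have ck: "mem N c ^ k = mem N b" using mem_power[OF cN k] c(3) by simp
    have "real K * Re (\<sigma> (mpr N (mem N c))) \<le> norm (mem N c) * Re (\<sigma> (mpr N (mem N (mid m))))"
    proof (rule cqt_multiple_le[OF s _ _ _ _ _ _ k, where w = ?w])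
      fix i assume i: "i < K"
      show "adj (?w i) * ?w i = mem N (mid m)" by (rule mem_mshift_adj_mult[OF im[OF i]])
      fix j assume j: "j < K" "i \<noteq> j"
      have "i * m + s \<noteq> j * m + t" if "s < m" "t < m" for s t
      proof
        assume eq: "i * m + s = j * m + t"
        have "(i * m + s) div m = i" "(j * m + t) div m = j" using that by auto
        then show False using eq j(2) by simp
      qed
      then have "mmult (madj (mshift m (i * m))) (mshift m (j * m)) = (\<lambda>s t. 0 :: 'a)"
        unfolding mshift_adj_mult[OF im[OF i] im[OF j(1)]] by (auto simp: fun_eq_iff)
      then show "adj (?w i) * ?w j = 0"
        by (simp add: w[OF i] w[OF j(1)] mem_adj mem_times madj_in_matrices mem_zero)
    next
      show "cpos (mem N c)" by (rule cpos_mem[OF c(1) cN])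
      show "mem N c * mem N (mid m) = mem N c" by (simp add: cN pN mem_times mmult_mid_right[OF c(2)])
      show "adj (mem N (mid m)) = mem N (mid m :: 'a mat_array)" by (simp add: mem_adj pN)
      show "mem N (mid m) * mem N (mid m) = mem N (mid m :: 'a mat_array)" 
        by (simp add: mem_times pN mmult_mid_left[OF mid_in_matrices])
      fix e :: real assume "0 < e"
      then obtain x where x: "x \<in> matrices N" "mnorm N (mminus (mmult (mmult x b) (madj x)) (mcopies m K b)) < e"
        using n[OF N(1)] by blast
      have "mem N x * mem N c ^ k * adj (mem N x) - (\<Sum>i<K. ?w i * mem N c ^ k * adj (?w i))
          = mem N (mminus (mmult (mmult x b) (madj x)) (mcopies m K b))"
        unfolding ck mcopies_eq_sum[OF Km b(2), symmetric]
        using x(1) bN copN by (simp add: mem_adj mem_times mem_minus mmult_in_matrices madj_in_matrices)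
      then have "norm (mem N x * mem N c ^ k * adj (mem N x) - (\<Sum>i<K. ?w i * mem N c ^ k * adj (?w i))) < e"
        using x bN copN by (simp add: norm_mem mminus_in_matrices mmult_in_matrices madj_in_matrices)
      then show "\<exists>X. norm (X * mem N c ^ k * adj X - (\<Sum>i<K. ?w i * mem N c ^ k * adj (?w i))) < e" by blast
    qed
    also have "\<dots> \<le> B * m"
    proof -
      have "\<tau> 1 = 1" using t by (simp add: QT_def)
      from quasitrace_mid[OF ext this mN] have "Re (\<sigma> (mpr N (mem N (mid m)))) = m" by (simp add: pN)
      moreover have "norm (mem N c) \<le> B"
        unfolding norm_mem[OF cN] B_def by (rule mnorm_le_sum_corner[OF c(2) mN])
      ultimately show ?thesis by (simp add: mult_right_mono)
    qed
    finally show ?thesis by (simp add: cN)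
  qed
  have pos: "\<sigma> c \<in> \<real>\<^sub>\<ge>\<^sub>0"
  proof -
    have "quasitrace_on (max 1 m) \<sigma>" using qt_ext[OF t, of "max 1 m"] by (simp add: \<sigma>_def quasitrace_extension_def)
    moreover have "c \<in> matrices (max 1 m)" using c(2) by (rule matrices_in_mono) simp
    ultimately show ?thesis
      using cqt_cpos[OF quasitrace_on_cqt cpos_mem[OF c(1)]] by fastforce
  qed
  have "Re (\<sigma> c) \<le> 0"
  proof (rule ccontr)
    assume "\<not> Re (\<sigma> c) \<le> 0"
    then obtain K :: nat where "B * m < real K * Re (\<sigma> c)"
      using reals_Archimedean3[of "Re (\<sigma> c)"] by (metis not_le)
    then show False using bound[of K] by simp
  qed
  then have "\<sigma> c = 0" using pos by (auto simp: complex_nonneg_Reals_iff complex_eq_iff)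
  then show ?thesis by (simp add: \<sigma>_def c_def)
qed

proposition d_qt_eq_0:
  assumes "\<tau> \<in> QT" "b \<in> Minf_pos" "b \<in> matrices m" and "\<And>K. cuntz_le (mcopies m K b) b"
  shows "d_qt \<tau> b = 0"
proof -
  have "\<forall>\<^sub>F n in sequentially. qt_ext \<tau> (mroot n b) = 0"
    by (rule eventually_sequentiallyI[of 1]) (rule qt_ext_mroot_eq_0[OF assms(1-3) _ assms(4)], simp)
  then have "(\<lambda>n. qt_ext \<tau> (mroot n b)) \<longlonglongrightarrow> 0"
    by (rule tendsto_eventually)
  then have "lim (\<lambda>n. qt_ext \<tau> (mroot n b)) = 0" by (rule limI)
  then show ?thesis using assms(2) by (simp add: d_qt_def)
qed

section \<open>States on ordered monoids\<close>

primrec nmul :: "nat \<Rightarrow> 'w::comm_monoid_add \<Rightarrow> 'w" where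
  "nmul 0 x = 0"
| "nmul (Suc n) x = x + nmul n x"

lemma nmul_1 [simp]: "nmul (Suc 0) x = x"
  by simp

lemma nmul_add: "nmul (m + n) x = nmul m x + nmul n x"
  by (induction m) (auto simp: add.assoc)

lemma nmul_add_right: "nmul n (x + y) = nmul n x + nmul n y"
  by (induction n) (auto simp: ac_simps)

lemma nmul_nmul: "nmul m (nmul n x) = nmul (m * n) x"
  by (induction m) (auto simp: nmul_add)

lemma nmul_mono: "x \<le> (y :: 'w::ordered_comm_monoid_add) \<Longrightarrow> nmul n x \<le> nmul n y"
  by (induction n) (auto intro: add_mono)

lemma nmul_mono_left:
  fixes x :: "'w::ordered_comm_monoid_add"
  assumes "0 \<le> x" "m \<le> n" shows "nmul m x \<le> nmul n x"
proof -
  have "0 \<le> nmul k x" for k by (induction k) (auto intro: add_nonneg_nonneg assms(1))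
  then have "0 \<le> nmul (n - m) x" .
  then have "nmul m x + 0 \<le> nmul m x + nmul (n - m) x" by (rule add_left_mono)
  then show ?thesis using assms(2) by (simp add: nmul_add[symmetric])
qed

section \<open>Extension of states by minimal subadditive functionals\<close>

locale state_extension =
  fixes x y :: "'w::ordered_comm_monoid_add"
  assumes pos: "\<And>z :: 'w. 0 \<le> z"
begin

definition I :: "'w set" where
  "I = {z. \<exists>m. z \<le> nmul m y}"

lemma le_add1: "(z::'w) \<le> z + w"
  using add_left_mono[OF pos[of w], of z] by simp

lemma le_add2: "(w::'w) \<le> z + w"
  using le_add1[of w z] by (simp add: add.commute)

lemma I_add: "z + w \<in> I \<longleftrightarrow> z \<in> I \<and> w \<in> I"
proof
  assume "z + w \<in> I"
  then show "z \<in> I \<and> w \<in> I" unfolding I_def using order_trans[OF le_add1] order_trans[OF le_add2] by blast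
next
  assume "z \<in> I \<and> w \<in> I"
  then obtain m n where "z \<le> nmul m y" "w \<le> nmul n y" by (auto simp: I_def)
  then have "z + w \<le> nmul (m + n) y" by (simp add: nmul_add add_mono)
  then show "z + w \<in> I" by (auto simp: I_def)
qed

lemma I_0: "0 \<in> I"
  unfolding I_def by (rule CollectI, rule exI[of _ 0]) simp

lemma I_nmul: "z \<in> I \<Longrightarrow> nmul n z \<in> I"
  by (induction n) (auto simp: I_0 I_add)

lemma I_y: "y \<in> I"
  unfolding I_def by (rule CollectI, rule exI[of _ 1]) simp

text \<open>The functionals among which a minimal one is additive; the last condition prevents the value at
  \<open>x\<close> from dropping below \<open>1\<close>.\<close>

definition P :: "('w \<Rightarrow> real) set" where
  "P = {p. (\<forall>z. z \<notin> I \<longrightarrow> p z = 0) \<and> (\<forall>z\<in>I. 0 \<le> p z) \<and>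
    (\<forall>z\<in>I. \<forall>w\<in>I. z \<le> w \<longrightarrow> p z \<le> p w) \<and> (\<forall>z\<in>I. \<forall>w\<in>I. p (z + w) \<le> p z + p w) \<and>
    p y \<le> 1 \<and> (\<forall>i j. real i + real j \<le> p (nmul i x + nmul j y))}"

context
  assumes x: "x \<in> I"
begin

lemma I_xy: "nmul i x + nmul j y \<in> I"
  by (simp add: I_add I_nmul x I_y)

text \<open>An infimum over a family stays in P if sums can be estimated by moving to a third index.
  This serves both the chains in Zorn's lemma and the two ways of lowering a minimal
  functional.\<close>

lemma INF_in_P:
  assumes J: "J \<noteq> {}"
    and nn: "\<And>a w. a \<in> J \<Longrightarrow> w \<in> I \<Longrightarrow> 0 \<le> r a w"
    and mono: "\<And>a z w. a \<in> J \<Longrightarrow> z \<in> I \<Longrightarrow> w \<in> I \<Longrightarrow> z \<le> w \<Longrightarrow> r a z \<le> r a w"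
    and sub: "\<And>a b z w. a \<in> J \<Longrightarrow> b \<in> J \<Longrightarrow> z \<in> I \<Longrightarrow> w \<in> I \<Longrightarrow> \<exists>c\<in>J. r c (z + w) \<le> r a z + r b w"
    and low: "\<And>a i j. a \<in> J \<Longrightarrow> real i + real j \<le> r a (nmul i x + nmul j y)"
    and y: "\<exists>a\<in>J. r a y \<le> 1"
  shows "(\<lambda>w. if w \<in> I then INF a\<in>J. r a w else (0::real)) \<in> P"
    and "\<And>a w. a \<in> J \<Longrightarrow> w \<in> I \<Longrightarrow> (INF a\<in>J. r a w) \<le> r a w"
proof -
  have bdd: "bdd_below ((\<lambda>a. r a w) ` J)" if "w \<in> I" for w
    by (rule bdd_belowI2[of _ 0]) (use nn that in auto)
  show le: "(INF a\<in>J. r a w) \<le> r a w" if "a \<in> J" "w \<in> I" for a w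
    by (rule cINF_lower[OF bdd]) (use that in auto)
  have "(INF a\<in>J. r a (z + w)) \<le> (INF a\<in>J. r a z) + (INF a\<in>J. r a w)" if z: "z \<in> I" and w: "w \<in> I" for z w
  proof (rule field_le_epsilon)
    fix e :: real assume "0 < e"
    then obtain a b where ab: "a \<in> J" "r a z < (INF a\<in>J. r a z) + e/2" "b \<in> J" "r b w < (INF a\<in>J. r a w) + e/2"
      using cINF_less_iff[OF J bdd[OF z]] cINF_less_iff[OF J bdd[OF w]] 
      by (metis half_gt_zero less_add_same_cancel1)
    then obtain c where c: "c \<in> J" "r c (z + w) \<le> r a z + r b w" using sub z w by blast
    have "z + w \<in> I" using z w by (simp add: I_add)
    from le[OF c(1) this] show "(INF a\<in>J. r a (z + w)) \<le> (INF a\<in>J. r a z) + (INF a\<in>J. r a w) + e"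
      using c(2) ab by linarith
  qed
  moreover have "(INF a\<in>J. r a z) \<le> (INF a\<in>J. r a w)" if "z \<in> I" "w \<in> I" "z \<le> w" for z w
    by (rule cINF_mono[OF J bdd]) (use mono that in auto)
  moreover have "0 \<le> (INF a\<in>J. r a w)" if "w \<in> I" for w
    by (rule cINF_greatest[OF J]) (use nn that in auto)
  moreover have "(INF a\<in>J. r a y) \<le> 1" using y le[OF _ I_y] by (meson order_trans)
  moreover have "real i + real j \<le> (INF a\<in>J. r a (nmul i x + nmul j y))" for i j
    by (rule cINF_greatest[OF J]) (use low in auto)
  ultimately show "(\<lambda>w. if w \<in> I then INF a\<in>J. r a w else 0) \<in> P"
    unfolding P_def by (auto simp: I_y I_nmul x I_add)
qed

lemma P_nmul_le:
  assumes p: "p \<in> P" and z: "z \<in> I" and n: "0 < n"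
  shows "p (nmul n z) \<le> real n * p z"
  using n
proof (induction n rule: nat_induct_non_zero)
  case (Suc n)
  have "p (z + nmul n z) \<le> p z + p (nmul n z)" using p z I_nmul[OF z] by (auto simp: P_def)
  then show ?case using Suc by (simp add: algebra_simps)
qed simp

text \<open>A minimal p cannot be lowered. Lowering it to the infimum of p(n w)/n gives homogeneity.
  Lowering it to the infimum of p(w + k u) - k c gives p w + c <= p(w + u), provided the lowered
  family respects the floor i + j at i x + j y. This is used for u = x and u = y with c = 1, and
  then for u = z with c = p z, which is superadditivity.\<close>

lemma minimal_additive:
  assumes p: "p \<in> P" and min: "\<And>q. q \<in> P \<Longrightarrow> (\<And>w. w \<in> I \<Longrightarrow> q w \<le> p w) \<Longrightarrow> q = p"
    and z: "z \<in> I" and w: "w \<in> I"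
  shows "p (z + w) = p z + p w"
proof -
  have nn: "0 \<le> p z" if "z \<in> I" for z using p that by (auto simp: P_def)
  have mono: "p z \<le> p w" if "z \<le> w" "z \<in> I" "w \<in> I" for z w using p that by (auto simp: P_def)
  have sub: "p (z + w) \<le> p z + p w" if "z \<in> I" "w \<in> I" for z w using p that by (auto simp: P_def)
  have py: "p y \<le> 1" using p by (auto simp: P_def)
  have low: "real i + real j \<le> p (nmul i x + nmul j y)" for i j using p by (auto simp: P_def)
  have INF: "p w \<le> r a w"
    if h: "J \<noteq> {}" "\<And>a w. a \<in> J \<Longrightarrow> w \<in> I \<Longrightarrow> 0 \<le> r a w"
      "\<And>a z w. a \<in> J \<Longrightarrow> z \<in> I \<Longrightarrow> w \<in> I \<Longrightarrow> z \<le> w \<Longrightarrow> r a z \<le> r a w"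
      "\<And>a b z w. a \<in> J \<Longrightarrow> b \<in> J \<Longrightarrow> z \<in> I \<Longrightarrow> w \<in> I \<Longrightarrow> \<exists>c\<in>J. r c (z + w) \<le> r a z + r b w"
      "\<And>a i j. a \<in> J \<Longrightarrow> real i + real j \<le> r a (nmul i x + nmul j y)"
      "\<exists>a0\<in>J. \<forall>w\<in>I. r a0 w \<le> p w" "a \<in> J" "w \<in> I" for J :: "nat set" and r and a w
  proof -
    have y1: "\<exists>a\<in>J. r a y \<le> 1" using h(6) I_y py by (meson order_trans)
    have in_P: "(\<lambda>w. if w \<in> I then INF a\<in>J. r a w else (0::real)) \<in> P"
      by (rule INF_in_P(1)) (fact h(1), fact h(2), fact h(3), fact h(4), fact h(5), fact y1)
    have lower: "(INF a\<in>J. r a w) \<le> r a w" if "a \<in> J" "w \<in> I" for a w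
      by (rule cINF_lower[OF bdd_belowI2[of J 0 "\<lambda>a. r a w"]]) (use h(2) that in auto)
    have "(\<lambda>w. if w \<in> I then INF a\<in>J. r a w else 0) = p"
    proof (rule min[OF in_P])
      fix w assume w: "w \<in> I"
      obtain a0 where a0: "a0 \<in> J" "r a0 w \<le> p w" using h(6) w by blast
      then show "(if w \<in> I then INF a\<in>J. r a w else 0) \<le> p w"
        using lower[OF a0(1) w] w by simp
    qed
    from fun_cong[OF this, of w] show ?thesis using lower[OF h(7,8)] h(8) by simp
  qed
  have homog: "real n * p w \<le> p (nmul n w)" if n: "0 < n" and w: "w \<in> I" for n w
  proof -
    have "p w \<le> p (nmul n w) / real n"
    proof (rule INF[where J = "{0<..}" and r = "\<lambda>n w. p (nmul n w) / real n"])
      show "0 \<le> p (nmul a w) / real a" if "w \<in> I" for a w using nn I_nmul that by simp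
      show "p (nmul a z) / real a \<le> p (nmul a w) / real a" if "z \<in> I" "w \<in> I" "z \<le> w" for a z w
        by (intro divide_right_mono mono nmul_mono I_nmul that) simp
      show "\<exists>c\<in>{0<..}. p (nmul c (z + w)) / real c \<le> p (nmul a z) / real a + p (nmul b w) / real b"
        if ab: "a \<in> {0<..}" "b \<in> {0<..}" and zw: "z \<in> I" "w \<in> I" for a b z w
      proof
        have "p (nmul (a * b) (z + w)) \<le> p (nmul b (nmul a z)) + p (nmul a (nmul b w))"
          using sub[OF I_nmul[OF zw(1)] I_nmul[OF zw(2)]] by (simp add: nmul_add_right nmul_nmul mult.commute)
        also have "\<dots> \<le> real b * p (nmul a z) + real a * p (nmul b w)"
          using ab by (intro add_mono P_nmul_le[OF p] I_nmul zw) auto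
        finally show "p (nmul (a * b) (z + w)) / real (a * b) \<le> p (nmul a z) / real a + p (nmul b w) / real b"
          using ab by (simp add: field_simps)
        show "a * b \<in> {0<..}" using ab by simp
      qed
      show "real i + real j \<le> p (nmul a (nmul i x + nmul j y)) / real a" if "a \<in> {0<..}" for a i j
        using low[of "a * i" "a * j"] that by (simp add: nmul_add_right nmul_nmul field_simps)
      show "\<exists>a0\<in>{0<..}. \<forall>w\<in>I. p (nmul a0 w) / real a0 \<le> p w" by (rule bexI[of _ 1]) auto
    qed (use n w in auto)
    then show ?thesis using n by (simp add: field_simps)
  qed
  have shift: "p w + c \<le> p (w + u)"
    if u: "u \<in> I" and c: "\<And>i j k. real i + real j + real k * c \<le> p (nmul i x + nmul j y + nmul k u)"
      and w: "w \<in> I" for u c w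
  proof -
    have "p w \<le> p (w + nmul 1 u) - real 1 * c"
    proof (rule INF[where J = UNIV and r = "\<lambda>k w. p (w + nmul k u) - real k * c"])
      fix k :: nat and w assume w: "w \<in> I"
      have "p (nmul k u) \<le> p (w + nmul k u)"
        by (intro mono le_add2) (simp_all add: I_add I_nmul u w)
      then show "0 \<le> p (w + nmul k u) - real k * c" using c[of 0 0 k] by simp
    next
      fix k :: nat and z w assume "z \<in> I" "w \<in> I" "z \<le> w"
      then have "p (z + nmul k u) \<le> p (w + nmul k u)"
        by (intro mono add_right_mono) (simp_all add: I_add I_nmul u)
      then show "p (z + nmul k u) - real k * c \<le> p (w + nmul k u) - real k * c" by simp
    next
      fix a b :: nat and z w assume zw: "z \<in> I" "w \<in> I"
      have "p (z + w + nmul (a + b) u) = p ((z + nmul a u) + (w + nmul b u))" by (simp add: nmul_add ac_simps)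
      also have "\<dots> \<le> p (z + nmul a u) + p (w + nmul b u)"
        by (rule sub) (simp_all add: I_add I_nmul u zw)
      finally show "\<exists>d\<in>UNIV. p (z + w + nmul d u) - real d * c
         \<le> p (z + nmul a u) - real a * c + (p (w + nmul b u) - real b * c)"
        by (intro bexI[of _ "a + b"]) (simp_all add: algebra_simps)
    next
      fix k i j :: nat
      show "real i + real j \<le> p (nmul i x + nmul j y + nmul k u) - real k * c" using c[of i j k] by simp
    next
      show "\<exists>a0\<in>UNIV. \<forall>w\<in>I. p (w + nmul a0 u) - real a0 * c \<le> p w"
        by (intro bexI[of _ 0]) simp_all
    qed (use w in auto)
    then show ?thesis by simp
  qed
  have shift_x: "p w + 1 \<le> p (w + x)" if "w \<in> I" for w
  proof (rule shift[OF x _ that])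
    show "real i + real j + real k * 1 \<le> p (nmul i x + nmul j y + nmul k x)" for i j k
      using low[of "i + k" j] by (simp add: nmul_add ac_simps)
  qed
  have shift_y: "p w + 1 \<le> p (w + y)" if "w \<in> I" for w
  proof (rule shift[OF I_y _ that])
    show "real i + real j + real k * 1 \<le> p (nmul i x + nmul j y + nmul k y)" for i j k
      using low[of i "j + k"] by (simp add: nmul_add ac_simps)
  qed
  have y_mult: "p w + real j \<le> p (w + nmul j y)" if "w \<in> I" for j w
    using that
  proof (induction j arbitrary: w)
    case (Suc j)
    then show ?case using shift_y[of w] Suc.IH[of "w + y"] by (simp add: I_add I_y add.assoc)
  qed simp
  have xy: "p w + (real i + real j) \<le> p (w + (nmul i x + nmul j y))" if "w \<in> I" for i j w
    using that
  proof (induction i arbitrary: w)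
    case (Suc i)
    then show ?case using shift_x[of w] Suc.IH[of "w + x"] by (simp add: I_add x add.assoc)
  qed (simp add: y_mult)
  \<comment> \<open>For c = p z the floor condition combines k p z <= p(k z) with the gain of at
    least 1 for each further x and y.\<close>
  have "p w + p z \<le> p (w + z)"
  proof (rule shift[OF z _ w])
    fix i j k
    have "real k * p z \<le> p (nmul k z)"
      using homog[OF _ z, of k] nn[OF I_0] by (cases "k = 0") auto
    then show "real i + real j + real k * p z \<le> p (nmul i x + nmul j y + nmul k z)"
      using xy[OF I_nmul[OF z], of k i j] by (simp add: ac_simps)
  qed
  then show ?thesis using sub[OF z w] by (simp add: add.commute)
qed

text \<open>Zorn's lemma for the reversed pointwise order, chains being bounded by their infimum.
  Members of P vanish off I, so comparison on I is comparison as functions.\<close>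

lemma ex_minimal:
  assumes "P \<noteq> {}"
  shows "\<exists>p\<in>P. \<forall>q\<in>P. (\<forall>w\<in>I. q w \<le> p w) \<longrightarrow> q = p"
proof -
  have "\<exists>p\<in>P. \<forall>q\<in>P. q \<le> p \<longrightarrow> q = p"
  proof (rule predicate_Zorn)
    show "partial_order_on P (relation_of (\<lambda>p q. q \<le> p) P)"
      by (rule partial_order_on_relation_ofI) auto
    fix C assume C: "C \<in> Chains (relation_of (\<lambda>p q. q \<le> p) P)"
    have CP: "C \<subseteq> P" and tot: "\<And>p q. p \<in> C \<Longrightarrow> q \<in> C \<Longrightarrow> p \<le> q \<or> q \<le> p"
      using C by (auto simp: Chains_def relation_of_def)
    show "\<exists>u\<in>P. \<forall>p\<in>C. u \<le> p"
    proof (cases "C = {}")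
      case True
      then show ?thesis using assms by blast
    next
      case False
      have sub: "\<exists>c\<in>C. c (z + w) \<le> a z + b w" if ab: "a \<in> C" "b \<in> C" and zw: "z \<in> I" "w \<in> I" for a b z w
      proof -
        obtain c where c: "c \<in> C" "c \<le> a" "c \<le> b" using tot[OF ab] ab by (metis order_refl)
        have "c (z + w) \<le> c z + c w" using CP c(1) zw by (auto simp: P_def)
        then show ?thesis using c le_funD[OF c(2), of z] le_funD[OF c(3), of w] by (intro bexI[of _ c]) linarith
      qed
      have nn: "0 \<le> a w" if "a \<in> C" "w \<in> I" for a w using CP that by (auto simp: P_def)
      have lower: "(INF p\<in>C. p w) \<le> a w" if "a \<in> C" "w \<in> I" for a w
        by (rule cINF_lower[OF bdd_belowI2[of C 0 "\<lambda>p. p w"]]) (use nn that in auto)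
      have in_P: "(\<lambda>w. if w \<in> I then INF p\<in>C. p w else 0) \<in> P"
      proof (rule INF_in_P(1)[where r = "\<lambda>p. p"])
        show "C \<noteq> {}" by (rule False)
        show "0 \<le> a w" if "a \<in> C" "w \<in> I" for a w using nn that .
        show "\<exists>c\<in>C. c (z + w) \<le> a z + b w" if "a \<in> C" "b \<in> C" "z \<in> I" "w \<in> I" for a b z w
          using sub that .
        show "a z \<le> a w" if "a \<in> C" "z \<in> I" "w \<in> I" "z \<le> w" for a z w
          using CP that by (auto simp: P_def)
        show "real i + real j \<le> a (nmul i x + nmul j y)" if "a \<in> C" for a i j
          using CP that by (auto simp: P_def)
        show "\<exists>a\<in>C. a y \<le> 1" using CP False by (auto simp: P_def)
      qed
      have "(\<lambda>w. if w \<in> I then INF p\<in>C. p w else 0) \<le> p" if "p \<in> C" for p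
        using lower[OF that] CP that by (auto simp: le_fun_def P_def)
      with in_P show ?thesis by blast
    qed
  qed
  then obtain p where p: "p \<in> P" "\<And>q. q \<in> P \<Longrightarrow> q \<le> p \<Longrightarrow> q = p" by blast
  have "q = p" if "q \<in> P" "\<forall>w\<in>I. q w \<le> p w" for q
  proof (rule p(2)[OF that(1)])
    have "q w = 0" "p w = 0" if "w \<notin> I" for w using p(1) \<open>q \<in> P\<close> that by (auto simp: P_def)
    then show "q \<le> p" using that(2) by (metis le_fun_def order_refl)
  qed
  with p(1) show ?thesis by blast
qed

text \<open>This makes P nonempty; the hypothesis is exactly the floor condition for the least
  multiple.\<close>

lemma least_multiple_in_P:
  assumes imp: "\<And>i j m. nmul i x + nmul j y \<le> nmul m y \<Longrightarrow> i + j \<le> m"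
  shows "(\<lambda>z. if z \<in> I then real (LEAST m. z \<le> nmul m y) else 0) \<in> P"
proof -
  define L where "L z = (LEAST m. z \<le> nmul m y)" for z
  have L: "z \<le> nmul (L z) y" if "z \<in> I" for z
    using that LeastI_ex[of "\<lambda>m. z \<le> nmul m y"] by (auto simp: I_def L_def)
  have L_le: "L z \<le> m" if "z \<le> nmul m y" for z m
    unfolding L_def using that by (rule Least_le)
  have "L z \<le> L w" if "z \<le> w" "w \<in> I" for z w
    using L[OF that(2)] that(1) by (intro L_le) simp
  moreover have "L (z + w) \<le> L z + L w" if "z \<in> I" "w \<in> I" for z w
    using L that by (intro L_le) (simp add: nmul_add add_mono)
  moreover have "L y \<le> 1" by (intro L_le) simp
  moreover have "i + j \<le> L (nmul i x + nmul j y)" for i j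
    by (rule imp[OF L[OF I_xy]])
  ultimately show ?thesis
    unfolding P_def L_def[symmetric] by (simp add: I_y I_nmul x I_add) (metis of_nat_add of_nat_le_iff)
qed

text \<open>The floor at j = 1 meets the condition p y <= 1, so the value at y is exactly 1. Setting
  f to \<infinity> off I preserves additivity because a sum lies in I only if both summands
  do.\<close>

lemma ex_state:
  assumes imp: "\<forall>i j m. nmul i x + nmul j y \<le> nmul m y \<longrightarrow> i + j \<le> m"
  shows "\<exists>f :: 'w \<Rightarrow> ennreal. (\<forall>z w. f (z + w) = f z + f w) \<and> (\<forall>z w. z \<le> w \<longrightarrow> f z \<le> f w) \<and>
    f y = 1 \<and> 1 \<le> f x \<and> (\<forall>z. z \<notin> I \<longrightarrow> f z = \<infinity>)"
proof -
  have "P \<noteq> {}" using least_multiple_in_P imp by blast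
  from ex_minimal[OF this] obtain p where p: "p \<in> P" and min: "\<And>q. q \<in> P \<Longrightarrow> (\<And>w. w \<in> I \<Longrightarrow> q w \<le> p w) \<Longrightarrow> q = p"
    by blast
  have add: "p (z + w) = p z + p w" if "z \<in> I" "w \<in> I" for z w
    by (rule minimal_additive[OF p min that])
  have nn: "0 \<le> p z" if "z \<in> I" for z using p that by (auto simp: P_def)
  have mono: "p z \<le> p w" if "z \<le> w" "z \<in> I" "w \<in> I" for z w using p that by (auto simp: P_def)
  have low: "real i + real j \<le> p (nmul i x + nmul j y)" for i j using p by (auto simp: P_def)
  have py: "p y = 1" using low[of 0 1] p by (auto simp: P_def)
  have px: "1 \<le> p x" using low[of 1 0] by simp
  define f where "f z = (if z \<in> I then ennreal (p z) else \<infinity>)" for z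
  have down: "z \<in> I" if "z \<le> w" "w \<in> I" for z w
    using that unfolding I_def by (blast intro: order_trans)
  have "f (z + w) = f z + f w" for z w
    by (auto simp: f_def I_add add nn ennreal_plus)
  moreover have "f z \<le> f w" if "z \<le> w" for z w
    using that down[OF that] mono[OF that] by (auto simp: f_def intro: ennreal_leI)
  moreover have "f y = 1" by (simp add: f_def I_y py)
  moreover have "1 \<le> f x" using px ennreal_leI[OF px] by (simp add: f_def x)
  moreover have "f z = \<infinity>" if "z \<notin> I" for z using that by (simp add: f_def)
  ultimately show ?thesis by blast
qed

end

end

text \<open>The first alternative is unavoidable: if 2 y <= y, no additive monotone f has f y = 1.
  If it fails, almost unperforation makes the multiples of y strictly increasing, and this starts
  the construction.\<close>

proposition almost_unperforated_comparison:
  fixes x y :: "'w::ordered_comm_monoid_add"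
  assumes pos: "\<And>z :: 'w. 0 \<le> z"
    and au: "\<And>(x::'w) y m n. 0 < m \<Longrightarrow> m < n \<Longrightarrow> nmul n x \<le> nmul m y \<Longrightarrow> x \<le> y"
    and not_le: "\<not> x \<le> y"
  shows "(\<forall>K. nmul K y \<le> y) \<or>
    (\<exists>f :: 'w \<Rightarrow> ennreal. (\<forall>z w. f (z + w) = f z + f w) \<and> (\<forall>z w. z \<le> w \<longrightarrow> f z \<le> f w) \<and> f y = 1 \<and> 1 \<le> f x)"
proof (cases "\<forall>K. nmul K y \<le> y")
  case False
  interpret X: state_extension x y by unfold_locales (rule pos)
  interpret Y: state_extension y y by unfold_locales (rule pos)
  \<comment> \<open>If (m + 1) y <= m y, then all multiples of y lie below m y, in particular (m +
    1) K y; for m > 0 almost unperforation, applied to K y and y, gives K y <= y.\<close>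
  have strict: "N \<le> m" if "nmul N y \<le> nmul m y" for N m
  proof (rule ccontr)
    assume "\<not> N \<le> m"
    then have "nmul (Suc m) y \<le> nmul N y" by (intro nmul_mono_left pos) auto
    then have Suc: "nmul (Suc m) y \<le> nmul m y" using that by simp
    have m_add: "nmul (m + k) y \<le> nmul m y" for k
    proof (induction k)
      case (Suc k)
      have "nmul (m + Suc k) y = nmul (Suc m) y + nmul k y" by (simp add: nmul_add ac_simps)
      also have "\<dots> \<le> nmul m y + nmul k y" by (rule add_right_mono) fact
      also have "\<dots> \<le> nmul m y" using Suc by (simp add: nmul_add)
      finally show ?case .
    qed simp
    have all: "nmul K y \<le> nmul m y" for K
      using nmul_mono_left[OF pos, of K "m + K" y] m_add[of K] by simp
    have "nmul K y \<le> y" for K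
    proof (cases "m = 0")
      case True
      then show ?thesis using all[of K] pos[of y] by simp
    next
      case False
      have "nmul (Suc m) (nmul K y) \<le> nmul m y" using all[of "Suc m * K"] by (simp only: nmul_nmul)
      then show ?thesis by (rule au[rotated 2]) (use False in auto)
    qed
    with False show False by blast
  qed
  show ?thesis
  proof (cases "x \<in> X.I")
    case True
    have perf: "\<forall>i j m. nmul i x + nmul j y \<le> nmul m y \<longrightarrow> i + j \<le> m"
    proof (intro allI impI, rule ccontr)
      fix i j m
      assume le: "nmul i x + nmul j y \<le> nmul m y"
      assume "\<not> i + j \<le> m"
      have "nmul j y \<le> nmul m y" using X.le_add2 le by (rule order_trans)
      then have jm: "j \<le> m" by (rule strict)
      define d where "d = m - j"
      have i: "Suc d \<le> i" using \<open>\<not> i + j \<le> m\<close> jm by (simp add: d_def)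
      have le': "nmul i x + nmul j y \<le> nmul d y + nmul j y" using le jm by (simp add: d_def nmul_add[symmetric])
      \<comment> \<open>The summand j y cannot be cancelled, so the inequality is iterated with j y
        kept on both sides. After j + 1 rounds the leftover j y on the right is outweighed, since (j
        + 1) d + j < (j + 1)(d + 1) <= (j + 1) i.\<close>
      have k: "nmul (k * i) x + nmul j y \<le> nmul (k * d) y + nmul j y" for k
      proof (induction k)
        case (Suc k)
        have "nmul (Suc k * i) x + nmul j y = nmul i x + (nmul (k * i) x + nmul j y)"
          by (simp add: nmul_add ac_simps)
        also have "\<dots> \<le> nmul i x + (nmul (k * d) y + nmul j y)" by (rule add_left_mono) fact
        also have "\<dots> = (nmul i x + nmul j y) + nmul (k * d) y" by (simp add: ac_simps)
        also have "\<dots> \<le> (nmul d y + nmul j y) + nmul (k * d) y" by (rule add_right_mono) fact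
        also have "\<dots> = nmul (Suc k * d) y + nmul j y" by (simp add: nmul_add ac_simps)
        finally show ?case .
      qed simp
      have "nmul (Suc j * i) x \<le> nmul (Suc j * i) x + nmul j y" by (rule X.le_add1)
      also have "\<dots> \<le> nmul (Suc j * d + j) y" using k[of "Suc j"] by (simp add: nmul_add)
      finally have le2: "nmul (Suc j * i) x \<le> nmul (Suc j * d + j) y" .
      have "Suc j * Suc d \<le> Suc j * i" using i by (rule mult_le_mono2)
      then have lt: "Suc j * d + j < Suc j * i" by simp
      have "x \<le> y"
      \<comment> \<open>Almost unperforation speaks of positive multiples of y, so the multiple 0 is
        treated apart.\<close>
      proof (cases "Suc j * d + j = 0")
        case True
        have "nmul 1 x \<le> nmul (Suc j * i) x" using lt by (intro nmul_mono_left pos) auto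
        also have "\<dots> \<le> 0" using le2 True by simp
        also have "0 \<le> y" by (rule pos)
        finally show ?thesis by simp
      qed (use au[OF _ lt le2] in auto)
      with not_le show False ..
    qed
    from X.ex_state[OF True perf] show ?thesis by (elim exE conjE) (intro disjI2 exI conjI)
  next
    case False
    \<comment> \<open>The order ideal depends on y alone. Hence the state is built with y in the
      role of x, and x, lying outside, receives the value \<infinity>.\<close>
    have perf: "\<forall>i j m. nmul i y + nmul j y \<le> nmul m y \<longrightarrow> i + j \<le> m"
      using strict by (simp add: nmul_add[symmetric])
    from Y.ex_state[OF Y.I_y perf] obtain f :: "'w \<Rightarrow> ennreal" where
      f: "\<forall>z w. f (z + w) = f z + f w" "\<forall>z w. z \<le> w \<longrightarrow> f z \<le> f w" "f y = 1" "\<forall>z. z \<notin> Y.I \<longrightarrow> f z = \<infinity>"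
      by (elim exE conjE) (rule that)
    have "x \<notin> Y.I" using False by (simp add: X.I_def Y.I_def)
    then have "1 \<le> f x" using f(4) by simp
    with f show ?thesis by blast
  qed
qed simp

section \<open>The Cuntz semigroup\<close>

text \<open>The comparing factors may come from the whole product algebra, since projecting to the
  N-th factor does not increase the norm.\<close>

lemma cuntz_leI:
  assumes a: "a \<in> matrices N" and b: "b \<in> matrices N"
    and le: "\<And>e. 0 < e \<Longrightarrow> \<exists>X. norm (X * mem N b * adj X - mem N a) < e"
  shows "cuntz_le a b"
proof -
  have "\<exists>x\<in>matrices N. mnorm N (mminus (mmult (mmult x b) (madj x)) a) < 1 / real (Suc k)" for k
  proof -
    obtain X where X: "norm (X * mem N b * adj X - mem N a) < 1 / real (Suc k)" using le[of "1 / real (Suc k)"] by auto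
    have "mpr N (X * mem N b * adj X - mem N a) = mminus (mmult (mmult (mpr N X) b) (madj (mpr N X))) a"
      by (simp add: mpr_minus mpr_times mpr_adj a b)
    then have "mnorm N (mminus (mmult (mmult (mpr N X) b) (madj (mpr N X))) a) < 1 / real (Suc k)"
      using X mnorm_mpr_le[of N "X * mem N b * adj X - mem N a"] by simp
    then show ?thesis using mpr_in_matrices by blast
  qed
  then obtain x where x: "\<And>k. x k \<in> matrices N"
      "\<And>k. mnorm N (mminus (mmult (mmult (x k) b) (madj (x k))) a) < 1 / real (Suc k)"
    by metis
  have "(\<lambda>k. mnorm N (mminus (mmult (mmult (x k) b) (madj (x k))) a)) \<longlonglongrightarrow> 0"
  proof (rule tendsto_sandwich[OF _ _ tendsto_const LIMSEQ_Suc[OF lim_1_over_n]])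
    show "\<forall>\<^sub>F k in sequentially. 0 \<le> mnorm N (mminus (mmult (mmult (x k) b) (madj (x k))) a)"
      by (simp add: mnorm_ge_0)
    show "\<forall>\<^sub>F k in sequentially. mnorm N (mminus (mmult (mmult (x k) b) (madj (x k))) a) \<le> 1 / real (Suc k)"
      by (intro always_eventually allI less_imp_le x)
  qed
  then show ?thesis using a b x(1) unfolding cuntz_le_def mtendsto_def by blast
qed

lemma cuntz_leE:
  assumes "cuntz_le a b"
  obtains n where "a \<in> matrices n" "b \<in> matrices n"
    "\<And>N e. n \<le> N \<Longrightarrow> 0 < e \<Longrightarrow> \<exists>X. norm (X * mem N b * adj X - mem N a) < e"
proof -
  obtain k where k: "a \<in> matrices k" "b \<in> matrices k" using assms unfolding cuntz_le_def by blast
  obtain l where l: "\<And>N e. l \<le> N \<Longrightarrow> 0 < e \<Longrightarrow> \<exists>x\<in>matrices N. mnorm N (mminus (mmult (mmult x b) (madj x)) a) < e"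
    using cuntz_le_approx[OF assms] by blast
  have n: "a \<in> matrices (max k l)" "b \<in> matrices (max k l)" by (rule matrices_in_mono[OF k(1)] matrices_in_mono[OF k(2)], simp)+
  have "\<exists>X. norm (X * mem N b * adj X - mem N a) < e" if N: "max k l \<le> N" and e: "0 < e" for N and e :: real
  proof -
    obtain x where x: "x \<in> matrices N" "mnorm N (mminus (mmult (mmult x b) (madj x)) a) < e"
      using l[of N e] N e by auto
    have ab: "a \<in> matrices N" "b \<in> matrices N" using n N matrices_in_mono by blast+
    have "norm (mem N x * mem N b * adj (mem N x) - mem N a) < e"
      using x ab by (simp add: mem_adj mem_times mem_minus norm_mem mmult_in_matrices madj_in_matrices mminus_in_matrices)
    then show ?thesis by blast
  qed
  then show ?thesis using that n by blast
qed

lemma cuntz_le_exact: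
  assumes "a \<in> matrices N" "b \<in> matrices N" "X * mem N b * adj X = mem N a"
  shows "cuntz_le a b"
  using assms(1,2) by (rule cuntz_leI) (use assms(3) in \<open>auto intro: exI[of _ X]\<close>)

lemma cuntz_le_refl:
  assumes "a \<in> matrices n" shows "cuntz_le a a"
  by (rule cuntz_le_exact[OF assms assms, of 1]) simp

text \<open>The summand 1 keeps the factor positive, so that one can divide by it even if X =
  0.\<close>

lemma norm_conj_le:
  fixes X :: "'a::unital_cstar_algebra"
  shows "norm (X * D * adj X) \<le> (1 + (norm X)\<^sup>2) * norm D"
proof -
  have "norm (X * D * adj X) \<le> (norm X)\<^sup>2 * norm D"
    using norm_mult_ineq[of "X * D" "adj X"] mult_right_mono[OF norm_mult_ineq[of X D], of "norm X"]
    by (simp add: power2_eq_square mult_ac)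
  then show ?thesis by (simp add: distrib_right add_increasing)
qed

lemma cuntz_le_trans:
  assumes ab: "cuntz_le a b" and bc: "cuntz_le b c"
  shows "cuntz_le a c"
proof -
  obtain k where k: "a \<in> matrices k" "b \<in> matrices k"
    "\<And>N e. k \<le> N \<Longrightarrow> 0 < e \<Longrightarrow> \<exists>X. norm (X * mem N b * adj X - mem N a) < e"
    using cuntz_leE[OF ab] by blast
  obtain l where l: "b \<in> matrices l" "c \<in> matrices l"
    "\<And>N e. l \<le> N \<Longrightarrow> 0 < e \<Longrightarrow> \<exists>X. norm (X * mem N c * adj X - mem N b) < e"
    using cuntz_leE[OF bc] by blast
  define N where "N = max k l"
  have N: "k \<le> N" "l \<le> N" by (auto simp: N_def)
  show ?thesis
  proof (rule cuntz_leI)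
    show "a \<in> matrices N" "c \<in> matrices N" using k l N matrices_in_mono by blast+
    fix e :: real assume e: "0 < e"
    obtain X where X: "norm (X * mem N b * adj X - mem N a) < e / 2" using k(3)[OF N(1), of "e/2"] e by auto
    define r where "r = 1 + (norm X)\<^sup>2"
    have r: "0 < r" by (simp add: r_def add_pos_nonneg)
    obtain Y where Y: "norm (Y * mem N c * adj Y - mem N b) < e / 2 / r"
      using l(3)[OF N(2), of "e/2/r"] e r by auto
    let ?D = "Y * mem N c * adj Y - mem N b"
    have "X * Y * mem N c * adj (X * Y) - mem N a = X * ?D * adj X + (X * mem N b * adj X - mem N a)"
      by (simp add: adj_mult algebra_simps)
    also have "norm \<dots> \<le> norm (X * ?D * adj X) + norm (X * mem N b * adj X - mem N a)"
      by (rule norm_triangle_ineq)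
    also have "norm (X * ?D * adj X) \<le> r * norm ?D" unfolding r_def by (rule norm_conj_le)
    also have "\<dots> \<le> e / 2" using Y r by (simp add: field_simps)
    finally have "norm (X * Y * mem N c * adj (X * Y) - mem N a) < e" using X by simp
    then show "\<exists>Z. norm (Z * mem N c * adj Z - mem N a) < e" by blast
  qed
qed

text \<open>It is enough to know z on the ranges of A and S B, because taking adjoints gives the
  relations on the right. Conjugates of direct sums are computed this way without block
  matrices.\<close>

lemma conj_add:
  fixes A B z :: "'a::unital_cstar_algebra"
  assumes A: "adj A = A" and B: "adj B = B" and zA: "z * A = x * A" and zB: "z * S * B = v * B"
  shows "z * (A + S * B * adj S) * adj z = x * A * adj x + v * B * adj v"
proof -
  have Az: "A * adj z = A * adj x" using arg_cong[OF zA, of adj] A by (simp add: adj_mult)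
  have Bz: "B * adj S * adj z = B * adj v" using arg_cong[OF zB, of adj] B by (simp add: adj_mult mult.assoc)
  have "z * (A + S * B * adj S) * adj z = (z * A) * adj z + (z * S * B) * (adj S * adj z)"
    by (simp add: algebra_simps)
  also have "\<dots> = x * (A * adj z) + v * (B * adj S * adj z)"
    by (simp only: zA zB) (simp only: mult.assoc)
  finally show ?thesis by (simp only: Az Bz) (simp only: mult.assoc)
qed

lemma mem_mid_mult: "a \<in> matrices n \<Longrightarrow> n \<le> N \<Longrightarrow> mem N (mid n) * mem N a = mem N a"
  by (simp add: mem_times matrices_in_mono[OF mid_in_matrices] matrices_in_mono mmult_mid_left)

lemma mem_mshift_adj_mid:
  assumes "d + m \<le> N"
  shows "adj (mem N (mshift m d)) * mem N (mid d) = (0 :: 'a::unital_cstar_algebra mat_prod)"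
proof -
  have w: "(mshift m d :: 'a mat_array) \<in> matrices N" by (rule mshift_in_matrices[OF assms])
  have d: "(mid d :: 'a mat_array) \<in> matrices N" by (rule matrices_in_mono[OF mid_in_matrices]) (use assms in simp)
  have "mmult (madj (mshift m d)) (mid d) = (\<lambda>i j. 0 :: 'a)"
    unfolding fun_eq_iff mmult_eq[OF madj_in_matrices[OF w]]
    by (auto simp: madj_def mshift_def mid_def intro!: sum.neutral)
  then show ?thesis by (simp add: mem_adj mem_times madj_in_matrices w d mem_zero)
qed

lemma mem_mid_mshift:
  assumes "d + m \<le> N"
  shows "mem N (mid d) * mem N (mshift m d) = (0 :: 'a::unital_cstar_algebra mat_prod)"
proof -
  have "(mid d :: 'a mat_array) \<in> matrices N" by (rule matrices_in_mono[OF mid_in_matrices]) (use assms in simp)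
  then show ?thesis
    using arg_cong[OF mem_mshift_adj_mid[OF assms], of "adj :: 'a mat_prod \<Rightarrow> _"] by (simp add: adj_mult adj_adj mem_adj)
qed

lemma adj_mem_pos: "a \<in> Minf_pos \<Longrightarrow> a \<in> matrices n \<Longrightarrow> adj (mem n a) = mem n a"
  by (rule cpos_adj[OF cpos_mem])

lemma cuntz_le_dsum:
  assumes ab: "cuntz_le a a'" "cuntz_le b b'" and a: "a \<in> matrices n" "a' \<in> matrices n'"
    and pos: "a' \<in> Minf_pos" "b' \<in> Minf_pos"
  shows "cuntz_le (dsum n a b) (dsum n' a' b')"
proof -
  obtain k where k: "\<And>N e. k \<le> N \<Longrightarrow> 0 < e \<Longrightarrow> \<exists>X. norm (X * mem N a' * adj X - mem N a) < e"
    using cuntz_leE[OF ab(1)] by blast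
  obtain m where m: "b \<in> matrices m" "b' \<in> matrices m"
    "\<And>N e. m \<le> N \<Longrightarrow> 0 < e \<Longrightarrow> \<exists>X. norm (X * mem N b' * adj X - mem N b) < e"
    using cuntz_leE[OF ab(2)] by blast
  define N where "N = max k (max (n + m) (n' + m))"
  have N: "k \<le> N" "n + m \<le> N" "n' + m \<le> N" by (auto simp: N_def)
  then have mN: "m \<le> N" "n \<le> N" "n' \<le> N" by auto
  have aN: "a' \<in> matrices N" and bN: "b' \<in> matrices N" using a m mN matrices_in_mono by blast+
  define S where "S = (mem N (mshift m n) :: 'a mat_prod)"
  define S' where "S' = (mem N (mshift m n') :: 'a mat_prod)"
  show ?thesis
  proof (rule cuntz_leI)
    show "dsum n a b \<in> matrices N" "dsum n' a' b' \<in> matrices N"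
      using dsum_in_matrices[OF m(1)] dsum_in_matrices[OF m(2)] N matrices_in_mono by blast+
    fix e :: real assume e: "0 < e"
    obtain X where X: "norm (X * mem N a' * adj X - mem N a) < e / 2" using k[OF N(1), of "e/2"] e by auto
    define r where "r = 1 + (norm S)\<^sup>2"
    have r: "0 < r" by (simp add: r_def add_pos_nonneg)
    obtain Y where Y: "norm (Y * mem N b' * adj Y - mem N b) < e / 2 / r"
      using m(3)[OF mN(1), of "e/2/r"] e r by auto
    \<comment> \<open>The projection \<open>mid n'\<close> lets X act on the first block and kills
      S'. On the second block, \<open>adj S'\<close> moves b' to the front, Y acts there and S moves
      the result behind a; the same \<open>adj S'\<close> kills a'.\<close>
    define z where "z = X * mem N (mid n') + S * Y * adj S'"
    have "adj S' * mem N a' = adj S' * mem N (mid n') * mem N a'"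
      using mem_mid_mult[OF a(2) mN(3)] by (simp add: mult.assoc)
    then have S'a: "adj S' * mem N a' = 0" by (simp add: S'_def mem_mshift_adj_mid[OF N(3)])
    have za: "z * mem N a' = X * mem N a'"
      by (simp add: z_def distrib_right mult.assoc mem_mid_mult[OF a(2) mN(3)] S'a)
    have "z * S' = S * Y * mem N (mid m)"
      by (simp add: z_def distrib_right mult.assoc S'_def mem_mid_mshift[OF N(3)] mem_mshift_adj_mult[OF N(3)])
    then have zb: "z * S' * mem N b' = S * Y * mem N b'"
      by (simp add: mult.assoc mem_mid_mult[OF m(2) mN(1)])
    let ?D = "Y * mem N b' * adj Y - mem N b"
    have "z * mem N (dsum n' a' b') * adj z = X * mem N a' * adj X + S * Y * mem N b' * adj (S * Y)"
      unfolding mem_dsum[OF a(2) m(2) N(3)] S'_def[symmetric]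
      by (rule conj_add[OF adj_mem_pos[OF pos(1) aN] adj_mem_pos[OF pos(2) bN] za zb])
    then have "z * mem N (dsum n' a' b') * adj z - mem N (dsum n a b) = (X * mem N a' * adj X - mem N a) + S * ?D * adj S"
      unfolding mem_dsum[OF a(1) m(1) N(2)] S_def[symmetric] by (simp add: adj_mult algebra_simps)
    also have "norm \<dots> \<le> norm (X * mem N a' * adj X - mem N a) + norm (S * ?D * adj S)"
      by (rule norm_triangle_ineq)
    also have "norm (S * ?D * adj S) \<le> r * norm ?D" unfolding r_def by (rule norm_conj_le)
    also have "\<dots> \<le> e / 2" using Y r by (simp add: field_simps)
    finally have "norm (z * mem N (dsum n' a' b') * adj z - mem N (dsum n a b)) < e" using X by simp
    then show "\<exists>Z. norm (Z * mem N (dsum n' a' b') * adj Z - mem N (dsum n a b)) < e" by blast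
  qed
qed

lemma cuntz_le_dsum_commute:
  assumes a: "a \<in> matrices n" "a \<in> Minf_pos" and b: "b \<in> matrices m" "b \<in> Minf_pos"
  shows "cuntz_le (dsum n a b) (dsum m b a)"
proof -
  define N where "N = n + m"
  have N: "n + m \<le> N" "m + n \<le> N" "n \<le> N" "m \<le> N" by (simp_all add: N_def)
  have aN: "a \<in> matrices N" and bN: "b \<in> matrices N" using a b N matrices_in_mono by blast+
  define S where "S = (mem N (mshift m n) :: 'a mat_prod)"
  define S' where "S' = (mem N (mshift n m) :: 'a mat_prod)"
  \<comment> \<open>The block permutation: the first block, of size m, moves behind position n, and
    the second returns to the front.\<close>
  define z where "z = S * mem N (mid m) + adj S'"
  have "adj S' * mem N b = adj S' * mem N (mid m) * mem N b"
    using mem_mid_mult[OF b(1) N(4)] by (simp add: mult.assoc)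
  then have "adj S' * mem N b = 0" by (simp add: S'_def mem_mshift_adj_mid[OF N(2)])
  then have zb: "z * mem N b = S * mem N b"
    by (simp add: z_def distrib_right mult.assoc mem_mid_mult[OF b(1) N(4)])
  have "z * S' = mem N (mid n)"
    by (simp add: z_def distrib_right mult.assoc S'_def mem_mid_mshift[OF N(2)] mem_mshift_adj_mult[OF N(2)])
  then have za: "z * S' * mem N a = 1 * mem N a"
    by (simp add: mem_mid_mult[OF a(1) N(3)])
  show ?thesis
  proof (rule cuntz_le_exact[of _ N])
    show "dsum n a b \<in> matrices N" "dsum m b a \<in> matrices N"
      using dsum_in_matrices[OF b(1), of n] dsum_in_matrices[OF a(1), of m] by (simp_all add: N_def add.commute)
    show "z * mem N (dsum m b a) * adj z = mem N (dsum n a b)"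
      unfolding mem_dsum[OF b(1) a(1) N(2)] mem_dsum[OF a(1) b(1) N(1)] S_def[symmetric] S'_def[symmetric]
      using conj_add[OF adj_mem_pos[OF b(2) bN] adj_mem_pos[OF a(2) aN] zb za] by simp
  qed
qed

lemma dsum_assoc:
  assumes "a \<in> matrices n" "b \<in> matrices m"
  shows "dsum (n + m) (dsum n a b) c = dsum n a (dsum m b c)"
proof (intro ext)
  fix i j
  show "dsum (n + m) (dsum n a b) c i j = dsum n a (dsum m b c) i j"
    using matrices_0[OF assms(1)] matrices_0[OF assms(2)] 
    by (auto simp: dsum_def less_diff_conv2 le_diff_conv2 add.commute)
qed

lemma Minf_pos_zero: "(\<lambda>i j. 0) \<in> Minf_pos"
  using Minf_posI[of "\<lambda>i j. 0" 0] by (simp add: mmult_def)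

lemma Minf_pos_dsum:
  assumes "a \<in> Minf_pos" "a \<in> matrices n" "b \<in> Minf_pos"
  shows "dsum n a b \<in> Minf_pos"
proof -
  obtain m where b: "b \<in> matrices m" using assms(3) by (rule Minf_posE)
  have N: "a \<in> matrices (n + m)" "b \<in> matrices (n + m)" using assms b by (auto intro: matrices_in_mono)
  have "cpos (mem (n + m) (dsum n a b))"
    unfolding mem_dsum[OF assms(2) b order_refl]
    using cpos_conj[OF cpos_mem[OF assms(3) N(2)], of "adj (mem (n + m) (mshift m n))"]
    by (intro cpos_add cpos_mem assms N) (simp add: adj_adj)
  from Minf_pos_mpr[OF this, of "n + m"] show ?thesis by (simp add: dsum_in_matrices[OF b])
qed

lemma Minf_pos_matrices: "a \<in> Minf_pos \<Longrightarrow> \<exists>n. a \<in> matrices n"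
  by (erule Minf_posE) blast

section \<open>The quotient as an ordered commutative monoid\<close>

lemma equiv_cuntz_rel: "equiv Minf_pos cuntz_rel"
proof (rule equivI)
  show "refl_on Minf_pos cuntz_rel"
    using Minf_pos_matrices cuntz_le_refl by (fastforce simp: refl_on_def cuntz_rel_def)
  show "sym cuntz_rel" by (auto simp: sym_def cuntz_rel_def)
  show "trans cuntz_rel" unfolding trans_def cuntz_rel_def using cuntz_le_trans by blast
  show "cuntz_rel \<subseteq> Minf_pos \<times> Minf_pos" by (auto simp: cuntz_rel_def)
qed

lemma cuntz_class_self: "a \<in> Minf_pos \<Longrightarrow> a \<in> cuntz_class a"
  unfolding cuntz_class_def by (rule equiv_class_self[OF equiv_cuntz_rel])

lemma cuntz_class_iff: "b \<in> cuntz_class a \<longleftrightarrow> a \<in> Minf_pos \<and> b \<in> Minf_pos \<and> cuntz_le a b \<and> cuntz_le b a"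
  by (auto simp: cuntz_class_def cuntz_rel_def)

lemma cuntz_class_eqI:
  "a \<in> Minf_pos \<Longrightarrow> b \<in> Minf_pos \<Longrightarrow> cuntz_le a b \<Longrightarrow> cuntz_le b a \<Longrightarrow> cuntz_class a = cuntz_class b"
  unfolding cuntz_class_def by (rule equiv_class_eq[OF equiv_cuntz_rel]) (simp add: cuntz_rel_def)

lemma cuntz_class_in: "a \<in> Minf_pos \<Longrightarrow> cuntz_class a \<in> cuntz_semigroup"
  unfolding cuntz_class_def cuntz_semigroup_def by (rule quotientI)

lemma cuntz_semigroupE:
  assumes "X \<in> cuntz_semigroup"
  obtains a where "a \<in> Minf_pos" "X = cuntz_class a"
  using assms unfolding cuntz_semigroup_def cuntz_class_def by (elim quotientE)

lemma W_le_class: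
  assumes "a \<in> Minf_pos" "b \<in> Minf_pos"
  shows "W_le (cuntz_class a) (cuntz_class b) \<longleftrightarrow> cuntz_le a b"
proof
  assume "W_le (cuntz_class a) (cuntz_class b)"
  then obtain a' b' where "cuntz_le a a'" "cuntz_le a' b'" "cuntz_le b' b"
    by (auto simp: W_le_def cuntz_class_iff)
  then show "cuntz_le a b" using cuntz_le_trans by blast
qed (use assms in \<open>auto simp: W_le_def intro: cuntz_class_self\<close>)

lemma W_add_class:
  assumes a: "a \<in> Minf_pos" "a \<in> matrices n" and b: "b \<in> Minf_pos"
  shows "W_add (cuntz_class a) (cuntz_class b) = cuntz_class (dsum n a b)"
proof -
  have eq: "cuntz_class (dsum n' a' b') = cuntz_class (dsum n a b)"
    if "a' \<in> cuntz_class a" "b' \<in> cuntz_class b" "a' \<in> matrices n'" for a' b' n'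
  proof -
    have *: "a' \<in> Minf_pos" "cuntz_le a a'" "cuntz_le a' a" "b' \<in> Minf_pos" "cuntz_le b b'" "cuntz_le b' b"
      using that by (auto simp: cuntz_class_iff)
    show ?thesis
      by (intro cuntz_class_eqI Minf_pos_dsum cuntz_le_dsum * a b that(3))
  qed
  \<comment> \<open>All members of the union are the same class and there is at least one of
    them.\<close>
  have "W_add (cuntz_class a) (cuntz_class b)
      = (\<Union>a'\<in>cuntz_class a. \<Union>b'\<in>cuntz_class b. \<Union>n'\<in>{n'. a' \<in> matrices n'}. cuntz_class (dsum n a b))"
    unfolding W_add_def using eq by (intro SUP_cong refl) auto
  also have "\<dots> = cuntz_class (dsum n a b)"
    using cuntz_class_self[OF a(1)] cuntz_class_self[OF b] a(2) by blast
  finally show ?thesis .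
qed

text \<open>As a type the semigroup can be an instance of \<open>ordered_comm_monoid_add\<close>,
  the setting of \<open>almost_unperforated_comparison\<close>. The order is antisymmetric because
  Cuntz equivalent elements are identified.\<close>

typedef (overloaded) ('a::unital_cstar_algebra) cuntz_sg = "cuntz_semigroup :: 'a mat_array set set"
  using cuntz_class_in[OF Minf_pos_zero] by blast

definition cls :: "'a::unital_cstar_algebra mat_array \<Rightarrow> 'a cuntz_sg" where
  "cls a = Abs_cuntz_sg (cuntz_class a)"

lemma Rep_cls: "a \<in> Minf_pos \<Longrightarrow> Rep_cuntz_sg (cls a) = cuntz_class a"
  by (simp add: cls_def Abs_cuntz_sg_inverse cuntz_class_in)

lemma cls_cases:
  obtains a n where "a \<in> Minf_pos" "a \<in> matrices n" "x = cls a"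
proof -
  obtain a where "a \<in> Minf_pos" "Rep_cuntz_sg x = cuntz_class a"
    using Rep_cuntz_sg[of x] by (rule cuntz_semigroupE)
  then show ?thesis using that Minf_pos_matrices by (metis Rep_cuntz_sg_inverse cls_def)
qed

instantiation cuntz_sg :: (unital_cstar_algebra) ordered_comm_monoid_add
begin

definition "0 = cls (\<lambda>i j. 0 :: 'a)"
definition "x + y = Abs_cuntz_sg (W_add (Rep_cuntz_sg x) (Rep_cuntz_sg y))"
definition "x \<le> y \<longleftrightarrow> W_le (Rep_cuntz_sg x) (Rep_cuntz_sg y)"
definition "x < y \<longleftrightarrow> x \<le> y \<and> \<not> (y \<le> (x :: 'a cuntz_sg))"

lemma cls_add:
  assumes "a \<in> Minf_pos" "a \<in> matrices n" "b \<in> Minf_pos"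
  shows "cls a + cls b = cls (dsum n a b)"
proof -
  have "cls a + cls b = Abs_cuntz_sg (W_add (cuntz_class a) (cuntz_class b))"
    by (simp only: plus_cuntz_sg_def Rep_cls assms)
  then show ?thesis by (simp only: W_add_class[OF assms] cls_def)
qed

lemma cls_le:
  assumes "a \<in> Minf_pos" "b \<in> Minf_pos"
  shows "cls a \<le> cls b \<longleftrightarrow> cuntz_le a b"
  unfolding less_eq_cuntz_sg_def Rep_cls[OF assms(1)] Rep_cls[OF assms(2)] by (rule W_le_class[OF assms])

lemma cls_eqI:
  assumes "a \<in> Minf_pos" "b \<in> Minf_pos" "cuntz_le a b" "cuntz_le b a"
  shows "cls a = cls b"
  unfolding cls_def using cuntz_class_eqI[OF assms] by simp

instance
proof
  fix x y z :: "'a cuntz_sg"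
  obtain a n where a: "a \<in> Minf_pos" "a \<in> matrices n" "x = cls a" by (rule cls_cases)
  obtain b m where b: "b \<in> Minf_pos" "b \<in> matrices m" "y = cls b" by (rule cls_cases)
  obtain c k where c: "c \<in> Minf_pos" "c \<in> matrices k" "z = cls c" by (rule cls_cases)
  have ab: "dsum n a b \<in> Minf_pos" "dsum n a b \<in> matrices (n + m)"
    using Minf_pos_dsum[OF a(1,2) b(1)] dsum_in_matrices[OF b(2)] by auto
  have ba: "dsum m b a \<in> Minf_pos" and bc: "dsum m b c \<in> Minf_pos"
    using Minf_pos_dsum[OF b(1,2) a(1)] Minf_pos_dsum[OF b(1,2) c(1)] by auto
  show "x + y + z = x + (y + z)"
    by (simp add: a(3) b(3) c(3) cls_add[OF a(1,2) b(1)] cls_add[OF ab c(1)] cls_add[OF b(1,2) c(1)]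
        cls_add[OF a(1,2) bc] dsum_assoc[OF a(2) b(2)])
  show comm: "x + y = y + x"
    unfolding a(3) b(3) cls_add[OF a(1,2) b(1)] cls_add[OF b(1,2) a(1)]
    by (intro cls_eqI ab ba cuntz_le_dsum_commute a b)
  have "cls (\<lambda>i j. 0) + x = cls (dsum 0 (\<lambda>i j. 0) a)"
    unfolding a(3) by (rule cls_add[OF Minf_pos_zero zero_in_matrices a(1)])
  also have "dsum 0 (\<lambda>i j. 0) a = a" by (simp add: dsum_def)
  finally show "0 + x = x" by (simp add: zero_cuntz_sg_def a(3))
  show "x < y \<longleftrightarrow> x \<le> y \<and> \<not> y \<le> x" by (rule less_cuntz_sg_def)
  show "x \<le> x" using cuntz_le_refl[OF a(2)] by (simp add: a(3) cls_le[OF a(1) a(1)])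
  show "x \<le> z" if "x \<le> y" "y \<le> z"
    using that cuntz_le_trans by (simp add: a(3) b(3) c(3) cls_le a(1) b(1) c(1)) blast
  show "x = y" if "x \<le> y" "y \<le> x"
    using that cls_eqI[OF a(1) b(1)] by (simp add: a(3) b(3) cls_le a(1) b(1))
  show "z + x \<le> z + y" if "x \<le> y"
  proof -
    have "cuntz_le a b" using that by (simp add: a(3) b(3) cls_le a(1) b(1))
    then have "cuntz_le (dsum k c a) (dsum k c b)"
      by (intro cuntz_le_dsum cuntz_le_refl[OF c(2)] c b)
    then show ?thesis
      by (simp add: a(3) b(3) c(3) cls_add[OF c(1,2) a(1)] cls_add[OF c(1,2) b(1)]
          cls_le[OF Minf_pos_dsum[OF c(1,2) a(1)] Minf_pos_dsum[OF c(1,2) b(1)]])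
  qed
qed

end

lemma cuntz_sg_nonneg: "0 \<le> (x :: 'a::unital_cstar_algebra cuntz_sg)"
proof -
  obtain a n where a: "a \<in> Minf_pos" "a \<in> matrices n" "x = cls a" by (rule cls_cases)
  have "cuntz_le (\<lambda>i j. 0) a"
    by (rule cuntz_le_exact[OF zero_in_matrices a(2), of 0]) (simp add: mem_zero)
  then show ?thesis by (simp add: zero_cuntz_sg_def a(3) cls_le[OF Minf_pos_zero a(1)])
qed

lemma Rep_nmul: "Rep_cuntz_sg (nmul n x) = W_times n (Rep_cuntz_sg x)"
proof (induction n)
  case 0
  then show ?case by (simp add: W_times_def zero_cuntz_sg_def Rep_cls[OF Minf_pos_zero])
next
  case (Suc n)
  obtain a k where a: "a \<in> Minf_pos" "a \<in> matrices k" "x = cls a" by (rule cls_cases)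
  obtain b m where b: "b \<in> Minf_pos" "b \<in> matrices m" "nmul n x = cls b" by (rule cls_cases)
  have "Rep_cuntz_sg (x + nmul n x) = W_add (Rep_cuntz_sg x) (Rep_cuntz_sg (nmul n x))"
    unfolding a(3) b(3)[unfolded a(3)] cls_add[OF a(1,2) b(1)]
    by (simp add: Rep_cls a(1) b(1) Minf_pos_dsum a(2) W_add_class[OF a(1,2) b(1)])
  then show ?case using Suc by (simp add: W_times_def)
qed

lemma almost_unperforated_nmul:
  fixes x y :: "'a::unital_cstar_algebra cuntz_sg"
  assumes "almost_unperforated TYPE('a)" "0 < m" "m < n" "nmul n x \<le> nmul m y"
  shows "x \<le> y"
  using assms Rep_cuntz_sg[of x] Rep_cuntz_sg[of y]
  unfolding almost_unperforated_def less_eq_cuntz_sg_def Rep_nmul by (metis less_trans)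

lemma cls_mcopies:
  assumes b: "b \<in> Minf_pos" "b \<in> matrices m"
  shows "mcopies m K b \<in> Minf_pos \<and> cls (mcopies m K b) = nmul K (cls b)"
proof (induction K)
  case (Suc K)
  have c: "mcopies m K b \<in> matrices (K * m)" by (rule mcopies_in_matrices[OF b(2)])
  show ?case
    using Suc Minf_pos_dsum[OF _ c b(1)] cls_add[OF _ c b(1)] by (simp add: add.commute)
qed (simp_all add: Minf_pos_zero zero_cuntz_sg_def)

section \<open>Weak strict comparison\<close>

text \<open>The restriction to \<open>Minf_pos\<close> supplies the extensionality built into
  \<open>dimension_functions\<close>.\<close>

lemma dimension_function_of_state:
  fixes f :: "'a::unital_cstar_algebra cuntz_sg \<Rightarrow> ennreal"
  assumes add: "\<forall>z w. f (z + w) = f z + f w" and mono: "\<forall>z w. z \<le> w \<longrightarrow> f z \<le> f w"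
  shows "restrict (\<lambda>c. f (cls c)) Minf_pos \<in> dimension_functions"
  unfolding dimension_functions_def
proof (intro CollectI conjI allI ballI impI)
  fix n and a b :: "'a mat_array" assume a: "a \<in> Minf_pos \<inter> matrices n" and b: "b \<in> Minf_pos"
  have "f (cls (dsum n a b)) = f (cls a) + f (cls b)"
    using add cls_add[of a n b] a b by (metis IntE)
  then show "restrict (\<lambda>c. f (cls c)) Minf_pos (dsum n a b)
      = restrict (\<lambda>c. f (cls c)) Minf_pos a + restrict (\<lambda>c. f (cls c)) Minf_pos b"
    using a b by (simp add: Minf_pos_dsum)
next
  fix a b :: "'a mat_array" assume "a \<in> Minf_pos" "b \<in> Minf_pos" "cuntz_le a b"
  then show "restrict (\<lambda>c. f (cls c)) Minf_pos a \<le> restrict (\<lambda>c. f (cls c)) Minf_pos b"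
    using mono by (simp add: cls_le)
qed simp

theorem theorem3p6:
  assumes "ideal_property TYPE('a::unital_cstar_algebra)"
    and "strict_comparison_of_projections TYPE('a)"
    and "finite (extremal_quasitraces :: ('a \<Rightarrow> complex) set)"
    and "almost_unperforated TYPE('a)"
  shows "weak_strict_comparison TYPE('a)"
proof -
  have QT: "(QT :: ('a \<Rightarrow> complex) set) \<noteq> {}"
    using assms(2) by (simp add: strict_comparison_of_projections_def)
  have "cuntz_le a b" if a: "a \<in> Minf_pos" and b: "b \<in> Minf_pos"
    and d: "\<And>d. d \<in> d_qt ` QT \<union> {f \<in> dimension_functions - d_qt ` QT. f b = 1} \<Longrightarrow> d a < d b"
    for a b :: "'a mat_array"
  proof (rule ccontr)
    assume "\<not> cuntz_le a b"
    then have "\<not> cls a \<le> cls b" by (simp add: cls_le a b)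
    then have "(\<forall>K. nmul K (cls b) \<le> cls b) \<or> (\<exists>f :: 'a cuntz_sg \<Rightarrow> ennreal. (\<forall>z w. f (z + w) = f z + f w) \<and>
        (\<forall>z w. z \<le> w \<longrightarrow> f z \<le> f w) \<and> f (cls b) = 1 \<and> 1 \<le> f (cls a))"
      by (intro almost_unperforated_comparison cuntz_sg_nonneg) (rule almost_unperforated_nmul[OF assms(4)])
    then show False
    proof (elim disjE exE conjE)
      assume mult: "\<forall>K. nmul K (cls b) \<le> cls b"
      obtain m where m: "b \<in> matrices m" using Minf_pos_matrices[OF b] by blast
      have "cuntz_le (mcopies m K b) b" for K
        using mult cls_mcopies[OF b m, of K] cls_le[OF _ b, of "mcopies m K b"] by metis
      moreover obtain \<tau> :: "'a \<Rightarrow> complex" where "\<tau> \<in> QT" using QT by blast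
      \<comment> \<open>The value \<open>d_qt \<tau> b\<close> is 0, and nothing in
        \<open>ennreal\<close> is smaller; a single \<tau> gives the contradiction, and
        \<open>QT\<close> is nonempty.\<close>
      ultimately show False using d_qt_eq_0[OF _ b m, of \<tau>] d[of "d_qt \<tau>"] by simp
    next
      fix f :: "'a cuntz_sg \<Rightarrow> ennreal"
      assume f: "\<forall>z w. f (z + w) = f z + f w" "\<forall>z w. z \<le> w \<longrightarrow> f z \<le> f w" "f (cls b) = 1" "1 \<le> f (cls a)"
      let ?g = "restrict (\<lambda>c. f (cls c)) Minf_pos"
      have "?g b = 1" "1 \<le> ?g a" using f a b by simp_all
      \<comment> \<open>If \<open>?g\<close> is some \<open>d_qt \<tau>\<close>, it lies in the
        first set of the union; if not, it lies in the second because its value at b is 1.\<close>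
      moreover have "?g a < ?g b"
        using dimension_function_of_state[OF f(1,2)] \<open>?g b = 1\<close> by (intro d) blast
      ultimately show False by simp
    qed
  qed
  then show ?thesis
    using QT unfolding weak_strict_comparison_def by blast
qed

end
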